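(* For every timed automaton, the abstraction $\mathrm{Extra}_{L\bar U}$ is lift-safe. The Zenoness problem $\mathsf{ZP}^{\mathfrak a}$ can be solved in polynomial time for $\mathfrak a=\mathrm{Extra}_{L\bar U}$.
   Context: Timed automata: clocks $X$, valuations $v:X\to\mathbb R_{\ge0}$, $v+\delta$, resets $[R]v$; $\mathcal A=(Q,q_0,X,T)$ with transitions $(q,g,R,q')$, guards being conjunctions of $x\#c$, $\#\in\{<,\le,=,\ge,>\}$, $c\in\mathbb N$. A run is $(q_0,\mathbf 0)\xrightarrow{\delta_0,t_0}(q_1,v_1)\cdots$ (delay $\delta_i$ then transition $t_i$, whose guard must hold after the delay). An infinite run is Zeno if $\sum\delta_i<\infty$. Zones: sets of valuations defined by conjunctions of $x\sim c$, $x-y\sim c$ ($c\in\mathbb Z$). Zone graph: initial node $(q_0,Z_0)$, $Z_0=\{\mathbf 0+\delta\}$; $(q,Z)\Rightarrow^t(q',Z')$ with $Z'=\{[R]v+\delta:v\in Z,v\models g,\delta\ge0\}$ (when nonempty). For a finite abstraction $\mathfrak a$ (zone $\mapsto$ zone, extensive, idempotent, finite range), $\mathrm{ZG}^{\mathfrak a}(\mathcal A)$ is the graph reachable from $(q_0,\mathfrak a(Z_0))$ with $(q,Z)\Rightarrow^t_{\mathfrak a}(q',\mathfrak a(Z'))$ when $\mathfrak a(Z)=Z$ and $(q,Z)\Rightarrow^t(q',Z')$. Extrapolation: $X=\{x_1,\dots,x_n\}$ plus $x_0\equiv0$; a nonempty zone is given by its canonical DBM $Z_{ij}=(c_{ij},\preccurlyeq_{ij})$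 or $(\infty,<)$ meaning $x_i-x_j\preccurlyeq_{ij}c_{ij}$. $L(x)$ (resp. $U(x)$) is the largest $c$ such that $x>c$ or $x\ge c$ (resp. $x<c$ or $x\le c$) occurs in a guard of $\mathcal A$ (an equality counting as both), $-\infty$ if none. The weak upper bound is $\bar U(x)=1$ if $L(x)\ge1$ and $U(x)=-\infty$, and $\bar U(x)=U(x)$ otherwise; $L(x_0)=\bar U(x_0)=0$. $\mathrm{Extra}_{L\bar U}(Z)$ has DBM entries (cases in order): $(\infty,<)$ if $c_{ij}>L(x_i)$; $(-\bar U(x_j),<)$ if $-c_{ij}>\bar U(x_j)$; $Z_{ij}$ otherwise. $\mathrm{Lf}(\mathcal A)$ is the set of clocks $x$ such that the guard of some transition of $\mathcal A$ implies $x\ge1$. $\mathfrak a$ is lift-safe if for every zone $Z$ and every $x\in\mathrm{Lf}(\mathcal A)$: $Z\models x\ge1$ iff $\mathfrak a(Z)\models x\ge1$. $\mathsf{ZP}^{\mathfrak a}$: given $\mathcal A$ and $\mathrm{ZG}^{\mathfrak a}(\mathcal A)$, decide whether $\mathcal A$ has a Zeno run.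
   Formalization: Lift-safety is proved only for automata whose guards are all satisfiable and in which no clock x in Lf(A) has U(x)=0; without these it can fail (e.g. guards x≥1 and x≤0 turn the zone x≥1 into x>0). The polynomial-time claim is proved for all timed automata. *)

theory Defs
  imports Complex_Main "HOL-Library.Option_ord" "HOL-Computational_Algebra.Polynomial"
begin

section \<open>Timed automata\<close>

text \<open>
  The clocks of an automaton are \<open>1, \<dots>, n\<close>; index \<open>0\<close> is the reference clock \<open>x\<^sub>0\<close>, which is
  constantly \<open>0\<close>.  Locations are natural numbers, so that automata can be inputs of programs.
\<close>

datatype cmp = CLt | CLe | CEq | CGe | CGt

fun cmp_holds :: "cmp \<Rightarrow> real \<Rightarrow> real \<Rightarrow> bool" where
  "cmp_holds CLt a b \<longleftrightarrow> a < b"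
| "cmp_holds CLe a b \<longleftrightarrow> a \<le> b"
| "cmp_holds CEq a b \<longleftrightarrow> a = b"
| "cmp_holds CGe a b \<longleftrightarrow> a \<ge> b"
| "cmp_holds CGt a b \<longleftrightarrow> a > b"

type_synonym valuation = "nat \<Rightarrow> real"
type_synonym guard = "(nat \<times> cmp \<times> nat) list"

record transition =
  src :: nat
  guard :: guard
  resets :: "nat list"
  tgt :: nat

record ta =
  locs :: "nat list"
  init :: nat
  nclocks :: nat
  trans :: "transition list"

definition timed_automaton :: "ta \<Rightarrow> bool" where
  "timed_automaton A \<longleftrightarrow> init A \<in> set (locs A) \<and>
     (\<forall>t\<in>set (trans A). src t \<in> set (locs A) \<and> tgt t \<in> set (locs A) \<and>
        (\<forall>(x, _, _)\<in>set (guard t). x \<in> {1..nclocks A}) \<and> set (resets t) \<subseteq> {1..nclocks A})"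

text \<open>
  The value at indices above \<open>n\<close> is fixed to \<open>0\<close>, so that valuations of \<open>n\<close> clocks are equal
  iff they agree on the clocks.
\<close>

definition valuation :: "nat \<Rightarrow> valuation \<Rightarrow> bool" where
  "valuation n v \<longleftrightarrow> (\<forall>i\<in>{1..n}. 0 \<le> v i) \<and> (\<forall>i. i \<notin> {1..n} \<longrightarrow> v i = 0)"

definition delay :: "nat \<Rightarrow> valuation \<Rightarrow> real \<Rightarrow> valuation" where
  "delay n v d = (\<lambda>i. if i \<in> {1..n} then v i + d else v i)"

definition reset :: "nat list \<Rightarrow> valuation \<Rightarrow> valuation" where
  "reset R v = (\<lambda>i. if i \<in> set R then 0 else v i)"

definition sat_guard :: "valuation \<Rightarrow> guard \<Rightarrow> bool" where
  "sat_guard v g \<longleftrightarrow> (\<forall>(x, op, c)\<in>set g. cmp_holds op (v x) (real c))"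

definition infinite_run ::
    "ta \<Rightarrow> (nat \<Rightarrow> nat) \<Rightarrow> (nat \<Rightarrow> valuation) \<Rightarrow> (nat \<Rightarrow> real) \<Rightarrow> (nat \<Rightarrow> transition) \<Rightarrow> bool" where
  "infinite_run A q v \<delta> t \<longleftrightarrow> q 0 = init A \<and> v 0 = (\<lambda>_. 0) \<and>
     (\<forall>i. t i \<in> set (trans A) \<and> 0 \<le> \<delta> i \<and>
          src (t i) = q i \<and> sat_guard (delay (nclocks A) (v i) (\<delta> i)) (guard (t i)) \<and>
          q (Suc i) = tgt (t i) \<and>
          v (Suc i) = reset (resets (t i)) (delay (nclocks A) (v i) (\<delta> i)))"

definition has_zeno_run :: "ta \<Rightarrow> bool" where
  "has_zeno_run A \<longleftrightarrow> (\<exists>q v \<delta> t. infinite_run A q v \<delta> t \<and> summable \<delta>)"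

section \<open>Zones and zone graphs\<close>

text \<open>An atom \<open>(x, y, \<sim>, c)\<close> is \<open>x - y \<sim> c\<close>; with \<open>y = 0\<close> it is the one-clock constraint \<open>x \<sim> c\<close>.\<close>

definition zone :: "nat \<Rightarrow> valuation set \<Rightarrow> bool" where
  "zone n Z \<longleftrightarrow> (\<exists>cs :: (nat \<times> nat \<times> cmp \<times> int) list.
     (\<forall>(x, y, _, _)\<in>set cs. x \<le> n \<and> y \<le> n) \<and>
     Z = {v. valuation n v \<and> (\<forall>(x, y, op, c)\<in>set cs. cmp_holds op (v x - v y) (real_of_int c))})"

definition initial_zone :: "ta \<Rightarrow> valuation set" where
  "initial_zone A = {delay (nclocks A) (\<lambda>_. 0) d | d. 0 \<le> d}"

definition post :: "ta \<Rightarrow> transition \<Rightarrow> valuation set \<Rightarrow> valuation set" where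
  "post A t Z =
     {delay (nclocks A) (reset (resets t) v) d | v d. v \<in> Z \<and> sat_guard v (guard t) \<and> 0 \<le> d}"

definition zg_step ::
    "ta \<Rightarrow> nat \<times> valuation set \<Rightarrow> transition \<Rightarrow> nat \<times> valuation set \<Rightarrow> bool" where
  "zg_step A = (\<lambda>(q, Z) t (q', Z').
     t \<in> set (trans A) \<and> src t = q \<and> tgt t = q' \<and> Z' = post A t Z \<and> Z' \<noteq> {})"

definition abs_step :: "ta \<Rightarrow> (valuation set \<Rightarrow> valuation set) \<Rightarrow>
    nat \<times> valuation set \<Rightarrow> transition \<Rightarrow> nat \<times> valuation set \<Rightarrow> bool" where
  "abs_step A \<aa> = (\<lambda>(q, Z) t (q', W).
     \<aa> Z = Z \<and> (\<exists>Z'. zg_step A (q, Z) t (q', Z') \<and> W = \<aa> Z'))"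

inductive_set zg_nodes :: "ta \<Rightarrow> (valuation set \<Rightarrow> valuation set) \<Rightarrow> (nat \<times> valuation set) set"
  for A :: ta and \<aa> :: "valuation set \<Rightarrow> valuation set" where
  start: "(init A, \<aa> (initial_zone A)) \<in> zg_nodes A \<aa>"
| step: "m \<in> zg_nodes A \<aa> \<Longrightarrow> abs_step A \<aa> m t m' \<Longrightarrow> m' \<in> zg_nodes A \<aa>"

definition zg_edges :: "ta \<Rightarrow> (valuation set \<Rightarrow> valuation set) \<Rightarrow>
    ((nat \<times> valuation set) \<times> transition \<times> (nat \<times> valuation set)) set" where
  "zg_edges A \<aa> = {(m, t, m'). m \<in> zg_nodes A \<aa> \<and> abs_step A \<aa> m t m'}"

section \<open>Difference bound matrices and the extrapolation\<close>

text \<open>\<open>Le c\<close> is \<open>(c, \<le>)\<close>, \<open>Lt c\<close> is \<open>(c, <)\<close> and \<open>Inf\<close> is \<open>(\<infinity>, <)\<close>.\<close>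

datatype bound = Le int | Lt int | Inf

fun sat_bound :: "real \<Rightarrow> bound \<Rightarrow> bool" where
  "sat_bound r (Le c) \<longleftrightarrow> r \<le> real_of_int c"
| "sat_bound r (Lt c) \<longleftrightarrow> r < real_of_int c"
| "sat_bound r Inf \<longleftrightarrow> True"

definition dbm_set :: "nat \<Rightarrow> (nat \<Rightarrow> nat \<Rightarrow> bound) \<Rightarrow> valuation set" where
  "dbm_set n D = {v. valuation n v \<and> (\<forall>i\<le>n. \<forall>j\<le>n. sat_bound (v i - v j) (D i j))}"

text \<open>
  The entries of the canonical DBM are the tightest bounds valid on the zone.  The tightest bound
  exists for every nonempty zone: its constants are integers, so an upper bound of
  \<open>x\<^sub>i - x\<^sub>j\<close> that cannot be improved is an integer, attained or not.
\<close>

definition canonical_entry :: "valuation set \<Rightarrow> nat \<Rightarrow> nat \<Rightarrow> bound" where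
  "canonical_entry Z i j = (THE b. (\<forall>v\<in>Z. sat_bound (v i - v j) b) \<and>
     (\<forall>b'. (\<forall>v\<in>Z. sat_bound (v i - v j) b') \<longrightarrow> (\<forall>r. sat_bound r b \<longrightarrow> sat_bound r b')))"

text \<open>
  In the following, \<open>None\<close> stands for \<open>-\<infinity>\<close>; it is the least element in the order of
  \<^theory>\<open>HOL-Library.Option_ord\<close>.
\<close>

definition lower_consts :: "ta \<Rightarrow> nat \<Rightarrow> int set" where
  "lower_consts A x =
     {int c | t op c. t \<in> set (trans A) \<and> (x, op, c) \<in> set (guard t) \<and> op \<in> {CGt, CGe, CEq}}"

definition upper_consts :: "ta \<Rightarrow> nat \<Rightarrow> int set" where
  "upper_consts A x =
     {int c | t op c. t \<in> set (trans A) \<and> (x, op, c) \<in> set (guard t) \<and> op \<in> {CLt, CLe, CEq}}"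

definition L_bound :: "ta \<Rightarrow> nat \<Rightarrow> int option" where
  "L_bound A x = (if x = 0 then Some 0 else Max (insert None (Some ` lower_consts A x)))"

definition U_bound :: "ta \<Rightarrow> nat \<Rightarrow> int option" where
  "U_bound A x = (if x = 0 then Some 0 else Max (insert None (Some ` upper_consts A x)))"

definition weak_U :: "ta \<Rightarrow> nat \<Rightarrow> int option" where
  "weak_U A x = (if Some 1 \<le> L_bound A x \<and> U_bound A x = None then Some 1 else U_bound A x)"

fun neg_strict :: "int option \<Rightarrow> bound" where
  "neg_strict None = Inf"
| "neg_strict (Some m) = Lt (- m)"

definition extra_finite :: "int option \<Rightarrow> int option \<Rightarrow> int \<Rightarrow> bound \<Rightarrow> bound" where
  "extra_finite l u c b =
     (if l < Some c then Inf else if u < Some (- c) then neg_strict u else b)"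

text \<open>For an entry \<open>(\<infinity>, <)\<close> the first case of the extrapolation always applies.\<close>

fun extra_entry :: "int option \<Rightarrow> int option \<Rightarrow> bound \<Rightarrow> bound" where
  "extra_entry l u (Le c) = extra_finite l u c (Le c)"
| "extra_entry l u (Lt c) = extra_finite l u c (Lt c)"
| "extra_entry l u Inf = Inf"

definition extra_LwU :: "ta \<Rightarrow> valuation set \<Rightarrow> valuation set" where
  "extra_LwU A Z = (if Z = {} then {} else
     dbm_set (nclocks A)
       (\<lambda>i j. extra_entry (L_bound A i) (weak_U A j) (canonical_entry Z i j)))"

section \<open>Lift-safety\<close>

definition lifted_clocks :: "ta \<Rightarrow> nat set" where
  "lifted_clocks A = {x \<in> {1..nclocks A}. \<exists>t\<in>set (trans A).
     \<forall>v. valuation (nclocks A) v \<and> sat_guard v (guard t) \<longrightarrow> 1 \<le> v x}"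

definition lift_safe :: "ta \<Rightarrow> (valuation set \<Rightarrow> valuation set) \<Rightarrow> bool" where
  "lift_safe A \<aa> \<longleftrightarrow> (\<forall>Z. zone (nclocks A) Z \<longrightarrow>
     (\<forall>x\<in>lifted_clocks A. (\<forall>v\<in>Z. 1 \<le> v x) \<longleftrightarrow> (\<forall>v\<in>\<aa> Z. 1 \<le> v x)))"

definition satisfiable_guards :: "ta \<Rightarrow> bool" where
  "satisfiable_guards A \<longleftrightarrow>
     (\<forall>t\<in>set (trans A). \<exists>v. valuation (nclocks A) v \<and> sat_guard v (guard t))"

section \<open>Polynomial time\<close>

text \<open>
  The machine model is the language WHILE of N. D. Jones, ``Computability and Complexity from a
  Programming Perspective'': imperative programs over binary trees with finitely many variables.
  Every node of an evaluated expression and every executed assignment or test costs one unit.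
  Subtrees are shared and only their root can be tested, so a program running for \<open>t\<close> steps is
  simulated by a Turing machine in time polynomial in \<open>t\<close> and the input size, and conversely;
  polynomial time for WHILE is therefore the usual class.
\<close>

datatype tree = NIL | Cell tree tree

datatype exp = Var nat | NilE | ConsE exp exp | HdE exp | TlE exp

datatype com = Assign nat exp | Seq com com | Cond exp com com | While exp com

type_synonym store = "nat \<Rightarrow> tree"

fun left :: "tree \<Rightarrow> tree" where
  "left NIL = NIL"
| "left (Cell a b) = a"

fun right :: "tree \<Rightarrow> tree" where
  "right NIL = NIL"
| "right (Cell a b) = b"

fun exp_val :: "exp \<Rightarrow> store \<Rightarrow> tree" where
  "exp_val (Var x) s = s x"
| "exp_val NilE s = NIL"
| "exp_val (ConsE e f) s = Cell (exp_val e s) (exp_val f s)"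
| "exp_val (HdE e) s = left (exp_val e s)"
| "exp_val (TlE e) s = right (exp_val e s)"

fun exp_cost :: "exp \<Rightarrow> nat" where
  "exp_cost (Var x) = 1"
| "exp_cost NilE = 1"
| "exp_cost (ConsE e f) = 1 + exp_cost e + exp_cost f"
| "exp_cost (HdE e) = 1 + exp_cost e"
| "exp_cost (TlE e) = 1 + exp_cost e"

text \<open>\<open>exec c s k s'\<close>: started in \<open>s\<close>, the program \<open>c\<close> halts in \<open>s'\<close> after \<open>k\<close> units of time.\<close>

inductive exec :: "com \<Rightarrow> store \<Rightarrow> nat \<Rightarrow> store \<Rightarrow> bool" where
  assign: "exec (Assign x e) s (1 + exp_cost e) (s(x := exp_val e s))"
| seq: "exec c s k s' \<Longrightarrow> exec d s' l s'' \<Longrightarrow> exec (Seq c d) s (k + l) s''"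
| cond_true: "exp_val e s \<noteq> NIL \<Longrightarrow> exec c s k s' \<Longrightarrow>
    exec (Cond e c d) s (1 + exp_cost e + k) s'"
| cond_false: "exp_val e s = NIL \<Longrightarrow> exec d s k s' \<Longrightarrow>
    exec (Cond e c d) s (1 + exp_cost e + k) s'"
| while_false: "exp_val e s = NIL \<Longrightarrow> exec (While e c) s (1 + exp_cost e) s"
| while_true: "exp_val e s \<noteq> NIL \<Longrightarrow> exec c s k s' \<Longrightarrow> exec (While e c) s' l s'' \<Longrightarrow>
    exec (While e c) s (1 + exp_cost e + k + l) s''"

text \<open>
  Variable \<open>0\<close> holds the input, and finally the answer (\<^const>\<open>NIL\<close> means no).  The running time
  is bounded in terms of the number of inner nodes of the input tree.  The problem may be a
  promise problem: nothing is required on inputs that do not encode an instance.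
\<close>

definition polytime_solvable :: "('i \<Rightarrow> tree) \<Rightarrow> 'i set \<Rightarrow> ('i \<Rightarrow> bool) \<Rightarrow> bool" where
  "polytime_solvable enc I yes \<longleftrightarrow> (\<exists>(c :: com) (p :: nat poly). \<forall>i\<in>I. \<exists>k s.
     exec c ((\<lambda>_. NIL)(0 := enc i)) k s \<and> k \<le> poly p (size (enc i)) \<and> (s 0 \<noteq> NIL \<longleftrightarrow> yes i))"

section \<open>The Zenoness problem\<close>

text \<open>
  An instance consists of an automaton and explicit lists of the nodes and edges of its abstract
  zone graph.  The (nonempty) zone of a node is given by its canonical DBM.
\<close>

type_synonym node = "nat \<times> bound list list"
type_synonym zp_instance = "ta \<times> node list \<times> (node \<times> transition \<times> node) list"

definition canonical_dbm :: "nat \<Rightarrow> valuation set \<Rightarrow> bound list list" where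
  "canonical_dbm n Z = map (\<lambda>i. map (canonical_entry Z i) [0..<Suc n]) [0..<Suc n]"

definition node_of :: "ta \<Rightarrow> nat \<times> valuation set \<Rightarrow> node" where
  "node_of A = (\<lambda>(q, Z). (q, canonical_dbm (nclocks A) Z))"

definition ZP_instances :: "(ta \<Rightarrow> valuation set \<Rightarrow> valuation set) \<Rightarrow> zp_instance set" where
  "ZP_instances \<aa> = {(A, ns, es). timed_automaton A \<and>
     distinct ns \<and> set ns = node_of A ` zg_nodes A (\<aa> A) \<and>
     distinct es \<and> set es = (\<lambda>(m, t, m'). (node_of A m, t, node_of A m')) ` zg_edges A (\<aa> A)}"

text \<open>Numbers are encoded in binary, least significant digit first.\<close>

fun enc_bool :: "bool \<Rightarrow> tree" where
  "enc_bool False = NIL"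
| "enc_bool True = Cell NIL NIL"

fun enc_nat :: "nat \<Rightarrow> tree" where
  "enc_nat n = (if n = 0 then NIL else Cell (enc_bool (odd n)) (enc_nat (n div 2)))"

declare enc_nat.simps [simp del]

definition enc_int :: "int \<Rightarrow> tree" where
  "enc_int c = Cell (enc_bool (c < 0)) (enc_nat (nat \<bar>c\<bar>))"

definition enc_list :: "('a \<Rightarrow> tree) \<Rightarrow> 'a list \<Rightarrow> tree" where
  "enc_list f xs = foldr (\<lambda>x. Cell (f x)) xs NIL"

fun enc_cmp :: "cmp \<Rightarrow> tree" where
  "enc_cmp CLt = enc_nat 0"
| "enc_cmp CLe = enc_nat 1"
| "enc_cmp CEq = enc_nat 2"
| "enc_cmp CGe = enc_nat 3"
| "enc_cmp CGt = enc_nat 4"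

fun enc_bound :: "bound \<Rightarrow> tree" where
  "enc_bound (Le c) = Cell (enc_bool False) (enc_int c)"
| "enc_bound (Lt c) = Cell (enc_bool True) (enc_int c)"
| "enc_bound Inf = NIL"

definition enc_guard :: "guard \<Rightarrow> tree" where
  "enc_guard = enc_list (\<lambda>(x, op, c). Cell (enc_nat x) (Cell (enc_cmp op) (enc_nat c)))"

definition enc_transition :: "transition \<Rightarrow> tree" where
  "enc_transition t = Cell (enc_nat (src t)) (Cell (enc_guard (guard t))
     (Cell (enc_list enc_nat (resets t)) (enc_nat (tgt t))))"

definition enc_ta :: "ta \<Rightarrow> tree" where
  "enc_ta A = Cell (enc_list enc_nat (locs A)) (Cell (enc_nat (init A))
     (Cell (enc_nat (nclocks A)) (enc_list enc_transition (trans A))))"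

definition enc_node :: "node \<Rightarrow> tree" where
  "enc_node = (\<lambda>(q, D). Cell (enc_nat q) (enc_list (enc_list enc_bound) D))"

definition enc_instance :: "zp_instance \<Rightarrow> tree" where
  "enc_instance = (\<lambda>(A, ns, es). Cell (enc_ta A) (Cell (enc_list enc_node ns)
     (enc_list (\<lambda>(m, t, m'). Cell (enc_node m) (Cell (enc_transition t) (enc_node m'))) es)))"

text \<open>The problem \<open>ZP\<^sup>\<aa>\<close>, for an abstraction that may depend on the automaton.\<close>

definition ZP_in_polytime :: "(ta \<Rightarrow> valuation set \<Rightarrow> valuation set) \<Rightarrow> bool" where
  "ZP_in_polytime \<aa> \<longleftrightarrow>
     polytime_solvable enc_instance (ZP_instances \<aa>) (\<lambda>(A, _, _). has_zeno_run A)"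

section \<open>A necessary condition for lift-safety\<close>

text \<open>
  The extrapolation is not lift-safe for automata in which the weak upper bound of a lifted clock
  is below \<open>1\<close>.  This happens when \<open>x\<close> has lower bound guards \<open>x \<ge> 1\<close> but only upper bound
  guards \<open>x < 0\<close>, \<open>x \<le> 0\<close> or \<open>x = 0\<close> (so that \<open>U x = 0\<close> stays \<open>0\<close>), and when \<open>x\<close> is in
  \<^const>\<open>lifted_clocks\<close> only because some guard is unsatisfiable and so implies everything.
\<close>

lemma canonical_entry_eqI:
  assumes "\<forall>v\<in>Z. sat_bound (v i - v j) b"
    and "\<And>b'. \<forall>v\<in>Z. sat_bound (v i - v j) b' \<Longrightarrow> \<forall>r. sat_bound r b \<longrightarrow> sat_bound r b'"
  shows "canonical_entry Z i j = b"
proof -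
  have inj: "b1 = b2" if eq: "\<And>r. sat_bound r b1 \<longleftrightarrow> sat_bound r b2" for b1 b2
  proof -
    have *: "b1 \<noteq> Inf \<Longrightarrow> b2 \<noteq> Inf"
      if eq: "\<And>r. sat_bound r b1 \<longleftrightarrow> sat_bound r b2" for b1 b2
    proof
      assume "b1 \<noteq> Inf" and "b2 = Inf"
      then have all: "sat_bound r b1" for r using eq[of r] by simp
      show False
      proof (cases b1)
        case (Le c)
        then show ?thesis using all[of "real_of_int c + 1"] by simp
      next
        case (Lt c)
        then show ?thesis using all[of "real_of_int c"] by simp
      qed (use \<open>b1 \<noteq> Inf\<close> in simp)
    qed
    have **: False if eq: "\<And>r. sat_bound r (Le c) \<longleftrightarrow> sat_bound r (Lt d)" for c d
    proof -
      have "real_of_int c < real_of_int d" using eq[of "real_of_int c"] by simp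
      then obtain r where "real_of_int c < r" "r < real_of_int d" using dense by blast
      with eq[of r] show False by simp
    qed
    show ?thesis
    proof (cases b1)
      case (Le c)
      with * [of b1 b2] eq have "b2 \<noteq> Inf" by simp
      then consider d where "b2 = Le d" | d where "b2 = Lt d" by (cases b2) auto
      then show ?thesis
      proof cases
        case (1 d)
        then show ?thesis using Le eq[of "real_of_int c"] eq[of "real_of_int d"] by simp
      next
        case (2 d)
        then show ?thesis using Le eq **[of c d] by simp
      qed
    next
      case (Lt c)
      with * [of b1 b2] eq have "b2 \<noteq> Inf" by simp
      then consider d where "b2 = Le d" | d where "b2 = Lt d" by (cases b2) auto
      then show ?thesis
      proof cases
        case (1 d)
        then show ?thesis using Lt eq **[of d c] by simp
      next
        case (2 d)
        then show ?thesis using Lt eq[of "real_of_int c"] eq[of "real_of_int d"] by simp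
      qed
    next
      case Inf
      with * [of b2 b1] eq show ?thesis by auto
    qed
  qed
  show ?thesis
    unfolding canonical_entry_def
  proof (rule the_equality)
    fix b'
    assume *: "(\<forall>v\<in>Z. sat_bound (v i - v j) b') \<and>
      (\<forall>b''. (\<forall>v\<in>Z. sat_bound (v i - v j) b'') \<longrightarrow> (\<forall>r. sat_bound r b' \<longrightarrow> sat_bound r b''))"
    show "b' = b"
    proof (rule inj)
      fix r
      have "\<forall>r. sat_bound r b' \<longrightarrow> sat_bound r b"
        by (rule mp[OF spec[OF conjunct2[OF *]] assms(1)])
      moreover have "\<forall>r. sat_bound r b \<longrightarrow> sat_bound r b'"
        by (rule assms(2)[OF conjunct1[OF *]])
      ultimately show "sat_bound r b' \<longleftrightarrow> sat_bound r b" by blast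
    qed
  next
    show "(\<forall>v\<in>Z. sat_bound (v i - v j) b) \<and>
      (\<forall>b'. (\<forall>v\<in>Z. sat_bound (v i - v j) b') \<longrightarrow> (\<forall>r. sat_bound r b \<longrightarrow> sat_bound r b'))"
      by (rule conjI[OF assms(1)], rule allI, rule impI, rule assms(2))
  qed
qed

lemma sat_bound_mono: "sat_bound r b \<Longrightarrow> r' \<le> r \<Longrightarrow> sat_bound r' b"
  by (cases b) auto

lemma canonical_entry_LeI:
  assumes "\<forall>v\<in>Z. v i - v j \<le> real_of_int c" "w \<in> Z" "w i - w j = real_of_int c"
  shows "canonical_entry Z i j = Le c"
proof (rule canonical_entry_eqI)
  fix b' assume "\<forall>v\<in>Z. sat_bound (v i - v j) b'"
  with assms(2,3) have "sat_bound (real_of_int c) b'" by metis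
  then show "\<forall>r. sat_bound r (Le c) \<longrightarrow> sat_bound r b'"
    using sat_bound_mono by auto
qed (use assms(1) in auto)

lemma canonical_entry_InfI:
  assumes "\<And>r. \<exists>v\<in>Z. r \<le> v i - v j"
  shows "canonical_entry Z i j = Inf"
proof (rule canonical_entry_eqI)
  fix b' assume "\<forall>v\<in>Z. sat_bound (v i - v j) b'"
  then show "\<forall>r. sat_bound r Inf \<longrightarrow> sat_bound r b'"
    using assms sat_bound_mono by blast
qed simp

lemma lift_safe_imp_weak_U:
  assumes "lift_safe A (extra_LwU A)" and x: "x \<in> lifted_clocks A"
  shows "Some 1 \<le> weak_U A x"
proof (rule ccontr)
  assume nle: "\<not> Some 1 \<le> weak_U A x"
  define n where "n = nclocks A"
  have xn: "x \<in> {1..n}" using x by (auto simp: lifted_clocks_def n_def)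
  define Z where "Z = {v. valuation n v \<and> 1 \<le> v x}"
  define w :: valuation where "w = (\<lambda>i. if i = x then 1 / 2 else 0)"
  have "zone n Z"
    unfolding zone_def Z_def
    by (rule exI[of _ "[(x, 0, CGe, 1)]"]) (use xn in \<open>auto simp: valuation_def\<close>)
  moreover have "\<forall>v\<in>Z. 1 \<le> v x" by (simp add: Z_def)
  ultimately have all: "\<forall>v\<in>extra_LwU A Z. 1 \<le> v x"
    using assms unfolding lift_safe_def n_def by blast
  have u1: "(\<lambda>i. if i = x then 1 else 0) \<in> Z"
    using xn by (auto simp: Z_def valuation_def)
  have upd: "(\<lambda>k. if k = x then max 1 a else if k = i then max 0 a else 0) \<in> Z"
    if "i \<in> {1..n}" for i a
    using that xn by (auto simp: Z_def valuation_def)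
  have sat: "sat_bound (w i - w j)
      (extra_entry (L_bound A i) (weak_U A j) (canonical_entry Z i j))"
    if "i \<le> n" "j \<le> n" for i j
  proof -
    consider "i = j" | "i = 0" "j = x" | "i = 0" "j \<noteq> 0" "j \<noteq> x" | "i \<noteq> 0" "i \<noteq> j"
      by metis
    then show ?thesis
    proof cases
      case 1
      have "canonical_entry Z i j = Le 0"
        by (rule canonical_entry_LeI[OF _ u1]) (use 1 in auto)
      then show ?thesis
        using 1 by (cases "weak_U A j") (auto simp: extra_finite_def)
    next
      case 2
      have "canonical_entry Z i j = Le (- 1)"
        by (rule canonical_entry_LeI[OF _ u1]) (use 2 xn in \<open>auto simp: Z_def valuation_def\<close>)
      moreover have "weak_U A j < Some 1" using nle 2 by auto
      ultimately show ?thesis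
        using 2 xn by (cases "weak_U A j") (auto simp: extra_finite_def w_def L_bound_def)
    next
      case 3
      have "canonical_entry Z i j = Le 0"
        by (rule canonical_entry_LeI[OF _ u1]) (use 3 xn that in \<open>auto simp: Z_def valuation_def\<close>)
      moreover have "weak_U A j = None \<or> Some 0 \<le> weak_U A j"
      proof -
        have fin: "finite (upper_consts A j)"
        proof -
          have "upper_consts A j \<subseteq>
              (\<lambda>(x, op, c). int c) ` (\<Union>t\<in>set (trans A). set (guard t))"
            by (force simp: upper_consts_def)
          then show ?thesis by (rule finite_subset) auto
        qed
        have "Max (insert None (Some ` upper_consts A j)) \<in> insert None (Some ` upper_consts A j)"
          by (rule Max_in) (use fin in auto)
        then show ?thesis
          using 3 by (auto simp: weak_U_def U_bound_def upper_consts_def)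
      qed
      ultimately show ?thesis
        using 3 xn by (cases "weak_U A j") (auto simp: extra_finite_def w_def L_bound_def)
    next
      case 4
      have "canonical_entry Z i j = Inf"
      proof (cases "j = x")
        case True
        show ?thesis
        proof (rule canonical_entry_InfI)
          fix r :: real
          have "(\<lambda>k. if k = x then 1 else if k = i then max 0 (r + 1) else 0) \<in> Z"
            using 4 that xn by (auto simp: Z_def valuation_def)
          then show "\<exists>v\<in>Z. r \<le> v i - v j"
            by (rule rev_bexI) (use 4 True in auto)
        qed
      next
        case False
        show ?thesis
        proof (rule canonical_entry_InfI)
          fix r :: real
          have "i \<in> {1..n}" using 4 that by auto
          from upd[OF this, of r] show "\<exists>v\<in>Z. r \<le> v i - v j"
            by (rule rev_bexI) (use 4 False in auto)
        qed
      qed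
      then show ?thesis by simp
    qed
  qed
  have "w \<in> extra_LwU A Z"
    using u1 sat xn unfolding extra_LwU_def dbm_set_def n_def[symmetric]
    by (auto simp: valuation_def w_def)
  with all show False by (auto simp: w_def)
qed

lemma satisfiable_not_lift_safe:
  "\<exists>A. timed_automaton A \<and> satisfiable_guards A \<and> \<not> lift_safe A (extra_LwU A)"
proof -
  define t1 where "t1 = \<lparr>src = 0, guard = [(1, CGe, 1)], resets = [], tgt = 0\<rparr>"
  define t2 where "t2 = \<lparr>src = 0, guard = [(1, CLe, 0)], resets = [], tgt = 0\<rparr>"
  define A where "A = \<lparr>locs = [0], init = 0, nclocks = 1, trans = [t1, t2]\<rparr>"
  note defs = A_def t1_def t2_def
  have "timed_automaton A"
    by (simp add: timed_automaton_def defs)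
  moreover have "satisfiable_guards A"
  proof -
    have "valuation 1 (\<lambda>i. if i = 1 then 1 else 0)" "valuation 1 (\<lambda>i. 0)"
      by (auto simp: valuation_def)
    then show ?thesis
      unfolding satisfiable_guards_def defs
      by (auto simp: sat_guard_def intro: exI[of _ "\<lambda>i. 0"] exI[of _ "\<lambda>i. if i = 1 then 1 else 0"])
  qed
  moreover have "\<not> lift_safe A (extra_LwU A)"
  proof
    have "1 \<in> lifted_clocks A"
      by (auto simp: lifted_clocks_def defs sat_guard_def)
    moreover assume "lift_safe A (extra_LwU A)"
    ultimately have "Some 1 \<le> weak_U A 1"
      by (rule lift_safe_imp_weak_U[rotated])
    moreover have "upper_consts A 1 = {0}"
    proof
      show "upper_consts A 1 \<subseteq> {0}"
        by (auto simp: upper_consts_def defs)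
      have "t2 \<in> set (trans A)" "(1, CLe, 0) \<in> set (guard t2)"
        by (simp_all add: defs)
      then show "{0} \<subseteq> upper_consts A 1"
        unfolding upper_consts_def by force
    qed
    ultimately show False
      by (simp add: weak_U_def U_bound_def max_def split: if_splits)
  qed
  ultimately show ?thesis by blast
qed

end

theory Submission
  imports Defs
begin

text \<open>
  A clock \<open>x\<close> is lifted by a transition if its guard contains \<open>x \<ge> c\<close>, \<open>x > c\<close> or \<open>x = c\<close> with
  \<open>c \<ge> 1\<close>.  There is a Zeno run iff the abstract zone graph has a cycle on which no clock is both reset
  and lifted.  Searching for such a cycle naively means guessing the set of clocks that are not reset,
  which is hard in general; but the extrapolation with the weak upper bound never forgets the order of
  clocks with positive lower bounds.  On a Zeno run the clocks lifted again and again are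
  eventually at least \<open>1\<close> and those reset again and again are below \<open>1\<close>, so the former can be
  taken to be an up-set \<open>{x. z \<le> x}\<close> of the order at some node, that is, a row of its DBM.
  It remains to look, for every row, for an infinite path among the edges that lift only clocks of
  the up-set and reset only other clocks, by repeatedly deleting edges without successor.

  An abstract path is realised by finite runs because extrapolated valuations are
  LU-simulated by valuations of the zone.  A finite run through five iterations of a cycle is
  enough to construct an infinite run with summable delays.
\<close>

section \<open>Polynomial time functions on trees\<close>

text \<open>The value 1 in the weak bound serves clocks that have a guard \<open>x \<ge> c\<close>
  with \<open>c \<ge> 1\<close> but no upper bound guard. With the bound -infinity the extrapolation
  would erase every lower bound on such a clock, and with it facts \<open>z \<le> x\<close>. A
  finite nonnegative bound keeps nonpositive entries nonpositive. All clocks start equal and a reset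
  puts a clock at the bottom, so clocks with positive lower bounds stay comparable, and there are
  only as many candidate up-sets as rows in the graph, plus the empty one. The threshold 1 separates
  the clocks because guard constants are integers: once less than one time unit remains, a clock
  that is reset never again reaches a positive constant. For the converse, the obstacle is that
  simulation is followed backwards from the end of a path. The starting valuation depends on the
  length of the path, so the finite runs do not fit together into an infinite one; new delays have
  to be invented for a single long enough run.\<close>

lemma poly_nat_mono: "m \<le> n \<Longrightarrow> poly p m \<le> poly (p :: nat poly) n"
  by (induction p) (auto intro!: add_mono mult_mono)

text \<open>The size bound is separate from the time bound: subtrees are shared, so a value can be
  doubled in constant time and a short run can build a tree of exponential size. The initial store
  is arbitrary so that programs can be chained without clearing scratch variables.\<close>

definition ptime :: "(tree \<Rightarrow> tree) \<Rightarrow> bool" where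
  "ptime f \<longleftrightarrow> (\<exists>c p. \<forall>s. \<exists>k s'. exec c s k s' \<and> s' 0 = f (s 0) \<and>
     k \<le> poly p (size (s 0)) \<and> size (f (s 0)) \<le> poly (p :: nat poly) (size (s 0)))"

lemma ptimeI:
  assumes "\<And>s. \<exists>k s'. exec c s k s' \<and> s' 0 = f (s 0) \<and> k \<le> poly p (size (s 0))"
    and "\<And>t. size (f t) \<le> poly q (size t)"
  shows "ptime f"
proof -
  have "\<exists>k s'. exec c s k s' \<and> s' 0 = f (s 0) \<and> k \<le> poly (p + q) (size (s 0)) \<and>
      size (f (s 0)) \<le> poly (p + q) (size (s 0))" for s
    using assms(1)[of s] assms(2)[of "s 0"] by (force intro: trans_le_add1 trans_le_add2)
  then show ?thesis unfolding ptime_def by blast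
qed

lemma ptimeE:
  assumes "ptime f"
  obtains c p where "\<And>s. \<exists>k s'. exec c s k s' \<and> s' 0 = f (s 0) \<and> k \<le> poly p (size (s 0))"
    and "\<And>t. size (f t) \<le> poly p (size t)"
proof -
  obtain c p where *: "\<And>s. \<exists>k s'. exec c s k s' \<and> s' 0 = f (s 0) \<and>
     k \<le> poly p (size (s 0)) \<and> size (f (s 0)) \<le> poly p (size (s 0))"
    using assms unfolding ptime_def by blast
  have "size (f t) \<le> poly p (size t)" for t using *[of "\<lambda>_. t"] by auto
  with * that show thesis by blast
qed

fun assigned :: "com \<Rightarrow> nat set" where
  "assigned (Assign x e) = {x}"
| "assigned (Seq c d) = assigned c \<union> assigned d"
| "assigned (Cond e c d) = assigned c \<union> assigned d"
| "assigned (While e c) = assigned c"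

lemma finite_assigned: "finite (assigned c)"
  by (induction c) auto

lemma exec_frame: "exec c s k s' \<Longrightarrow> x \<notin> assigned c \<Longrightarrow> s' x = s x"
  by (induction rule: exec.induct) auto

lemma fresh_variable: "finite V \<Longrightarrow> \<exists>x :: nat. x \<noteq> 0 \<and> x \<notin> V"
  using ex_new_if_finite[of "insert 0 V"] by auto

lemma exec_assign: "s' = s(x := exp_val e s) \<Longrightarrow> k = 1 + exp_cost e \<Longrightarrow> exec (Assign x e) s k s'"
  by (simp only: exec.assign)

lemma ptime_id: "ptime (\<lambda>t. t)"
  by (rule ptimeI[of "Assign 0 (Var 0)" _ "[:2:]" "[:0, 1:]"])
     (auto intro!: exI exec_assign)

lemma ptime_NIL: "ptime (\<lambda>t. NIL)"
  by (rule ptimeI[of "Assign 0 NilE" _ "[:2:]" "0"])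
     (auto intro!: exI exec_assign)

lemma ptime_comp:
  assumes "ptime f" "ptime g"
  shows "ptime (\<lambda>t. f (g t))"
proof -
  obtain c p where c: "\<And>s. \<exists>k s'. exec c s k s' \<and> s' 0 = f (s 0) \<and> k \<le> poly p (size (s 0))"
    and p: "\<And>t. size (f t) \<le> poly p (size t)" using ptimeE[OF assms(1)] by metis
  obtain d q where d: "\<And>s. \<exists>k s'. exec d s k s' \<and> s' 0 = g (s 0) \<and> k \<le> poly q (size (s 0))"
    and q: "\<And>t. size (g t) \<le> poly q (size t)" using ptimeE[OF assms(2)] by metis
  have pq: "poly p (size (g t)) \<le> poly (pcompose p q) (size t)" for t
    using poly_nat_mono[OF q] by (simp add: poly_pcompose)
  show ?thesis
  proof (rule ptimeI)
    fix s :: store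
    obtain k s1 where 1: "exec d s k s1" "s1 0 = g (s 0)" "k \<le> poly q (size (s 0))"
      using d by blast
    obtain l s2 where 2: "exec c s1 l s2" "s2 0 = f (s1 0)" "l \<le> poly p (size (s1 0))"
      using c by blast
    have "exec (Seq d c) s (k + l) s2" using 1 2 by (blast intro: exec.seq)
    moreover have "k + l \<le> poly (q + pcompose p q) (size (s 0))"
      using 1 2 pq[of "s 0"] by simp
    ultimately show "\<exists>k s'. exec (Seq d c) s k s' \<and> s' 0 = f (g (s 0)) \<and>
        k \<le> poly (q + pcompose p q) (size (s 0))"
      using 1 2 by metis
  next
    show "size (f (g t)) \<le> poly (pcompose p q) (size t)" for t
      using p[of "g t"] pq[of t] by simp
  qed
qed

lemma ptime_left: "ptime f \<Longrightarrow> ptime (\<lambda>t. left (f t))"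
proof (rule ptime_comp[of left])
  have "size (left t) \<le> size t" for t by (cases t) auto
  then show "ptime left"
    by (intro ptimeI[of "Assign 0 (HdE (Var 0))" _ "[:3:]" "[:0, 1:]"])
      (auto intro!: exI exec_assign)
qed

lemma ptime_right: "ptime f \<Longrightarrow> ptime (\<lambda>t. right (f t))"
proof (rule ptime_comp[of right])
  have "size (right t) \<le> size t" for t by (cases t) auto
  then show "ptime right"
    by (intro ptimeI[of "Assign 0 (TlE (Var 0))" _ "[:3:]" "[:0, 1:]"])
      (auto intro!: exI exec_assign)
qed

text \<open>Both operands read the same input. It is parked in a variable that \<open>c\<close> does
  not assign, and the first result in one that \<open>d\<close> does not assign;
  \<open>exec_frame\<close> shows that they survive.\<close>

lemma ptime_Cell:
  assumes "ptime f" "ptime g"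
  shows "ptime (\<lambda>t. Cell (f t) (g t))"
proof -
  obtain c p where c: "\<And>s. \<exists>k s'. exec c s k s' \<and> s' 0 = f (s 0) \<and> k \<le> poly p (size (s 0))"
    and p: "\<And>t. size (f t) \<le> poly p (size t)" using ptimeE[OF assms(1)] by metis
  obtain d q where d: "\<And>s. \<exists>k s'. exec d s k s' \<and> s' 0 = g (s 0) \<and> k \<le> poly q (size (s 0))"
    and q: "\<And>t. size (g t) \<le> poly q (size t)" using ptimeE[OF assms(2)] by metis
  obtain x where x: "x \<noteq> 0" "x \<notin> assigned c" using fresh_variable[OF finite_assigned] by metis
  obtain y where y: "y \<noteq> 0" "y \<notin> assigned d \<union> {x}"
    using fresh_variable[of "assigned d \<union> {x}"] finite_assigned by auto
  let ?prog = "Seq (Assign x (Var 0)) (Seq c (Seq (Assign y (Var 0)) (Seq (Assign 0 (Var x))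
     (Seq d (Assign 0 (ConsE (Var y) (Var 0)))))))"
  show ?thesis
  proof (rule ptimeI)
    fix s :: store
    let ?s1 = "s(x := s 0)"
    obtain k s2 where 1: "exec c ?s1 k s2" "s2 0 = f (?s1 0)" "k \<le> poly p (size (?s1 0))"
      using c by blast
    have s2x: "s2 x = s 0" using exec_frame[OF 1(1) x(2)] by simp
    let ?s3 = "s2(y := s2 0, 0 := s2 x)"
    obtain l s4 where 2: "exec d ?s3 l s4" "s4 0 = g (?s3 0)" "l \<le> poly q (size (?s3 0))"
      using d by blast
    have s4y: "s4 y = s2 0" using exec_frame[OF 2(1)] y by simp
    have "exec ?prog s (2 + (k + (2 + (2 + (l + 4))))) (s4(0 := Cell (s4 y) (s4 0)))"
      using 1 2 x y by (intro exec.seq) (auto intro!: exec_assign)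
    then show "\<exists>k s'. exec ?prog s k s' \<and> s' 0 = Cell (f (s 0)) (g (s 0)) \<and>
        k \<le> poly (p + q + [:10:]) (size (s 0))"
      using 1 2 x y s2x s4y by (intro exI[of _ "2 + (k + (2 + (2 + (l + 4))))"]
        exI[of _ "s4(0 := Cell (s4 y) (s4 0))"]) auto
  next
    show "size (Cell (f t) (g t)) \<le> poly (p + q + 1) (size t)" for t
      using p[of t] q[of t] by simp
  qed
qed

lemma ptime_case:
  assumes "ptime h" "ptime f" "ptime g"
  shows "ptime (\<lambda>t. if h t = NIL then f t else g t)"
proof -
  obtain b r where b: "\<And>s. \<exists>k s'. exec b s k s' \<and> s' 0 = h (s 0) \<and> k \<le> poly r (size (s 0))"
    using ptimeE[OF assms(1)] by metis
  obtain c p where c: "\<And>s. \<exists>k s'. exec c s k s' \<and> s' 0 = f (s 0) \<and> k \<le> poly p (size (s 0))"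
    and p: "\<And>t. size (f t) \<le> poly p (size t)" using ptimeE[OF assms(2)] by metis
  obtain d q where d: "\<And>s. \<exists>k s'. exec d s k s' \<and> s' 0 = g (s 0) \<and> k \<le> poly q (size (s 0))"
    and q: "\<And>t. size (g t) \<le> poly q (size t)" using ptimeE[OF assms(3)] by metis
  obtain x where x: "x \<noteq> 0" "x \<notin> assigned b" using fresh_variable[OF finite_assigned] by metis
  obtain y where y: "y \<noteq> 0" "y \<noteq> x"
    using fresh_variable[of "{x}"] by auto
  let ?prog = "Seq (Assign x (Var 0)) (Seq b (Seq (Assign y (Var 0)) (Seq (Assign 0 (Var x))
     (Cond (Var y) d c))))"
  show ?thesis
  proof (rule ptimeI)
    fix s :: store
    let ?s1 = "s(x := s 0)"
    obtain k s2 where 1: "exec b ?s1 k s2" "s2 0 = h (?s1 0)" "k \<le> poly r (size (?s1 0))"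
      using b by blast
    have s2x: "s2 x = s 0" using exec_frame[OF 1(1) x(2)] by simp
    let ?s3 = "s2(y := s2 0, 0 := s2 x)"
    have "\<exists>l s4. exec (Cond (Var y) d c) ?s3 (2 + l) s4 \<and>
        s4 0 = (if h (s 0) = NIL then f (s 0) else g (s 0)) \<and> l \<le> poly (p + q) (size (s 0))"
    proof (cases "h (s 0) = NIL")
      case True
      obtain l s4 where "exec c ?s3 l s4" "s4 0 = f (?s3 0)" "l \<le> poly p (size (?s3 0))"
        using c by blast
      then show ?thesis
        using True exec.cond_false[of "Var y" ?s3 c l s4 d] 1 x y s2x
        by (intro exI[of _ l] exI[of _ s4]) auto
    next
      case False
      obtain l s4 where "exec d ?s3 l s4" "s4 0 = g (?s3 0)" "l \<le> poly q (size (?s3 0))"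
        using d by blast
      then show ?thesis
        using False exec.cond_true[of "Var y" ?s3 d l s4 c] 1 x y s2x
        by (intro exI[of _ l] exI[of _ s4]) auto
    qed
    then obtain l s4 where 2: "exec (Cond (Var y) d c) ?s3 (2 + l) s4"
      "s4 0 = (if h (s 0) = NIL then f (s 0) else g (s 0))" "l \<le> poly (p + q) (size (s 0))"
      by blast
    have "exec ?prog s (2 + (k + (2 + (2 + (2 + l))))) s4"
      using 1 2(1) x y by (intro exec.seq) (auto intro!: exec_assign)
    then show "\<exists>k s'. exec ?prog s k s' \<and>
        s' 0 = (if h (s 0) = NIL then f (s 0) else g (s 0)) \<and>
        k \<le> poly (p + q + r + [:8:]) (size (s 0))"
      using 1 2 x by (intro exI[of _ "2 + (k + (2 + (2 + (2 + l))))"] exI[of _ s4]) auto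
  next
    show "size (if h t = NIL then f t else g t) \<le> poly (p + q) (size t)" for t
      using p[of t] q[of t] by simp
  qed
qed

section \<open>Loops and folds\<close>

inductive loop :: "(tree \<Rightarrow> tree) \<Rightarrow> nat \<Rightarrow> tree \<Rightarrow> nat \<Rightarrow> tree \<Rightarrow> bool" for f B where
  stop: "left u = NIL \<Longrightarrow> size u \<le> B \<Longrightarrow> loop f B u 0 u"
| step: "left u \<noteq> NIL \<Longrightarrow> size u \<le> B \<Longrightarrow> loop f B (f u) n u' \<Longrightarrow> loop f B u (Suc n) u'"

lemma loop_size: "loop f B u n u' \<Longrightarrow> size u' \<le> B"
  by (induction rule: loop.induct) auto

text \<open>Few iterations are not enough, as each could double the size of the state. Hence
  \<open>loop\<close> also bounds every intermediate state by \<open>B\<close>, which gives a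
  uniform cost per iteration. The test \<open>HdE (Var 0)\<close> costs 3, once per iteration and
  once on exit.\<close>

lemma ptime_loop:
  assumes f: "ptime f" and i: "ptime i"
    and loop: "\<And>t. \<exists>n \<le> poly q (size t). loop f (poly q (size t)) (i t) n (g t)"
  shows "ptime g"
proof -
  obtain c p where c: "\<And>s. \<exists>k s'. exec c s k s' \<and> s' 0 = f (s 0) \<and> k \<le> poly p (size (s 0))"
    using ptimeE[OF f] by metis
  obtain d r where d: "\<And>s. \<exists>k s'. exec d s k s' \<and> s' 0 = i (s 0) \<and> k \<le> poly r (size (s 0))"
    using ptimeE[OF i] by metis
  have run: "\<exists>k s'. exec (While (HdE (Var 0)) c) s k s' \<and> s' 0 = u' \<and> k \<le> 3 + n * (poly p B + 3)"
    if "loop f B u n u'" "s 0 = u" for B u n u' s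
    using that
  proof (induction arbitrary: s rule: loop.induct)
    case (stop u)
    then show ?case
      using exec.while_false[of "HdE (Var 0)" s c] by (intro exI[of _ 3] exI[of _ s]) (auto simp: numeral_3_eq_3)
  next
    case (step u n u')
    obtain k s1 where 1: "exec c s k s1" "s1 0 = f (s 0)" "k \<le> poly p (size (s 0))"
      using c by blast
    obtain l s2 where 2: "exec (While (HdE (Var 0)) c) s1 l s2" "s2 0 = u'"
      "l \<le> 3 + n * (poly p B + 3)" using step.IH[of s1] 1 step.prems by auto
    have "poly p (size (s 0)) \<le> poly p B"
      using step by (auto intro: poly_nat_mono)
    then show ?case
      using exec.while_true[OF _ 1(1) 2(1)] 1 2 step.hyps step.prems
      by (intro exI[of _ "3 + k + l"] exI[of _ s2]) (auto simp: numeral_3_eq_3)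
  qed
  show ?thesis
  proof (rule ptimeI)
    fix s :: store
    obtain n where n: "n \<le> poly q (size (s 0))" "loop f (poly q (size (s 0))) (i (s 0)) n (g (s 0))"
      using loop by blast
    obtain l s1 where l: "exec d s l s1" "s1 0 = i (s 0)" "l \<le> poly r (size (s 0))"
      using d by blast
    obtain k s' where k: "exec (While (HdE (Var 0)) c) s1 k s'" "s' 0 = g (s 0)"
      "k \<le> 3 + n * (poly p (poly q (size (s 0))) + 3)"
      using run[OF n(2), of s1] l(2) by blast
    have "n * (poly p (poly q (size (s 0))) + 3) \<le> poly q (size (s 0)) * (poly p (poly q (size (s 0))) + 3)"
      using n(1) by (rule mult_right_mono) simp
    then have "l + k \<le> poly (r + [:3:] + q * (pcompose p q + [:3:])) (size (s 0))"
      using k(3) l(3) unfolding poly_add poly_mult poly_pcompose poly_pCons poly_0 mult_zero_right add_0_right by linarith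
    with exec.seq[OF l(1) k(1)] k(2)
    show "\<exists>k s'. exec (Seq d (While (HdE (Var 0)) c)) s k s' \<and> s' 0 = g (s 0) \<and>
        k \<le> poly (r + [:3:] + q * (pcompose p q + [:3:])) (size (s 0))" by blast
  next
    show "size (g t) \<le> poly q (size t)" for t
      using loop[of t] loop_size by blast
  qed
qed

text \<open>The right spine of a tree, read as a list. With \<open>of_items\<close> as inverse,
  every tree is the code of a list and malformed codes need no treatment.\<close>

fun items :: "tree \<Rightarrow> tree list" where
  "items NIL = []"
| "items (Cell a b) = a # items b"

fun of_items :: "tree list \<Rightarrow> tree" where
  "of_items [] = NIL"
| "of_items (x # xs) = Cell x (of_items xs)"

lemma items_of_items [simp]: "items (of_items xs) = xs"
  by (induction xs) auto

lemma of_items_items [simp]: "of_items (items t) = t"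
  by (induction t) auto

lemma of_items_eq_NIL [simp]: "of_items xs = NIL \<longleftrightarrow> xs = []"
  by (cases xs) auto

lemma length_items: "length (items t) \<le> size t"
  by (induction t) auto

lemma items_enc_list [simp]: "items (enc_list f xs) = map f xs"
  by (induction xs) (auto simp: enc_list_def)

text \<open>Growth is charged to the items: each may enlarge the accumulator by at most a constant
  and twice its own size, so the total growth is linear. The input \<open>t\<close> travels along so
  that the step function can consult it.\<close>

lemma ptime_foldl:
  assumes f: "ptime f" and xs: "ptime xs" and a: "ptime a"
    and size_f: "\<And>x a t. size (f (Cell x (Cell a t))) \<le> size a + 2 * size x + 2"
  shows "ptime (\<lambda>t. foldl (\<lambda>a x. f (Cell x (Cell a t))) (a t) (items (xs t)))"
proof -
  define g where "g u = Cell (right (left u))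
    (Cell (f (Cell (left (left u)) (right u))) (right (right u)))" for u
  define h where "h u = Cell NIL
    (Cell (foldl (\<lambda>a x. f (Cell x (Cell a (right (right u))))) (left (right u)) (items (left u)))
      (right (right u)))" for u
  have g: "ptime g"
    unfolding g_def
    by (intro ptime_Cell ptime_left ptime_right ptime_id ptime_comp[OF f])
  \<comment> \<open>The bound is an invariant: consuming \<open>x\<close> lowers
    \<open>2 * size v\<close> by \<open>2 * size x + 2\<close>, exactly what \<open>size_f\<close>
    lets the accumulator gain.\<close>
  have loop: "loop g B (Cell v (Cell a t)) (length (items v)) (h (Cell v (Cell a t)))"
    if "2 * size v + size a + size t + 2 \<le> B" for B v a t
    using that
  proof (induction v arbitrary: a rule: items.induct)
    case 1
    then show ?case by (auto simp: h_def intro!: loop.stop)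
  next
    case (2 x v)
    have gu: "g (Cell (Cell x v) (Cell a t)) = Cell v (Cell (f (Cell x (Cell a t))) t)"
      by (simp add: g_def)
    have hu: "h (Cell (Cell x v) (Cell a t)) = h (Cell v (Cell (f (Cell x (Cell a t))) t))"
      by (simp add: h_def)
    have "loop g B (g (Cell (Cell x v) (Cell a t))) (length (items v)) (h (Cell (Cell x v) (Cell a t)))"
      unfolding gu hu using 2(2) size_f[of x a t] by (intro 2(1)) auto
    then show ?case using 2(2) by (auto intro!: loop.step)
  qed
  have "ptime (\<lambda>t. h (Cell (xs t) (Cell (a t) t)))"
  proof -
    have i: "ptime (\<lambda>t. Cell (xs t) (Cell (a t) t))"
      by (intro ptime_Cell xs a ptime_id)
    obtain c q where q: "\<And>t. size (Cell (xs t) (Cell (a t) t)) \<le> poly q (size t)"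
      using ptimeE[OF i] by metis
    show ?thesis
    proof (rule ptime_loop[OF g i])
      fix t
      have "length (items (xs t)) \<le> poly (2 * q) (size t)"
        using length_items[of "xs t"] q[of t] by simp
      moreover have "loop g (poly (2 * q) (size t)) (Cell (xs t) (Cell (a t) t)) (length (items (xs t)))
          (h (Cell (xs t) (Cell (a t) t)))"
        using q[of t] by (intro loop) simp
      ultimately show "\<exists>n\<le>poly (2 * q) (size t). loop g (poly (2 * q) (size t)) (Cell (xs t) (Cell (a t) t)) n
          (h (Cell (xs t) (Cell (a t) t)))" by blast
    qed
  qed
  from ptime_left[OF ptime_right[OF this]] show ?thesis by (simp add: h_def)
qed

lemma ptime_rev:
  assumes "ptime f"
  shows "ptime (\<lambda>t. of_items (rev (items (f t))))"
proof -
  have "foldl (\<lambda>a x. Cell x a) a xs = of_items (rev xs @ items a)" for a xs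
    by (induction xs arbitrary: a) simp_all
  from this[of NIL] have eq: "(\<lambda>t. of_items (rev (items (f t)))) =
      (\<lambda>t. foldl (\<lambda>a x. (\<lambda>u. Cell (left u) (left (right u))) (Cell x (Cell a t))) NIL (items (f t)))"
    by simp
  show ?thesis
    unfolding eq
    by (rule ptime_foldl) (auto intro!: ptime_Cell ptime_left ptime_right ptime_id ptime_NIL assms)
qed

lemma ptime_foldr:
  assumes "ptime f" "ptime xs" "ptime a"
    and "\<And>x a t. size (f (Cell x (Cell a t))) \<le> size a + 2 * size x + 2"
  shows "ptime (\<lambda>t. foldr (\<lambda>x a. f (Cell x (Cell a t))) (items (xs t)) (a t))"
  using ptime_foldl[OF assms(1) ptime_rev[OF assms(2)] assms(3,4)] by (simp add: foldl_conv_foldr)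

section \<open>Decidable predicates\<close>

definition pdec :: "(tree \<Rightarrow> bool) \<Rightarrow> bool" where
  "pdec P \<longleftrightarrow> ptime (\<lambda>t. enc_bool (P t))"

lemma enc_bool_eq_NIL [simp]: "enc_bool b = NIL \<longleftrightarrow> \<not> b"
  by (cases b) auto

lemma ptime_if:
  assumes "pdec P" "ptime f" "ptime g"
  shows "ptime (\<lambda>t. if P t then f t else g t)"
proof -
  have "(\<lambda>t. if P t then f t else g t) = (\<lambda>t. if enc_bool (P t) = NIL then g t else f t)"
    by auto
  then show ?thesis
    using ptime_case[OF assms(1)[unfolded pdec_def] assms(3,2)] by (simp only:)
qed

lemma pdec_const: "pdec (\<lambda>t. b)"
  unfolding pdec_def by (cases b) (auto intro!: ptime_NIL ptime_Cell)

lemma pdec_if: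
  assumes "pdec P" "pdec Q" "pdec R"
  shows "pdec (\<lambda>t. if P t then Q t else R t)"
proof -
  have "(\<lambda>t. enc_bool (if P t then Q t else R t)) = (\<lambda>t. if P t then enc_bool (Q t) else enc_bool (R t))"
    by auto
  then show ?thesis
    using ptime_if[OF assms(1) assms(2,3)[unfolded pdec_def]] unfolding pdec_def by (simp only:)
qed

lemma pdec_cong:
  assumes "pdec P" "\<And>t. P t \<longleftrightarrow> Q t"
  shows "pdec Q"
proof -
  have "P = Q" using assms(2) by auto
  then show ?thesis using assms(1) by simp
qed

lemma pdec_not: "pdec P \<Longrightarrow> pdec (\<lambda>t. \<not> P t)"
  by (rule pdec_cong[OF pdec_if[of P "\<lambda>t. False" "\<lambda>t. True"]]) (auto intro: pdec_const)

lemma pdec_conj: "pdec P \<Longrightarrow> pdec Q \<Longrightarrow> pdec (\<lambda>t. P t \<and> Q t)"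
  by (rule pdec_cong[OF pdec_if[of P Q "\<lambda>t. False"]]) (auto intro: pdec_const)

lemma pdec_disj: "pdec P \<Longrightarrow> pdec Q \<Longrightarrow> pdec (\<lambda>t. P t \<or> Q t)"
  by (rule pdec_cong[OF pdec_if[of P "\<lambda>t. True" Q]]) (auto intro: pdec_const)

lemma pdec_NIL:
  assumes "ptime f"
  shows "pdec (\<lambda>t. f t = NIL)"
proof -
  have "(\<lambda>t. enc_bool (f t = NIL)) = (\<lambda>t. if f t = NIL then Cell NIL NIL else NIL)"
    by auto
  then show ?thesis
    unfolding pdec_def by (simp only:) (intro ptime_case assms ptime_Cell ptime_NIL)
qed

lemma pdec_comp: "pdec P \<Longrightarrow> ptime f \<Longrightarrow> pdec (\<lambda>t. P (f t))"
  unfolding pdec_def by (rule ptime_comp)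

lemma ptime_filter:
  assumes P: "pdec (\<lambda>u. P (left u) (right u))" and g: "ptime g"
  shows "ptime (\<lambda>t. of_items (filter (\<lambda>x. P x t) (items (g t))))"
proof -
  define f where "f u = (if P (left u) (right (right u)) then Cell (left u) (left (right u))
    else left (right u))" for u
  have "pdec (\<lambda>u. P (left u) (right (right u)))"
    using pdec_comp[OF P, of "\<lambda>u. Cell (left u) (right (right u))"]
    by (simp add: ptime_Cell ptime_left ptime_right ptime_id)
  then have f: "ptime f"
    unfolding f_def by (intro ptime_if ptime_Cell ptime_left ptime_right ptime_id)
  have eq: "of_items (filter (\<lambda>x. P x t) xs) = foldr (\<lambda>x a. f (Cell x (Cell a t))) xs NIL" for t xs
    by (induction xs) (auto simp: f_def)
  show ?thesis
    unfolding eq by (rule ptime_foldr[OF f g ptime_NIL]) (simp add: f_def)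
qed

lemma pdec_ex:
  assumes "pdec (\<lambda>u. P (left u) (right u))" "ptime g"
  shows "pdec (\<lambda>t. \<exists>x\<in>set (items (g t)). P x t)"
  by (rule pdec_cong[OF pdec_not[OF pdec_NIL[OF ptime_filter[OF assms]]]]) (auto simp: filter_empty_conv)

lemma pdec_all:
  assumes "pdec (\<lambda>u. P (left u) (right u))" "ptime g"
  shows "pdec (\<lambda>t. \<forall>x\<in>set (items (g t)). P x t)"
  by (rule pdec_cong[OF pdec_not[OF pdec_ex[OF pdec_not[OF assms(1)] assms(2)]]]) simp

text \<open>A program can only test whether a root is \<open>NIL\<close>, so equality needs a
  simultaneous traversal with an explicit stack. A mismatch turns the whole state into
  \<open>NIL\<close>, which both stops the loop and is the negative answer.\<close>

lemma pdec_eq: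
  assumes "ptime f" "ptime g"
  shows "pdec (\<lambda>t. f t = g t)"
proof -
  \<comment> \<open>The state is a list of pairs of trees that remain to be compared, and the answer.\<close>
  define h where "h s = (let a = left (left (left s)); b = right (left (left s)); rest = right (left s) in
    if a = NIL then if b = NIL then Cell rest (right s) else NIL
    else if b = NIL then NIL
    else Cell (Cell (Cell (left a) (left b)) (Cell (Cell (right a) (right b)) rest)) (right s))" for s
  define st where "st ps = of_items (map (\<lambda>(a, b). Cell a b) ps)" for ps
  \<comment> \<open>\<open>2 * size a + 1\<close> counts all nodes of \<open>a\<close>, leaves
    included; every iteration without a mismatch removes exactly one.\<close>
  define \<mu> :: "(tree \<times> tree) list \<Rightarrow> nat" where "\<mu> ps = (\<Sum>(a, b)\<leftarrow>ps. 2 * size a + 1)" for ps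
  have st_simps: "st [] = NIL" "st ((a, b) # ps) = Cell (Cell a b) (st ps)" for a b ps
    by (auto simp: st_def)
  have loop: "\<exists>n\<le>\<mu> ps. loop h B (Cell (st ps) (Cell NIL NIL)) n
      (if \<forall>(a, b)\<in>set ps. a = b then Cell NIL (Cell NIL NIL) else NIL)"
    if "size (st ps) + 2 \<le> B" for ps B
    using that
  proof (induction "\<mu> ps" arbitrary: ps rule: less_induct)
    case less
    show ?case
    proof (cases ps)
      case Nil
      then show ?thesis using less.prems
        by (auto simp: st_simps intro!: exI[of _ 0] loop.stop)
    next
      case (Cons p ps')
      obtain a b where p: "p = (a, b)" by force
      let ?res = "\<lambda>ps. if \<forall>(a, b)\<in>set ps. a = b then Cell NIL (Cell NIL NIL) else NIL"
      have nonNIL: "left (Cell (st ps) (Cell NIL NIL)) \<noteq> NIL" by (simp add: Cons p st_simps)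
      have sz: "size (Cell (st ps) (Cell NIL NIL)) \<le> B" using less.prems by simp
      consider "a = NIL" "b = NIL" | "a = NIL \<longleftrightarrow> b \<noteq> NIL"
        | a1 a2 b1 b2 where "a = Cell a1 a2" "b = Cell b1 b2"
        by (cases a; cases b) auto
      then show ?thesis
      proof cases
        case 1
        have "\<mu> ps' < \<mu> ps" by (simp add: \<mu>_def Cons p)
        moreover have "size (st ps') + 2 \<le> B" using less.prems by (simp add: Cons p st_simps)
        ultimately obtain n where n: "n \<le> \<mu> ps'"
          "loop h B (Cell (st ps') (Cell NIL NIL)) n (?res ps')"
          using less.hyps by blast
        have "h (Cell (st ps) (Cell NIL NIL)) = Cell (st ps') (Cell NIL NIL)"
          by (simp add: h_def Cons p st_simps 1)
        moreover have "?res ps = ?res ps'" by (simp add: Cons p 1)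
        ultimately have "loop h B (Cell (st ps) (Cell NIL NIL)) (Suc n) (?res ps)"
          using n(2) by (simp only:) (rule loop.step[OF nonNIL sz], simp)
        moreover have "Suc n \<le> \<mu> ps" using n(1) \<open>\<mu> ps' < \<mu> ps\<close> by simp
        ultimately show ?thesis by blast
      next
        case 2
        have "h (Cell (st ps) (Cell NIL NIL)) = NIL"
          using 2 by (auto simp: h_def Cons p st_simps Let_def)
        moreover have "?res ps = NIL" using 2 by (auto simp: Cons p)
        ultimately have "loop h B (Cell (st ps) (Cell NIL NIL)) (Suc 0) (?res ps)"
          by (intro loop.step[OF nonNIL sz]) (auto intro: loop.stop)
        moreover have "Suc 0 \<le> \<mu> ps" by (simp add: \<mu>_def Cons p)
        ultimately show ?thesis by blast
      next
        case 3
        let ?ps = "(a1, b1) # (a2, b2) # ps'"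
        have lt: "\<mu> ?ps < \<mu> ps" by (simp add: \<mu>_def Cons p 3)
        moreover have "size (st ?ps) + 2 \<le> B" using less.prems by (simp add: Cons p st_simps 3)
        ultimately obtain n where n: "n \<le> \<mu> ?ps"
          "loop h B (Cell (st ?ps) (Cell NIL NIL)) n (?res ?ps)"
          using less.hyps by blast
        have "h (Cell (st ps) (Cell NIL NIL)) = Cell (st ?ps) (Cell NIL NIL)"
          by (simp add: h_def Cons p st_simps 3)
        moreover have "?res ps = ?res ?ps" by (auto simp: Cons p 3)
        ultimately have "loop h B (Cell (st ps) (Cell NIL NIL)) (Suc n) (?res ps)"
          using n(2) by (simp only:) (rule loop.step[OF nonNIL sz], simp)
        moreover have "Suc n \<le> \<mu> ps" using n(1) lt by simp
        ultimately show ?thesis by blast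
      qed
    qed
  qed
  have h: "ptime h"
    unfolding h_def Let_def
    by (intro ptime_if pdec_NIL ptime_Cell ptime_left ptime_right ptime_id ptime_NIL)
  have i: "ptime (\<lambda>t. Cell (Cell (Cell (f t) (g t)) NIL) (Cell NIL NIL))"
    by (intro ptime_Cell ptime_NIL assms)
  obtain c q where q: "\<And>t. size (Cell (Cell (Cell (f t) (g t)) NIL) (Cell NIL NIL)) \<le> poly q (size t)"
    using ptimeE[OF i] by metis
  have "ptime (\<lambda>t. if f t = g t then Cell NIL (Cell NIL NIL) else NIL)"
  proof (rule ptime_loop[OF h i])
    fix t
    have "\<exists>n\<le>2 * size (f t) + 1. loop h (poly (2 * q) (size t))
       (Cell (Cell (Cell (f t) (g t)) NIL) (Cell NIL NIL)) n
       (if f t = g t then Cell NIL (Cell NIL NIL) else NIL)"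
      using loop[of "[(f t, g t)]" "poly (2 * q) (size t)"] q[of t]
      by (simp add: st_simps \<mu>_def)
    moreover have "2 * size (f t) + 1 \<le> poly (2 * q) (size t)" using q[of t] by simp
    ultimately show "\<exists>n\<le>poly (2 * q) (size t). loop h (poly (2 * q) (size t))
       (Cell (Cell (Cell (f t) (g t)) NIL) (Cell NIL NIL)) n
       (if f t = g t then Cell NIL (Cell NIL NIL) else NIL)"
      by (meson order_trans)
  qed
  from pdec_not[OF pdec_NIL[OF this]] show ?thesis by (rule pdec_cong) simp
qed

section \<open>The decision procedure\<close>

text \<open>The pair of the entries at even and at odd positions. A new front element shifts all
  positions by one, so the halves change places and the element joins the even one.\<close>

definition halves :: "tree \<Rightarrow> tree" where
  "halves t = foldr (\<lambda>x u. Cell (Cell x (right u)) (left u)) (items t) (Cell NIL NIL)"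

text \<open>
  Indices are given in binary, so that the digits of an index tell whether the sought entry is in
  the even or in the odd half of the list.
\<close>

definition lookup :: "tree \<Rightarrow> tree \<Rightarrow> tree" where
  "lookup t y = left (foldl (\<lambda>a b. if b = NIL then left (halves a) else right (halves a)) t (items y))"

text \<open>The additional cell is the pair itself, so neither half is larger than the list; this
  gives the growth condition for the fold in \<open>lookup\<close>.\<close>

lemma size_halves: "size (halves t) = size t + 1"
proof (induction t)
  case (Cell x t)
  then have "halves t \<noteq> NIL" by auto
  then obtain a b where "halves t = Cell a b" by (cases "halves t") auto
  with Cell show ?case by (simp add: halves_def)
qed (simp add: halves_def)

lemma ptime_halves: "ptime halves"
proof -
  have eq: "halves = (\<lambda>t. foldr (\<lambda>x u. (\<lambda>w. Cell (Cell (left w) (right (left (right w)))) (left (left (right w))))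
      (Cell x (Cell u t))) (items t) (Cell NIL NIL))"
    by (simp add: halves_def fun_eq_iff)
  have le: "size (right u) + size (left u) \<le> size u" for u by (cases u) auto
  show ?thesis
    unfolding eq
  proof (intro ptime_foldr ptime_Cell ptime_left ptime_right ptime_id ptime_NIL)
    show "size (Cell (Cell (left (Cell x (Cell u t))) (right (left (right (Cell x (Cell u t))))))
        (left (left (right (Cell x (Cell u t)))))) \<le> size u + 2 * size x + 2" for x u t
      using le[of u] by simp
  qed
qed

lemma ptime_lookup:
  assumes "ptime f" "ptime g"
  shows "ptime (\<lambda>t. lookup (f t) (g t))"
proof -
  define h where "h w = (if left w = NIL then left (halves (left (right w)))
    else right (halves (left (right w))))" for w
  have h: "ptime h"
    unfolding h_def
    by (intro ptime_if pdec_NIL ptime_left ptime_right ptime_comp[OF ptime_halves] ptime_id)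
  have "size (left (halves a)) \<le> size a" "size (right (halves a)) \<le> size a" for a
    using size_halves[of a] by (cases "halves a"; simp)+
  then have size_h: "size (h (Cell x (Cell a t))) \<le> size a + 2 * size x + 2" for x a t
    unfolding h_def by (simp add: le_SucI trans_le_add1)
  have eq: "lookup (f t) (g t) = left (foldl (\<lambda>a x. h (Cell x (Cell a t))) (f t) (items (g t)))" for t
    by (simp add: lookup_def h_def cong: if_cong)
  show ?thesis
    unfolding eq by (intro ptime_left ptime_foldl h assms size_h)
qed

text \<open>The default \<open>NIL\<close> is also the code of \<open>Inf\<close>, so a clock beyond
  the end of a row counts as outside the up-set. The empty row thus stands for the empty
  up-set.\<close>

definition nth_tree :: "tree list \<Rightarrow> nat \<Rightarrow> tree" where
  "nth_tree xs k = (if k < length xs then xs ! k else NIL)"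

lemma nth_tree_Cons: "nth_tree (x # xs) k = (case k of 0 \<Rightarrow> x | Suc j \<Rightarrow> nth_tree xs j)"
  by (simp add: nth_tree_def split: nat.split)

lemma nth_tree_halves:
  "nth_tree (items (left (halves t))) k = nth_tree (items t) (2 * k) \<and>
   nth_tree (items (right (halves t))) k = nth_tree (items t) (2 * k + 1)"
proof (induction t arbitrary: k)
  case NIL
  show ?case by (simp add: halves_def nth_tree_def)
next
  case (Cell x t)
  have "halves (Cell x t) = Cell (Cell x (right (halves t))) (left (halves t))"
    by (simp add: halves_def)
  then show ?case
    using Cell by (auto simp: nth_tree_Cons split: nat.split)
qed

lemma lookup_enc_nat: "lookup t (enc_nat y) = nth_tree (items t) y"
proof (induction y arbitrary: t rule: less_induct)
  case (less y)
  show ?case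
  proof (cases "y = 0")
    case True
    then show ?thesis by (cases t) (simp_all add: lookup_def enc_nat.simps[of 0] nth_tree_def)
  next
    case False
    let ?t = "if odd y then right (halves t) else left (halves t)"
    have "lookup t (enc_nat y) = lookup ?t (enc_nat (y div 2))"
      using False by (subst enc_nat.simps) (simp add: lookup_def)
    also have "\<dots> = nth_tree (items ?t) (y div 2)"
      using False by (intro less) simp
    also have "\<dots> = nth_tree (items t) y"
      using nth_tree_halves[of t "y div 2"] by (cases "odd y") auto
    finally show ?thesis .
  qed
qed

text \<open>
  In the following functions, \<open>r\<close> is an encoded row of a DBM and \<open>e\<close> an encoded edge of the zone graph.
\<close>

definition nonpos_tree :: "tree \<Rightarrow> bool" where
  "nonpos_tree b \<longleftrightarrow> b \<noteq> NIL \<and> (left (right b) \<noteq> NIL \<or> right (right b) = NIL)"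

text \<open>The comparisons \<open>CEq\<close>, \<open>CGe\<close>, \<open>CGt\<close> have the
  codes 2, 3, 4, and \<open>CLt\<close>, \<open>CLe\<close> the codes 0, 1. Dropping the lowest
  digit therefore leaves a nonempty list exactly for the former. The second test says that the
  constant is not 0, and the last line ranges over the resets.\<close>

definition edge_ok_tree :: "tree \<Rightarrow> tree \<Rightarrow> bool" where
  "edge_ok_tree r e \<longleftrightarrow>
     (\<forall>g\<in>set (items (left (right (left (right e))))).
        right (left (right g)) \<noteq> NIL \<and> right (right g) \<noteq> NIL \<longrightarrow> nonpos_tree (lookup r (left g))) \<and>
     (\<forall>y\<in>set (items (left (right (right (left (right e)))))). \<not> nonpos_tree (lookup r y))"

definition trim_tree :: "tree \<Rightarrow> tree" where
  "trim_tree es = of_items (filter (\<lambda>e. \<exists>e'\<in>set (items es). left e' = right (right e)) (items es))"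

definition trim_all_tree :: "tree \<Rightarrow> tree" where
  "trim_all_tree es = foldl (\<lambda>a _. trim_tree a) es (items es)"

definition row_ok_tree :: "tree \<Rightarrow> tree \<Rightarrow> bool" where
  "row_ok_tree r es \<longleftrightarrow> trim_all_tree (of_items (filter (edge_ok_tree r) (items es))) \<noteq> NIL"

text \<open>The row \<open>NIL\<close> covers the case in which no clock is lifted again and again:
  it admits the edges that lift nothing.\<close>

definition zeno_tree :: "tree \<Rightarrow> bool" where
  "zeno_tree t \<longleftrightarrow> row_ok_tree NIL (right (right t)) \<or>
     (\<exists>m\<in>set (items (left (right t))). \<exists>r\<in>set (items (right m)). row_ok_tree r (right (right t)))"

lemmas ptime_basics = ptime_left ptime_right ptime_Cell ptime_id ptime_NIL ptime_lookup
  pdec_NIL pdec_not pdec_conj pdec_disj pdec_ex pdec_all pdec_eq ptime_filter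

lemma pdec_nonpos: "ptime f \<Longrightarrow> pdec (\<lambda>t. nonpos_tree (f t))"
  unfolding nonpos_tree_def by (intro ptime_basics)

lemma pdec_edge_ok:
  assumes "ptime f" "ptime g"
  shows "pdec (\<lambda>t. edge_ok_tree (f t) (g t))"
proof -
  have "pdec (\<lambda>u. edge_ok_tree (left u) (right u))"
    unfolding edge_ok_tree_def imp_conv_disj by (intro ptime_basics pdec_nonpos)
  from pdec_comp[OF this ptime_Cell[OF assms]] show ?thesis by simp
qed

lemma ptime_trim: "ptime trim_tree"
  unfolding trim_tree_def[abs_def] by (intro ptime_basics)

lemma size_of_items_filter: "size (of_items (filter P (items t))) \<le> size t"
  by (induction t) auto

lemma ptime_trim_all:
  assumes "ptime f"
  shows "ptime (\<lambda>t. trim_all_tree (f t))"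
proof -
  have eq: "trim_all_tree (f t) = foldl (\<lambda>a x. (\<lambda>u. trim_tree (left (right u))) (Cell x (Cell a t))) (f t) (items (f t))"
    for t by (simp add: trim_all_tree_def)
  have le: "size (trim_tree a) \<le> size a" for a
    unfolding trim_tree_def by (rule size_of_items_filter)
  show ?thesis
    unfolding eq
  proof (intro ptime_foldl ptime_comp[OF ptime_trim] ptime_left ptime_right ptime_id assms)
    show "size (trim_tree (left (right (Cell x (Cell a t))))) \<le> size a + 2 * size x + 2" for x a t
      using le[of a] by simp
  qed
qed

lemma pdec_row_ok:
  assumes "ptime f" "ptime g"
  shows "pdec (\<lambda>t. row_ok_tree (f t) (g t))"
proof -
  have "pdec (\<lambda>u. row_ok_tree (left u) (right u))"
    unfolding row_ok_tree_def by (intro ptime_basics ptime_trim_all pdec_edge_ok)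
  from pdec_comp[OF this ptime_Cell[OF assms]] show ?thesis by simp
qed

lemma pdec_zeno_tree: "pdec zeno_tree"
  unfolding zeno_tree_def[abs_def] by (intro ptime_basics pdec_row_ok)

lemma polytime_solvable_pdec:
  assumes "pdec P"
  shows "polytime_solvable enc I (\<lambda>i. P (enc i))"
proof -
  obtain c p where *: "\<And>s. \<exists>k s'. exec c s k s' \<and> s' 0 = enc_bool (P (s 0)) \<and> k \<le> poly p (size (s 0))"
    using ptimeE[OF assms[unfolded pdec_def]] by metis
  show ?thesis
    unfolding polytime_solvable_def
  proof (intro exI[of _ c] exI[of _ p] ballI)
    fix i
    show "\<exists>k s. exec c ((\<lambda>_. NIL)(0 := enc i)) k s \<and> k \<le> poly p (size (enc i)) \<and>
        (s 0 \<noteq> NIL \<longleftrightarrow> P (enc i))"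
      using *[of "(\<lambda>_. NIL)(0 := enc i)"] by fastforce
  qed
qed

section \<open>Trimming and infinite paths\<close>

lemma trim_all_tree_eq_funpow: "trim_all_tree es = (trim_tree ^^ length (items es)) es"
proof -
  have "foldl (\<lambda>a _. trim_tree a) a xs = (trim_tree ^^ length xs) a" for a :: tree and xs :: "tree list"
    by (induction xs arbitrary: a) (simp_all add: funpow_swap1)
  then show ?thesis by (simp add: trim_all_tree_def)
qed

text \<open>A round that changes the list removes at least one edge, so as many rounds as there are
  edges reach a fixed point, at the latest the empty list.\<close>

lemma trim_tree_fixpoint: "trim_tree (trim_all_tree es) = trim_all_tree es"
proof -
  define E where "E k = (trim_tree ^^ k) es" for k
  have E_Suc: "E (Suc k) = trim_tree (E k)" for k by (simp add: E_def)
  have decr: "trim_tree u = u \<or> length (items (trim_tree u)) < length (items u)" for u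
  proof (rule disjCI)
    assume "\<not> length (items (trim_tree u)) < length (items u)"
    then have "items (trim_tree u) = items u"
      unfolding trim_tree_def
      by (simp add: not_less) (metis filter_True length_filter_less not_less)
    then show "trim_tree u = u" by (metis of_items_items)
  qed
  have "trim_tree (E k) = E k \<or> length (items (E k)) + k \<le> length (items es)" for k
  proof (induction k)
    case 0
    then show ?case by (simp add: E_def)
  next
    case (Suc k)
    then show ?case using decr[of "E k"] unfolding E_Suc by auto
  qed
  from this[of "length (items es)"] have "trim_tree (E (length (items es))) = E (length (items es))"
    by (cases "E (length (items es))") (auto simp: trim_tree_def)
  then show ?thesis by (simp add: trim_all_tree_eq_funpow E_def)
qed

text \<open>In the fixed point every edge has a successor, so dependent choice yields a path unless
  it is empty. Conversely, the edges of an infinite path are successors of each other and survive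
  every round.\<close>

lemma trim_all_tree_nonempty_iff:
  "trim_all_tree es \<noteq> NIL \<longleftrightarrow>
     (\<exists>e :: nat \<Rightarrow> tree. \<forall>i. e i \<in> set (items es) \<and> left (e (Suc i)) = right (right (e i)))"
proof
  let ?E = "trim_all_tree es"
  have subset: "set (items ((trim_tree ^^ k) es)) \<subseteq> set (items es)" for k
    by (induction k) (auto simp: trim_tree_def)
  assume "?E \<noteq> NIL"
  then obtain e0 where e0: "e0 \<in> set (items ?E)" by (cases ?E) auto
  have "\<exists>e'\<in>set (items ?E). left e' = right (right e)" if "e \<in> set (items ?E)" for e
  proof -
    have "filter (\<lambda>e. \<exists>e'\<in>set (items ?E). left e' = right (right e)) (items ?E) = items ?E"
      using arg_cong[OF trim_tree_fixpoint[of es], of items]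
      by (simp only: trim_tree_def items_of_items)
    then show ?thesis
      using that unfolding filter_id_conv by blast
  qed
  then have "\<exists>e :: nat \<Rightarrow> tree. \<forall>i. e i \<in> set (items ?E) \<and> left (e (Suc i)) = right (right (e i))"
    using e0 dependent_nat_choice[of "\<lambda>_ e. e \<in> set (items ?E)" "\<lambda>_ e e'. left e' = right (right e)"]
    by metis
  then show "\<exists>e :: nat \<Rightarrow> tree. \<forall>i. e i \<in> set (items es) \<and> left (e (Suc i)) = right (right (e i))"
    using subset[of "length (items es)"] unfolding trim_all_tree_eq_funpow by blast
next
  assume "\<exists>e :: nat \<Rightarrow> tree. \<forall>i. e i \<in> set (items es) \<and> left (e (Suc i)) = right (right (e i))"
  then obtain e :: "nat \<Rightarrow> tree" where e: "\<And>i. e i \<in> set (items es)" "\<And>i. left (e (Suc i)) = right (right (e i))"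
    by blast
  have "\<forall>i. e i \<in> set (items ((trim_tree ^^ k) es))" for k
    by (induction k) (use e in \<open>auto simp: trim_tree_def\<close>)
  then show "trim_all_tree es \<noteq> NIL"
    unfolding trim_all_tree_eq_funpow by (metis empty_iff items.simps(1) list.set(1))
qed

section \<open>Zones and canonical bounds\<close>

text \<open>
  Zones are handled semantically, as sets that are closed under the coordinatewise operations
  below.  They include maximum, minimum and rounding to integers.  The reference clock takes part
  in an operation, after which all clocks are shifted to bring it back to \<open>0\<close>.
\<close>

definition zop :: "(real \<Rightarrow> real \<Rightarrow> real) \<Rightarrow> bool" where
  "zop g \<longleftrightarrow> (\<forall>a b a' b' (c :: int).
     (a - a' \<le> c \<and> b - b' \<le> c \<longrightarrow> g a b - g a' b' \<le> c) \<and>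
     (a - a' < c \<and> b - b' < c \<longrightarrow> g a b - g a' b' < c))"

lemma zop_le: "zop g \<Longrightarrow> a - a' \<le> real_of_int c \<Longrightarrow> b - b' \<le> real_of_int c \<Longrightarrow> g a b - g a' b' \<le> real_of_int c"
  unfolding zop_def by blast

lemma zop_less: "zop g \<Longrightarrow> a - a' < real_of_int c \<Longrightarrow> b - b' < real_of_int c \<Longrightarrow> g a b - g a' b' < real_of_int c"
  unfolding zop_def by blast

lemma zop_mono: "zop g \<Longrightarrow> a \<le> a' \<Longrightarrow> b \<le> b' \<Longrightarrow> g a b \<le> g a' b'"
  using zop_le[of g a a' 0 b b'] by simp

lemma zop_max: "zop (\<lambda>a b. max a (b + s))"
  unfolding zop_def by (auto simp: max_def)

lemma zop_min: "zop (\<lambda>a b. min a (b + s))"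
  unfolding zop_def by (auto simp: min_def)

text \<open>Rounding up preserves differences \<open>\<le> c\<close> for integers \<open>c\<close>,
  but a difference \<open>< c\<close> may become equal to \<open>c\<close>. The positive weight of
  the unrounded value restores strictness.\<close>

lemma zop_ceiling:
  assumes "0 < \<epsilon>" "\<epsilon> \<le> 1"
  shows "zop (\<lambda>a b. \<epsilon> * (a + r) + (1 - \<epsilon>) * real_of_int \<lceil>a + r\<rceil>)"
  unfolding zop_def
proof (intro allI conjI impI; elim conjE)
  fix a a' :: real and c :: int
  have ceil: "real_of_int \<lceil>a + r\<rceil> \<le> real_of_int \<lceil>a' + r\<rceil> + real_of_int c" if "a - a' \<le> real_of_int c"
  proof -
    have "\<lceil>a + r\<rceil> \<le> \<lceil>a' + r + real_of_int c\<rceil>" using that by (intro ceiling_mono) simp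
    then show ?thesis by simp
  qed
  show "\<epsilon> * (a + r) + (1 - \<epsilon>) * real_of_int \<lceil>a + r\<rceil> -
      (\<epsilon> * (a' + r) + (1 - \<epsilon>) * real_of_int \<lceil>a' + r\<rceil>) \<le> real_of_int c"
    if "a - a' \<le> real_of_int c"
  proof -
    have "\<epsilon> * (a - a') \<le> \<epsilon> * real_of_int c" using that assms by (intro mult_left_mono) auto
    moreover have "(1 - \<epsilon>) * real_of_int \<lceil>a + r\<rceil> \<le> (1 - \<epsilon>) * (real_of_int \<lceil>a' + r\<rceil> + real_of_int c)"
      using ceil[OF that] assms by (intro mult_left_mono) auto
    ultimately show ?thesis by (simp add: algebra_simps)
  qed
  show "\<epsilon> * (a + r) + (1 - \<epsilon>) * real_of_int \<lceil>a + r\<rceil> -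
      (\<epsilon> * (a' + r) + (1 - \<epsilon>) * real_of_int \<lceil>a' + r\<rceil>) < real_of_int c"
    if "a - a' < real_of_int c"
  proof -
    have "\<epsilon> * (a - a') < \<epsilon> * real_of_int c" using that assms by (intro mult_strict_left_mono) auto
    moreover have "(1 - \<epsilon>) * real_of_int \<lceil>a + r\<rceil> \<le> (1 - \<epsilon>) * (real_of_int \<lceil>a' + r\<rceil> + real_of_int c)"
      using ceil that assms by (intro mult_left_mono) auto
    ultimately show ?thesis by (simp add: algebra_simps)
  qed
qed

definition anchor :: "nat \<Rightarrow> valuation \<Rightarrow> valuation" where
  "anchor n u = (\<lambda>i. if i \<in> {1..n} then u i - u 0 else 0)"

lemma anchor_apply: "i \<le> n \<Longrightarrow> anchor n u i = u i - u 0"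
  by (cases i) (auto simp: anchor_def)

lemma valuation_0 [simp]: "valuation n v \<Longrightarrow> v 0 = 0"
  by (simp add: valuation_def)

lemma valuation_nonneg: "valuation n v \<Longrightarrow> 0 \<le> v i"
  unfolding valuation_def by (cases "i \<in> {1..n}") auto

text \<open>This closure property passes through guards, resets and delays directly. Exhibiting
  constraints for \<open>post\<close> would instead require eliminating the delay and the old values
  of the reset clocks.\<close>

definition zone_like :: "nat \<Rightarrow> valuation set \<Rightarrow> bool" where
  "zone_like n Z \<longleftrightarrow> (\<forall>v\<in>Z. valuation n v) \<and>
     (\<forall>g v w. zop g \<longrightarrow> v \<in> Z \<longrightarrow> w \<in> Z \<longrightarrow> anchor n (\<lambda>i. g (v i) (w i)) \<in> Z)"

lemma zone_like_valuation: "zone_like n Z \<Longrightarrow> v \<in> Z \<Longrightarrow> valuation n v"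
  by (simp add: zone_like_def)

lemma zone_like_anchor:
  "zone_like n Z \<Longrightarrow> zop g \<Longrightarrow> v \<in> Z \<Longrightarrow> w \<in> Z \<Longrightarrow> anchor n (\<lambda>i. g (v i) (w i)) \<in> Z"
  by (simp add: zone_like_def)

lemma valuation_anchor:
  assumes "zop g" "valuation n v" "valuation n w"
  shows "valuation n (anchor n (\<lambda>i. g (v i) (w i)))"
  using assms zop_mono[OF assms(1)] valuation_nonneg[OF assms(2)] valuation_nonneg[OF assms(3)]
  by (auto simp: valuation_def anchor_def)

lemma cmp_holds_anchor:
  assumes "zop g" "x \<le> n" "y \<le> n"
    and "cmp_holds op (v x - v y) (real_of_int c)" "cmp_holds op (w x - w y) (real_of_int c)"
  shows "cmp_holds op (anchor n (\<lambda>i. g (v i) (w i)) x - anchor n (\<lambda>i. g (v i) (w i)) y) (real_of_int c)"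
  using assms(4,5) zop_le[OF assms(1), of "v x" "v y" c "w x" "w y"]
    zop_less[OF assms(1), of "v x" "v y" c "w x" "w y"]
    zop_le[OF assms(1), of "v y" "v x" "- c" "w y" "w x"]
    zop_less[OF assms(1), of "v y" "v x" "- c" "w y" "w x"] assms(2,3)
  by (cases op) (auto simp: anchor_apply)

lemma sat_bound_anchor:
  assumes "zop g" "x \<le> n" "y \<le> n" "sat_bound (v x - v y) b" "sat_bound (w x - w y) b"
  shows "sat_bound (anchor n (\<lambda>i. g (v i) (w i)) x - anchor n (\<lambda>i. g (v i) (w i)) y) b"
  using assms zop_le[OF assms(1), of "v x" "v y" _ "w x" "w y"]
    zop_less[OF assms(1), of "v x" "v y" _ "w x" "w y"]
  by (cases b) (auto simp: anchor_apply)

lemma zone_like_zone: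
  assumes "zone n Z"
  shows "zone_like n Z"
proof -
  obtain cs where cs: "\<forall>(x, y, _, _)\<in>set cs. x \<le> n \<and> y \<le> n"
    and Z: "Z = {v. valuation n v \<and> (\<forall>(x, y, op, c)\<in>set cs. cmp_holds op (v x - v y) (real_of_int c))}"
    using assms unfolding zone_def by blast
  show ?thesis
    unfolding zone_like_def Z
    using cs by (fastforce intro: valuation_anchor cmp_holds_anchor)
qed

lemma zone_like_dbm_set: "zone_like n (dbm_set n D)"
  unfolding zone_like_def dbm_set_def
  by (auto intro: valuation_anchor sat_bound_anchor)

lemma zone_like_initial: "zone_like (nclocks A) (initial_zone A)"
  unfolding zone_like_def
proof (intro conjI ballI allI impI)
  fix g v w assume g: "zop g" and v: "v \<in> initial_zone A" and w: "w \<in> initial_zone A"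
  obtain d e where "v = delay (nclocks A) (\<lambda>_. 0) d" "w = delay (nclocks A) (\<lambda>_. 0) e" "0 \<le> d" "0 \<le> e"
    using v w unfolding initial_zone_def by blast
  then have "anchor (nclocks A) (\<lambda>i. g (v i) (w i)) = delay (nclocks A) (\<lambda>_. 0) (g d e - g 0 0)"
    and "0 \<le> g d e - g 0 0"
    using zop_mono[OF g, of 0 d 0 e] by (auto simp: anchor_def delay_def)
  then show "anchor (nclocks A) (\<lambda>i. g (v i) (w i)) \<in> initial_zone A"
    unfolding initial_zone_def by blast
qed (auto simp: initial_zone_def valuation_def delay_def)

lemma zone_like_post:
  assumes A: "timed_automaton A" and t: "t \<in> set (trans A)" and Z: "zone_like (nclocks A) Z"
  shows "zone_like (nclocks A) (post A t Z)"
proof -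
  let ?n = "nclocks A"
  have R: "set (resets t) \<subseteq> {1..?n}" and G: "\<And>x op c. (x, op, c) \<in> set (guard t) \<Longrightarrow> x \<in> {1..?n}"
    using A t unfolding timed_automaton_def by fastforce+
  show ?thesis
    unfolding zone_like_def
  proof (intro conjI ballI allI impI)
    fix u assume "u \<in> post A t Z"
    then obtain v d where u: "u = delay ?n (reset (resets t) v) d" "v \<in> Z" "0 \<le> d"
      unfolding post_def by blast
    have "valuation ?n v" using Z u zone_like_valuation by blast
    then show "valuation ?n u" using u R by (auto simp: valuation_def delay_def reset_def)
  next
    fix g v' w' assume g: "zop g" and "v' \<in> post A t Z" "w' \<in> post A t Z"
    then obtain v w d e where v: "v' = delay ?n (reset (resets t) v) d" "v \<in> Z" "sat_guard v (guard t)" "0 \<le> d"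
      and w: "w' = delay ?n (reset (resets t) w) e" "w \<in> Z" "sat_guard w (guard t)" "0 \<le> e"
      unfolding post_def by blast
    \<comment> \<open>Relative to the reference clock, a delay only moves the reference clock; hence
      the operation on the delayed valuations is a shifted operation on the original ones.\<close>
    define h where "h a b = g (a + d) (b + e)" for a b
    have h: "zop h" using g unfolding zop_def h_def by (auto simp: algebra_simps)
    define z where "z = anchor ?n (\<lambda>i. h (v i) (w i))"
    have v0: "v 0 = 0" "w 0 = 0" using v w Z zone_like_valuation valuation_0 by blast+
    have "z \<in> Z" unfolding z_def by (rule zone_like_anchor[OF Z h v(2) w(2)])
    moreover have "sat_guard z (guard t)"
      unfolding sat_guard_def
    proof clarify
      fix x op c assume xc: "(x, op, c) \<in> set (guard t)"
      have "cmp_holds op (z x - z 0) (real_of_int (int c))"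
        unfolding z_def
        by (rule cmp_holds_anchor[OF h]) (use xc G v w v0 in \<open>auto simp: sat_guard_def\<close>)
      then show "cmp_holds op (z x) (real c)" by (simp add: z_def anchor_def)
    qed
    moreover have "0 \<le> g d e - g 0 0" using zop_mono[OF g, of 0 d 0 e] v w by simp
    moreover have "anchor ?n (\<lambda>i. g (v' i) (w' i)) = delay ?n (reset (resets t) z) (g d e - g 0 0)"
      using v0 R by (auto simp: fun_eq_iff anchor_def delay_def reset_def v(1) w(1) z_def h_def)
    ultimately show "anchor ?n (\<lambda>i. g (v' i) (w' i)) \<in> post A t Z"
      unfolding post_def by blast
  qed
qed

text \<open>The bound is \<open>Inf\<close>, \<open>Le c\<close> or \<open>Lt c\<close>, as the
  differences are unbounded, attain the rounded-up supremum \<open>c\<close>, or only approach it.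
  Rounding inside the zone excludes a supremum strictly between integers.\<close>

lemma tight_bound_exists:
  assumes Z: "zone_like n Z" and ne: "Z \<noteq> {}" and ij: "i \<le> n" "j \<le> n"
  shows "\<exists>b. (\<forall>v\<in>Z. sat_bound (v i - v j) b) \<and> (\<forall>r. sat_bound r b \<longrightarrow> (\<exists>v\<in>Z. r \<le> v i - v j))"
proof -
  let ?S = "(\<lambda>v. v i - v j) ` Z"
  \<comment> \<open>Integer difference constraints are invariant under pushing all clock values, relative to the
    clock \<open>j\<close>, towards the next integer.\<close>
  have push: "\<exists>v'\<in>Z. b \<le> v' i - v' j" if v: "v \<in> Z" and b: "b < real_of_int \<lceil>v i - v j\<rceil>" for v b
  proof -
    define a where "a = v i - v j"
    \<comment> \<open>The pushed difference is
      \<open>\<lceil>a\<rceil> - \<epsilon> * (\<lceil>a\<rceil> - a)\<close>, which falls short of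
      the integer by at most \<open>\<epsilon>\<close> and thus stays above
      \<open>b\<close>.\<close>
    define \<epsilon> where "\<epsilon> = min 1 (real_of_int \<lceil>a\<rceil> - b)"
    have \<epsilon>: "0 < \<epsilon>" "\<epsilon> \<le> 1" using b by (auto simp: \<epsilon>_def a_def)
    define v' where "v' = anchor n (\<lambda>k. \<epsilon> * (v k + - v j) + (1 - \<epsilon>) * real_of_int \<lceil>v k + - v j\<rceil>)"
    have "v' \<in> Z"
      unfolding v'_def using zone_like_anchor[OF Z zop_ceiling[OF \<epsilon>, of "- v j"] v v] .
    moreover have "v' i - v' j = \<epsilon> * a + (1 - \<epsilon>) * real_of_int \<lceil>a\<rceil>"
      using ij by (simp add: v'_def anchor_apply a_def)
    moreover have "\<epsilon> * (real_of_int \<lceil>a\<rceil> - a) \<le> \<epsilon> * 1"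
      using \<epsilon> by (intro mult_left_mono) linarith+
    then have "b \<le> \<epsilon> * a + (1 - \<epsilon>) * real_of_int \<lceil>a\<rceil>"
      by (simp add: algebra_simps \<epsilon>_def)
    ultimately show ?thesis by metis
  qed
  show ?thesis
  proof (cases "bdd_above ?S")
    case False
    then have "\<exists>v\<in>Z. r \<le> v i - v j" for r
      unfolding bdd_above_def by (force simp: not_le intro: less_imp_le)
    then show ?thesis by (intro exI[of _ Inf]) auto
  next
    case True
    define c where "c = \<lceil>Sup ?S\<rceil>"
    have le: "v i - v j \<le> real_of_int c" if "v \<in> Z" for v
    proof -
      have "v i - v j \<le> Sup ?S" using that True by (intro cSup_upper) auto
      then show ?thesis unfolding c_def by linarith
    qed
    show ?thesis
    proof (cases "\<exists>w\<in>Z. w i - w j = real_of_int c")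
      case True
      then obtain w where "w \<in> Z" "w i - w j = real_of_int c" by blast
      then show ?thesis using le by (intro exI[of _ "Le c"]) (auto intro!: bexI[of _ w])
    next
      case False
      have "real_of_int c - 1 < Sup ?S" unfolding c_def by linarith
      then obtain w where w: "w \<in> Z" "real_of_int c - 1 < w i - w j"
        using less_cSup_iff[OF _ True] ne by auto
      have "\<lceil>w i - w j\<rceil> = c" using w le[OF w(1)] by linarith
      then have "\<exists>v\<in>Z. r \<le> v i - v j" if "r < real_of_int c" for r
        using push[OF w(1)] that by simp
      moreover have "v i - v j < real_of_int c" if "v \<in> Z" for v
        using le[OF that] False that by fastforce
      ultimately show ?thesis by (intro exI[of _ "Lt c"]) auto
    qed
  qed
qed

lemma canonical_entry_tight:
  assumes "zone_like n Z" "Z \<noteq> {}" "i \<le> n" "j \<le> n"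
  shows "\<forall>v\<in>Z. sat_bound (v i - v j) (canonical_entry Z i j)"
    and "sat_bound r (canonical_entry Z i j) \<Longrightarrow> \<exists>v\<in>Z. r \<le> v i - v j"
proof -
  obtain b where b: "\<forall>v\<in>Z. sat_bound (v i - v j) b" "\<And>r. sat_bound r b \<Longrightarrow> \<exists>v\<in>Z. r \<le> v i - v j"
    using tight_bound_exists[OF assms] by blast
  have "canonical_entry Z i j = b"
    by (rule canonical_entry_eqI) (use b sat_bound_mono in blast)+
  with b show "\<forall>v\<in>Z. sat_bound (v i - v j) (canonical_entry Z i j)"
    and "sat_bound r (canonical_entry Z i j) \<Longrightarrow> \<exists>v\<in>Z. r \<le> v i - v j" by blast+
qed

definition nonpos :: "bound \<Rightarrow> bool" where
  "nonpos b \<longleftrightarrow> (case b of Le c \<Rightarrow> c \<le> 0 | Lt c \<Rightarrow> c \<le> 0 | Inf \<Rightarrow> False)"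

text \<open>Tightness of the entry makes the converse true; it is what allows the order of two
  clocks to be read off a DBM.\<close>

lemma nonpos_canonical_entry:
  assumes "zone_like n Z" "Z \<noteq> {}" "i \<le> n" "j \<le> n"
  shows "nonpos (canonical_entry Z i j) \<longleftrightarrow> (\<forall>v\<in>Z. v i \<le> v j)"
proof
  assume "nonpos (canonical_entry Z i j)"
  then show "\<forall>v\<in>Z. v i \<le> v j"
    using canonical_entry_tight(1)[OF assms]
    by (cases "canonical_entry Z i j") (fastforce simp: nonpos_def)+
next
  assume le: "\<forall>v\<in>Z. v i \<le> v j"
  have sat: "\<not> sat_bound r (canonical_entry Z i j)" if "0 < r" for r
    using canonical_entry_tight(2)[OF assms] that le by fastforce
  show "nonpos (canonical_entry Z i j)"
  proof (cases "canonical_entry Z i j")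
    case (Le c)
    then show ?thesis using sat[of "real_of_int c"] by (intro ccontr[of "nonpos _"]) (simp add: nonpos_def)
  next
    case (Lt c)
    then show ?thesis using sat[of "real_of_int c - 1 / 2"] by (intro ccontr[of "nonpos _"]) (simp add: nonpos_def)
  next
    case Inf
    then show ?thesis using sat[of 1] by simp
  qed
qed

text \<open>The node codes of an instance contain only canonical entries; by this lemma they
  determine the zone.\<close>

lemma dbm_set_canonical_entry:
  assumes Z: "zone_like n Z" "Z \<noteq> {}" "Z = dbm_set n D"
  shows "dbm_set n (canonical_entry Z) = Z"
proof
  show "Z \<subseteq> dbm_set n (canonical_entry Z)"
    using canonical_entry_tight(1)[OF Z(1,2)] zone_like_valuation[OF Z(1)] by (auto simp: dbm_set_def)
next
  have "\<exists>w\<in>Z. v i - v j \<le> w i - w j" if "v \<in> dbm_set n (canonical_entry Z)" "i \<le> n" "j \<le> n" for v i j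
    using that canonical_entry_tight(2)[OF Z(1,2)] by (auto simp: dbm_set_def)
  then show "dbm_set n (canonical_entry Z) \<subseteq> Z"
    using Z(3) sat_bound_mono unfolding dbm_set_def by blast
qed

section \<open>The extrapolation\<close>

lemma finite_consts: "finite (lower_consts A x)" "finite (upper_consts A x)"
proof -
  have "lower_consts A x \<subseteq> (\<lambda>(x, op, c). int c) ` (\<Union>t\<in>set (trans A). set (guard t))"
    "upper_consts A x \<subseteq> (\<lambda>(x, op, c). int c) ` (\<Union>t\<in>set (trans A). set (guard t))"
    by (force simp: lower_consts_def upper_consts_def)+
  then show "finite (lower_consts A x)" "finite (upper_consts A x)"
    by (auto elim!: finite_subset)
qed

lemma L_bound_ge:
  assumes "c \<in> lower_consts A x" "x \<noteq> 0"
  shows "\<exists>l. L_bound A x = Some l \<and> c \<le> l"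
proof -
  have "Some c \<le> L_bound A x"
    unfolding L_bound_def using assms finite_consts by (auto intro!: Max_ge)
  then show ?thesis by (cases "L_bound A x") auto
qed

lemma U_bound_ge:
  assumes "c \<in> upper_consts A x" "x \<noteq> 0"
  shows "\<exists>u. U_bound A x = Some u \<and> c \<le> u"
proof -
  have "Some c \<le> U_bound A x"
    unfolding U_bound_def using assms finite_consts by (auto intro!: Max_ge)
  then show ?thesis by (cases "U_bound A x") auto
qed

lemma L_bound_nonneg:
  assumes "L_bound A x = Some l"
  shows "0 \<le> l"
proof (cases "x = 0")
  case False
  have "Max (insert None (Some ` lower_consts A x)) \<in> insert None (Some ` lower_consts A x)"
    by (rule Max_in) (auto simp: finite_consts)
  then show ?thesis
    using assms False by (auto simp: L_bound_def lower_consts_def)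
qed (use assms in \<open>simp add: L_bound_def\<close>)

lemma U_bound_nonneg:
  assumes "U_bound A x = Some u"
  shows "0 \<le> u"
proof (cases "x = 0")
  case False
  have "Max (insert None (Some ` upper_consts A x)) \<in> insert None (Some ` upper_consts A x)"
    by (rule Max_in) (auto simp: finite_consts)
  then show ?thesis
    using assms False by (auto simp: U_bound_def upper_consts_def)
qed (use assms in \<open>simp add: U_bound_def\<close>)

lemma weak_U_eq: "U_bound A x = Some u \<Longrightarrow> weak_U A x = Some u"
  by (simp add: weak_U_def)

lemma weak_U_nonneg: "weak_U A x = Some u \<Longrightarrow> 0 \<le> u"
  using U_bound_nonneg[of A x] by (auto simp: weak_U_def split: if_splits)

lemma L_bound_0 [simp]: "L_bound A 0 = Some 0" and U_bound_0 [simp]: "U_bound A 0 = Some 0"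
  by (simp_all add: L_bound_def U_bound_def)

section \<open>The extrapolation is contained in the LU-abstraction\<close>

definition exceeds :: "int option \<Rightarrow> real \<Rightarrow> bool" where
  "exceeds m a \<longleftrightarrow> (\<forall>l. m = Some l \<longrightarrow> real_of_int l < a)"

lemma exceeds_mono: "exceeds m a \<Longrightarrow> a \<le> b \<Longrightarrow> exceeds m b"
  by (fastforce simp: exceeds_def)

text \<open>
  A Helly-type property: lower bounds on clocks survive pointwise maxima, upper bounds survive
  pointwise minima, so pairwise satisfiable bounds are jointly satisfiable.  A solution
  up to a shift \<open>s\<close> suffices, since it can be combined with solutions for the single bounds.
\<close>

lemma pairwise_bounds_satisfiable:
  assumes Z: "zone_like n Z"
    and lo: "\<And>i a b. lo i a \<Longrightarrow> a \<le> b \<Longrightarrow> lo i b" and up: "\<And>i a b. up i b \<Longrightarrow> a \<le> b \<Longrightarrow> up i a"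
    and lo0: "\<And>a. lo 0 a \<longleftrightarrow> 0 \<le> a" and up0: "\<And>a. up 0 a \<longleftrightarrow> a \<le> (0 :: real)"
    and pair: "\<And>i j. i \<le> n \<Longrightarrow> j \<le> n \<Longrightarrow> \<exists>v\<in>Z. \<exists>s. lo i (v i + s) \<and> up j (v j + s)"
  shows "\<exists>v\<in>Z. \<forall>i\<le>n. lo i (v i) \<and> up i (v i)"
proof -
  have v0: "v 0 = 0" if "v \<in> Z" for v using Z that zone_like_valuation valuation_0 by blast
  \<comment> \<open>For \<open>s \<le> 0\<close> the maximum leaves the reference clock at 0, so
    anchoring shifts nothing. The minimum needs \<open>0 \<le> s\<close> for the same
    reason.\<close>
  have max_in: "\<exists>u\<in>Z. \<forall>i\<le>n. u i = max (v i) (w i + s)" if "v \<in> Z" "w \<in> Z" "s \<le> 0" for v w s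
    using zone_like_anchor[OF Z zop_max[of s] that(1,2)] that v0[OF that(1)] v0[OF that(2)]
    by (intro bexI[rotated]) (auto simp: anchor_apply)
  have min_in: "\<exists>u\<in>Z. \<forall>i\<le>n. u i = min (v i) (w i + s)" if "v \<in> Z" "w \<in> Z" "0 \<le> s" for v w s
    using zone_like_anchor[OF Z zop_min[of s] that(1,2)] that v0[OF that(1)] v0[OF that(2)]
    by (intro bexI[rotated]) (auto simp: anchor_apply)
  have ex_lo: "\<exists>v\<in>Z. lo i (v i)" if i: "i \<le> n" for i
  proof -
    obtain v s where "v \<in> Z" "lo i (v i + s)" "up 0 (v 0 + s)" using pair[OF i, of 0] by auto
    then show ?thesis using lo[of i "v i + s" "v i"] v0[of v] by (auto simp: up0)
  qed
  have ex_up: "\<exists>v\<in>Z. up j (v j)" if j: "j \<le> n" for j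
  proof -
    obtain v s where "v \<in> Z" "lo 0 (v 0 + s)" "up j (v j + s)" using pair[OF _ j, of 0] by auto
    then show ?thesis using up[of j "v j + s" "v j"] v0[of v] by (auto simp: lo0)
  qed
  have ex_pair: "\<exists>v\<in>Z. lo i (v i) \<and> up j (v j)" if ij: "i \<le> n" "j \<le> n" for i j
  proof -
    obtain v s where v: "v \<in> Z" "lo i (v i + s)" "up j (v j + s)" using pair[OF ij] by blast
    show ?thesis
    proof (cases "s \<le> 0")
      case True
      obtain w where w: "w \<in> Z" "up j (w j)" using ex_up ij by blast
      obtain u where u: "u \<in> Z" "\<forall>i\<le>n. u i = max (w i) (v i + s)"
        using max_in[OF w(1) v(1) True] by blast
      then have "up j (u j)" using w v ij by (simp add: max_def)
      moreover have "lo i (u i)" using lo[OF v(2), of "u i"] u ij by simp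
      ultimately show ?thesis using u by blast
    next
      case False
      obtain w where w: "w \<in> Z" "lo i (w i)" using ex_lo ij by blast
      obtain u where u: "u \<in> Z" "\<forall>i\<le>n. u i = min (w i) (v i + s)"
        using min_in[OF w(1) v(1), of s] False not_le[of s 0] less_imp_le by metis
      then have "lo i (u i)" using w v ij by (simp add: min_def)
      moreover have "up j (u j)" using up[OF v(3), of "u j"] u ij by simp
      ultimately show ?thesis using u by blast
    qed
  qed
  have all_lo: "\<exists>v\<in>Z. (\<forall>i\<in>I. lo i (v i)) \<and> up j (v j)" if "finite I" "I \<subseteq> {..n}" "j \<le> n" for I j
    using that
  proof (induction I rule: finite_induct)
    case empty
    then show ?case using ex_up by simp
  next
    case (insert i I)
    obtain v where v: "v \<in> Z" "\<forall>i\<in>I. lo i (v i)" "up j (v j)" using insert by auto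
    obtain w where w: "w \<in> Z" "lo i (w i)" "up j (w j)" using ex_pair[of i j] insert.prems by auto
    obtain u where u: "u \<in> Z" "\<forall>i\<le>n. u i = max (v i) (w i + 0)"
      using max_in[OF v(1) w(1), of 0] by blast
    have "lo k (u k)" if "k \<in> insert i I" for k
      using that u insert.prems v w lo[of k "v k" "u k"] lo[of i "w i" "u i"] by (auto simp: subset_iff)
    moreover have "up j (u j)" using u v w insert.prems by (simp add: max_def)
    ultimately show ?case using u by blast
  qed
  have "\<exists>v\<in>Z. (\<forall>i\<le>n. lo i (v i)) \<and> (\<forall>j\<in>J. up j (v j))" if "finite J" "J \<subseteq> {..n}" for J
    using that
  proof (induction J rule: finite_induct)
    case empty
    then show ?case using all_lo[of "{..n}" 0] by auto
  next
    case (insert j J)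
    obtain v where v: "v \<in> Z" "\<forall>i\<le>n. lo i (v i)" "\<forall>j\<in>J. up j (v j)" using insert by auto
    obtain w where w: "w \<in> Z" "\<forall>i\<le>n. lo i (w i)" "up j (w j)" using all_lo[of "{..n}" j] insert.prems by auto
    obtain u where u: "u \<in> Z" "\<forall>i\<le>n. u i = min (v i) (w i + 0)"
      using min_in[OF v(1) w(1), of 0] by blast
    have "lo i (u i)" if "i \<le> n" for i using that u v w by (simp add: min_def)
    moreover have "up k (u k)" if "k \<in> insert j J" for k
      using that u insert.prems v w up[of k "v k" "u k"] up[of j "w j" "u j"] by (auto simp: subset_iff)
    ultimately show ?case using u by blast
  qed
  from this[of "{..n}"] show ?thesis by auto
qed

text \<open>The LU-preorder, with \<open>w\<close> as the simulated side. It refers to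
  \<open>U_bound\<close>, since simulation depends only on the guards that occur.\<close>

definition lu_sim :: "ta \<Rightarrow> valuation \<Rightarrow> valuation \<Rightarrow> bool" where
  "lu_sim A w v \<longleftrightarrow> (\<forall>x. (v x < w x \<longrightarrow> exceeds (L_bound A x) (v x)) \<and>
     (w x < v x \<longrightarrow> exceeds (U_bound A x) (w x)))"

lemma lu_sim_trans:
  assumes "lu_sim A w v" "lu_sim A v u"
  shows "lu_sim A w u"
  unfolding lu_sim_def
proof (intro allI conjI impI)
  fix x
  note wv = assms(1)[unfolded lu_sim_def, rule_format, of x]
    and vu = assms(2)[unfolded lu_sim_def, rule_format, of x]
  show "exceeds (L_bound A x) (u x)" if "u x < w x"
    using wv vu that exceeds_mono[of _ "v x" "u x"] by (cases "u x < v x") auto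
  show "exceeds (U_bound A x) (w x)" if "w x < u x"
    using wv vu that exceeds_mono[of _ "v x" "w x"] by (cases "w x < v x") auto
qed

lemma canonical_implies_extra_entry:
  "sat_bound r b \<Longrightarrow> sat_bound r (extra_entry l u b)"
  by (cases b; cases u) (auto simp: extra_finite_def)

lemma extra_extensive:
  assumes "zone_like (nclocks A) Z"
  shows "Z \<subseteq> extra_LwU A Z"
  using assms canonical_entry_tight(1)[OF assms] zone_like_valuation[OF assms]
  by (auto simp: extra_LwU_def dbm_set_def intro!: canonical_implies_extra_entry)

lemma zone_like_extra: "zone_like (nclocks A) (extra_LwU A Z)"
  using zone_like_dbm_set by (auto simp: extra_LwU_def zone_like_def)

text \<open>By the Helly property it suffices to meet a lower demand on \<open>i\<close> together
  with an upper demand on \<open>j\<close>. If \<open>w j\<close> exceeds \<open>U_bound\<close>,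
  the upper demand is void. Otherwise \<open>weak_U\<close> and \<open>U_bound\<close> agree on
  \<open>j\<close>. An entry violated by \<open>w\<close> was then relaxed in the first case of the
  extrapolation, where \<open>i\<close> can be taken above \<open>L_bound\<close>; the second case
  would make \<open>w i\<close> negative.\<close>

lemma extra_sound:
  assumes Z: "zone_like (nclocks A) Z" and w: "w \<in> extra_LwU A Z"
  shows "\<exists>v\<in>Z. lu_sim A w v"
proof -
  let ?n = "nclocks A"
  have ne: "Z \<noteq> {}" using w by (auto simp: extra_LwU_def)
  have wval: "valuation ?n w" using zone_like_extra w zone_like_valuation by blast
  have w_sat: "sat_bound (w i - w j) (extra_entry (L_bound A i) (weak_U A j) (canonical_entry Z i j))"
    if "i \<le> ?n" "j \<le> ?n" for i j
    using w ne that by (auto simp: extra_LwU_def dbm_set_def)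
  define lo where "lo i a \<longleftrightarrow> w i \<le> a \<or> exceeds (L_bound A i) a" for i a
  define up where "up i a \<longleftrightarrow> a \<le> w i \<or> exceeds (U_bound A i) (w i)" for i a
  have lo_mono: "lo i b" if "lo i a" "a \<le> b" for i a b
    using that exceeds_mono[of _ a b] by (auto simp: lo_def)
  have diff: "\<exists>v\<in>Z. lo i (v i - v j + w j)"
    if ij: "i \<le> ?n" "j \<le> ?n" and u: "U_bound A j = Some u" "w j \<le> real_of_int u" for i j u
  proof -
    let ?b = "canonical_entry Z i j"
    have "\<exists>r. sat_bound r ?b \<and> lo i (r + w j)"
    proof (cases "sat_bound (w i - w j) ?b")
      case True
      then show ?thesis by (intro exI[of _ "w i - w j"]) (simp add: lo_def)
    next
      case False
      have fin: "\<exists>r. sat_bound r ?b \<and> lo i (r + w j)"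
        if b: "\<And>r. r < real_of_int c \<Longrightarrow> sat_bound r ?b"
          and e: "extra_entry (L_bound A i) (weak_U A j) ?b = extra_finite (L_bound A i) (weak_U A j) c ?b" for c
      proof (cases "L_bound A i < Some c")
        case True
        show ?thesis
        proof (cases "L_bound A i")
          case None
          then show ?thesis using b[of "real_of_int c - 1"] by (auto simp: lo_def exceeds_def)
        next
          case (Some l)
          then have "real_of_int l + 1 \<le> real_of_int c" using True by (simp add: less_option_Some)
          then show ?thesis
            using b[of "real_of_int l + 1 / 2"] Some valuation_nonneg[OF wval, of j]
            by (intro exI[of _ "real_of_int l + 1 / 2"]) (auto simp: lo_def exceeds_def)
        qed
      next
        case nL: False
        have "weak_U A j < Some (- c)"
          using w_sat[OF ij] False nL by (auto simp: e extra_finite_def split: if_splits)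
        then have "w i - w j < - real_of_int u"
          using w_sat[OF ij, unfolded e] nL weak_U_eq[OF u(1)] by (simp add: extra_finite_def)
        then show ?thesis using u(2) valuation_nonneg[OF wval, of i] by linarith
      qed
      show ?thesis
      proof (cases ?b)
        case (Le c)
        then show ?thesis using fin[of c] by simp
      next
        case (Lt c)
        then show ?thesis using fin[of c] by simp
      qed (use False in simp)
    qed
    then obtain r where "sat_bound r ?b" "lo i (r + w j)" by blast
    moreover then obtain v where "v \<in> Z" "r \<le> v i - v j"
      using canonical_entry_tight(2)[OF Z ne ij] by blast
    ultimately show ?thesis
      using lo_mono[of i "r + w j" "v i - v j + w j"] by (intro bexI[of _ v]) auto
  qed
  have "\<exists>v\<in>Z. \<forall>i\<le>?n. lo i (v i) \<and> up i (v i)"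
  proof (rule pairwise_bounds_satisfiable[OF Z])
    show "lo i b" if "lo i a" "a \<le> b" for i a b
      using that by (rule lo_mono)
    show "up i a" if "up i b" "a \<le> b" for i a b
      using that by (auto simp: up_def)
    show "lo 0 a \<longleftrightarrow> 0 \<le> a" "up 0 a \<longleftrightarrow> a \<le> 0" for a
      using wval by (auto simp: lo_def up_def exceeds_def)
    show "\<exists>v\<in>Z. \<exists>s. lo i (v i + s) \<and> up j (v j + s)" if ij: "i \<le> ?n" "j \<le> ?n" for i j
    proof (cases "exceeds (U_bound A j) (w j)")
      case True
      obtain v where "v \<in> Z" using ne by blast
      then show ?thesis
        using True by (intro bexI[of _ v] exI[of _ "w i - v i"]) (auto simp: lo_def up_def)
    next
      case False
      then obtain u where "U_bound A j = Some u" "w j \<le> real_of_int u"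
        by (auto simp: exceeds_def not_less)
      from diff[OF ij this] obtain v where "v \<in> Z" "lo i (v i - v j + w j)" by blast
      then show ?thesis
        by (intro bexI[of _ v] exI[of _ "w j - v j"]) (auto simp: up_def algebra_simps)
    qed
  qed
  then obtain v where v: "v \<in> Z" "\<And>i. i \<le> ?n \<Longrightarrow> lo i (v i) \<and> up i (v i)" by blast
  have "valuation ?n v" using Z v(1) zone_like_valuation by blast
  then have "v x = w x" if "\<not> x \<le> ?n" for x
    using wval that by (auto simp: valuation_def)
  then have "lu_sim A w v"
    using v(2) unfolding lu_sim_def lo_def up_def by (metis less_irrefl not_less)
  with v(1) show ?thesis by blast
qed

lemma extra_nonempty: "zone_like (nclocks A) Z \<Longrightarrow> Z \<noteq> {} \<Longrightarrow> extra_LwU A Z \<noteq> {}"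
  using extra_extensive by blast

text \<open>\<open>abs_step\<close> leaves only from fixed points of the abstraction, so without
  idempotence nodes could lack successors. An entry left alone is still tight afterwards. An entry
  set to \<open>Lt (- u)\<close> can only be tightened by canonization, and extrapolating again
  gives \<open>Lt (- u)\<close>.\<close>

lemma extra_idem:
  assumes Z: "zone_like (nclocks A) Z" and ne: "Z \<noteq> {}"
  shows "extra_LwU A (extra_LwU A Z) = extra_LwU A Z"
proof
  let ?n = "nclocks A" and ?W = "extra_LwU A Z"
  define D where "D i j = extra_entry (L_bound A i) (weak_U A j) (canonical_entry Z i j)" for i j
  have W: "zone_like ?n ?W" "?W \<noteq> {}" using zone_like_extra extra_nonempty[OF Z ne] by auto
  have W_D: "?W = dbm_set ?n D" using ne by (simp add: extra_LwU_def D_def[abs_def])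
  show "?W \<subseteq> extra_LwU A ?W" by (rule extra_extensive[OF W(1)])
  have "sat_bound r (D i j)"
    if ij: "i \<le> ?n" "j \<le> ?n"
      and r: "sat_bound r (extra_entry (L_bound A i) (weak_U A j) (canonical_entry ?W i j))" for i j r
  proof -
    let ?b = "canonical_entry Z i j" and ?b' = "canonical_entry ?W i j"
    have b'_D: "sat_bound r (D i j)" if b': "sat_bound r ?b'" for r
    proof -
      obtain w where "w \<in> ?W" "r \<le> w i - w j" using canonical_entry_tight(2)[OF W ij b'] by blast
      then show ?thesis using W_D ij sat_bound_mono unfolding dbm_set_def by blast
    qed
    have b_b': "sat_bound r ?b'" if b: "sat_bound r ?b" for r
    proof -
      obtain v where "v \<in> Z" "r \<le> v i - v j" using canonical_entry_tight(2)[OF Z ne ij b] by blast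
      then show ?thesis
        using extra_extensive[OF Z] canonical_entry_tight(1)[OF W ij] sat_bound_mono by blast
    qed
    show ?thesis
    proof (cases "D i j = ?b")
      case True
      have "?b' = ?b"
      proof (rule canonical_entry_eqI)
        show "\<forall>v\<in>?W. sat_bound (v i - v j) ?b"
          using W_D ij unfolding dbm_set_def True[symmetric] by auto
        show "\<forall>r. sat_bound r ?b \<longrightarrow> sat_bound r b'" if "\<forall>v\<in>?W. sat_bound (v i - v j) b'" for b'
          using that extra_extensive[OF Z] canonical_entry_tight(2)[OF Z ne ij] sat_bound_mono by blast
      qed
      then show ?thesis using r by (simp add: D_def)
    next
      case False
      show ?thesis
      proof (cases "D i j = Inf")
        case nInf: False
        obtain c where c: "D i j = extra_finite (L_bound A i) (weak_U A j) c ?b" "sat_bound (real_of_int c - 1) ?b"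
          using nInf by (cases ?b) (auto simp: D_def)
        then have "weak_U A j < Some (- c)" and "\<not> L_bound A i < Some c"
          using False nInf by (auto simp: extra_finite_def split: if_splits)
        moreover obtain u where u: "weak_U A j = Some u"
          using c nInf False by (cases "weak_U A j") (auto simp: extra_finite_def split: if_splits)
        moreover obtain l where l: "L_bound A i = Some l"
          using c nInf by (cases "L_bound A i") (auto simp: extra_finite_def)
        ultimately have Dij: "D i j = Lt (- u)"
          using c False by (auto simp: extra_finite_def split: if_splits)
        have nonneg: "0 \<le> u" "0 \<le> l" using u l weak_U_nonneg L_bound_nonneg by blast+
        show ?thesis
        proof (cases ?b')
          case (Le c')
          have "c' < - u" using b'_D[of "real_of_int c'"] by (simp add: Le Dij)
          then show ?thesis
            using r nonneg by (auto simp: Le Dij l u extra_finite_def split: if_splits)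
        next
          case (Lt c')
          have "c' \<le> - u"
          proof (rule ccontr)
            assume "\<not> c' \<le> - u"
            then show False using b'_D[of "- real_of_int u"] by (simp add: Lt Dij)
          qed
          then show ?thesis
            using r nonneg by (auto simp: Lt Dij l u extra_finite_def split: if_splits)
        next
          case Inf
          then show ?thesis using b'_D[of 0] b'_D[of r] by simp
        qed
      qed simp
    qed
  qed
  note entry = this
  show "extra_LwU A ?W \<subseteq> ?W"
  proof
    fix v assume v: "v \<in> extra_LwU A ?W"
    have "sat_bound (v i - v j) (D i j)" if "i \<le> ?n" "j \<le> ?n" for i j
      by (rule entry[OF that])
        (use v W(2) that in \<open>simp add: extra_LwU_def[of A "extra_LwU A Z"] dbm_set_def\<close>)
    moreover have "valuation ?n v" using v zone_like_extra zone_like_valuation by blast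
    ultimately show "v \<in> ?W" by (subst W_D) (simp add: dbm_set_def)
  qed
qed

section \<open>Realising abstract paths\<close>

text \<open>Valuations are taken at the moment a transition fires, so a step is guard, reset, delay.
  This is the order in which \<open>post\<close> builds delay-closed zones, while
  \<open>infinite_run\<close> delays first.\<close>

definition ta_step :: "ta \<Rightarrow> transition \<Rightarrow> valuation \<Rightarrow> valuation \<Rightarrow> bool" where
  "ta_step A t u u' \<longleftrightarrow> sat_guard u (guard t) \<and>
     (\<exists>d\<ge>0. u' = delay (nclocks A) (reset (resets t) u) d)"

lemma mem_post: "u' \<in> post A t Z \<longleftrightarrow> (\<exists>u\<in>Z. ta_step A t u u')"
  by (auto simp: post_def ta_step_def)

lemma guard_clock: "timed_automaton A \<Longrightarrow> t \<in> set (trans A) \<Longrightarrow> (x, op, c) \<in> set (guard t) \<Longrightarrow> x \<in> {1..nclocks A}"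
  unfolding timed_automaton_def by fastforce

text \<open>The same delay works on both sides: \<open>exceeds\<close> is preserved when values
  increase, and reset clocks agree.\<close>

lemma lu_sim_step:
  assumes A: "timed_automaton A" and t: "t \<in> set (trans A)"
    and sim: "lu_sim A w v" and w: "ta_step A t w w'"
  shows "\<exists>v'. ta_step A t v v' \<and> lu_sim A w' v'"
proof -
  let ?n = "nclocks A"
  obtain d where g: "sat_guard w (guard t)" and d: "0 \<le> d" and w': "w' = delay ?n (reset (resets t) w) d"
    using w by (auto simp: ta_step_def)
  have "sat_guard v (guard t)"
    unfolding sat_guard_def
  proof clarify
    fix x op c assume xc: "(x, op, c) \<in> set (guard t)"
    have x: "x \<noteq> 0" using guard_clock[OF A t xc] by simp
    have gx: "cmp_holds op (w x) (real c)" using g xc by (auto simp: sat_guard_def)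
    have lower: "w x \<le> v x \<or> real c < v x" if "op \<in> {CGt, CGe, CEq}"
    proof -
      have "int c \<in> lower_consts A x" using t xc that by (auto simp: lower_consts_def)
      from L_bound_ge[OF this x] obtain l where "L_bound A x = Some l" "int c \<le> l" by blast
      then show ?thesis using sim by (force simp: lu_sim_def exceeds_def not_le)
    qed
    have upper: "v x \<le> w x \<or> real c < w x" if "op \<in> {CLt, CLe, CEq}"
    proof -
      have "int c \<in> upper_consts A x" using t xc that by (auto simp: upper_consts_def)
      from U_bound_ge[OF this x] obtain l where "U_bound A x = Some l" "int c \<le> l" by blast
      then show ?thesis using sim by (force simp: lu_sim_def exceeds_def not_le)
    qed
    show "cmp_holds op (v x) (real c)"
      using gx lower upper by (cases op) auto
  qed
  moreover have "lu_sim A w' (delay ?n (reset (resets t) v) d)"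
    unfolding lu_sim_def
  proof (intro allI)
    fix x
    show "(delay ?n (reset (resets t) v) d x < w' x \<longrightarrow>
         exceeds (L_bound A x) (delay ?n (reset (resets t) v) d x)) \<and>
        (w' x < delay ?n (reset (resets t) v) d x \<longrightarrow> exceeds (U_bound A x) (w' x))"
      using sim[unfolded lu_sim_def, rule_format, of x] d
        exceeds_mono[of "L_bound A x" "v x" "v x + d"] exceeds_mono[of "U_bound A x" "w x" "w x + d"]
      by (auto simp: w' delay_def reset_def)
  qed
  ultimately show ?thesis using d by (auto simp: ta_step_def)
qed

inductive reachable :: "ta \<Rightarrow> nat \<Rightarrow> valuation \<Rightarrow> bool" for A where
  start: "u \<in> initial_zone A \<Longrightarrow> reachable A (init A) u"
| step: "reachable A (src t) u \<Longrightarrow> t \<in> set (trans A) \<Longrightarrow> ta_step A t u u' \<Longrightarrow> reachable A (tgt t) u'"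

definition zeno_from :: "ta \<Rightarrow> nat \<Rightarrow> valuation \<Rightarrow> bool" where
  "zeno_from A q u \<longleftrightarrow> (\<exists>us ts ds. us 0 = u \<and> src (ts 0) = q \<and> summable ds \<and>
     (\<forall>i. ts i \<in> set (trans A) \<and> src (ts (Suc i)) = tgt (ts i) \<and> sat_guard (us i) (guard (ts i)) \<and>
        0 \<le> ds i \<and> us (Suc i) = delay (nclocks A) (reset (resets (ts i)) (us i)) (ds i)))"

lemma zeno_from_step:
  assumes t: "t \<in> set (trans A)" and step: "ta_step A t u u'" and zeno: "zeno_from A (tgt t) u'"
  shows "zeno_from A (src t) u"
proof -
  obtain us ts ds where *: "us 0 = u'" "src (ts 0) = tgt t" "summable ds"
     "\<And>i. ts i \<in> set (trans A) \<and> src (ts (Suc i)) = tgt (ts i) \<and> sat_guard (us i) (guard (ts i)) \<and>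
        0 \<le> ds i \<and> us (Suc i) = delay (nclocks A) (reset (resets (ts i)) (us i)) (ds i)"
    using zeno unfolding zeno_from_def by blast
  obtain d where d: "sat_guard u (guard t)" "0 \<le> d" "u' = delay (nclocks A) (reset (resets t) u) d"
    using step by (auto simp: ta_step_def)
  have "summable (case_nat d ds)"
    using *(3) by (subst summable_Suc_iff[symmetric]) simp
  then show ?thesis
    unfolding zeno_from_def using * d t
    by (intro exI[of _ "case_nat u us"] exI[of _ "case_nat t ts"] exI[of _ "case_nat d ds"])
      (auto split: nat.split)
qed

lemma zeno_run_of_reachable:
  assumes "reachable A q u" "zeno_from A q u"
  shows "has_zeno_run A"
  using assms
proof (induction rule: reachable.induct)
  case (start u)
  obtain us ts ds where *: "us 0 = u" "src (ts 0) = init A" "summable ds"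
     "\<And>i. ts i \<in> set (trans A) \<and> src (ts (Suc i)) = tgt (ts i) \<and> sat_guard (us i) (guard (ts i)) \<and>
        0 \<le> ds i \<and> us (Suc i) = delay (nclocks A) (reset (resets (ts i)) (us i)) (ds i)"
    using start.prems unfolding zeno_from_def by blast
  obtain d where d: "0 \<le> d" "u = delay (nclocks A) (\<lambda>_. 0) d"
    using start.hyps by (auto simp: initial_zone_def)
  define v where "v = case_nat (\<lambda>_. 0) (\<lambda>i. reset (resets (ts i)) (us i))"
  have us: "delay (nclocks A) (v i) (case_nat d ds i) = us i" for i
    using * d by (cases i) (auto simp: v_def)
  have "infinite_run A (\<lambda>i. src (ts i)) v (case_nat d ds) ts"
    unfolding infinite_run_def us using * d by (auto simp: v_def split: nat.split)
  moreover have "summable (case_nat d ds)"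
    using *(3) by (subst summable_Suc_iff[symmetric]) simp
  ultimately show ?case unfolding has_zeno_run_def by blast
next
  case (step t u u')
  then show ?case using zeno_from_step by blast
qed

section \<open>Concretization of paths of the zone graph\<close>

abbreviation zg_extra_nodes :: "ta \<Rightarrow> (nat \<times> valuation set) set" where
  "zg_extra_nodes A \<equiv> zg_nodes A (extra_LwU A)"

lemma abs_step_iff:
  "abs_step A \<aa> m t m' \<longleftrightarrow> \<aa> (snd m) = snd m \<and> t \<in> set (trans A) \<and> src t = fst m \<and> tgt t = fst m' \<and>
     post A t (snd m) \<noteq> {} \<and> snd m' = \<aa> (post A t (snd m))"
  by (cases m; cases m') (auto simp: abs_step_def zg_step_def)

lemma initial_zone_nonempty: "initial_zone A \<noteq> {}"
  by (auto simp: initial_zone_def)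

lemma zg_nodes_extra:
  assumes A: "timed_automaton A" and m: "m \<in> zg_extra_nodes A"
  obtains Z where "zone_like (nclocks A) Z" "Z \<noteq> {}" "snd m = extra_LwU A Z"
  using m
proof (cases rule: zg_nodes.cases)
  case start
  then show ?thesis
    using that[OF zone_like_initial initial_zone_nonempty] by simp
next
  case (step m0 t)
  from step(1) have "zone_like (nclocks A) (snd m0)"
    by cases (auto simp: abs_step_iff zone_like_extra)
  then show ?thesis
    using step that[of "post A t (snd m0)"] zone_like_post[OF A] by (auto simp: abs_step_iff)
qed

lemma zg_nodes_zone:
  assumes A: "timed_automaton A" and m: "m \<in> zg_extra_nodes A"
  shows "zone_like (nclocks A) (snd m)" "snd m \<noteq> {}" "extra_LwU A (snd m) = snd m"
    "dbm_set (nclocks A) (canonical_entry (snd m)) = snd m"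
proof -
  obtain Z where Z: "zone_like (nclocks A) Z" "Z \<noteq> {}" "snd m = extra_LwU A Z"
    using zg_nodes_extra[OF assms] .
  show *: "zone_like (nclocks A) (snd m)" "snd m \<noteq> {}" "extra_LwU A (snd m) = snd m"
    using Z zone_like_extra extra_nonempty extra_idem by simp_all
  show "dbm_set (nclocks A) (canonical_entry (snd m)) = snd m"
    by (rule dbm_set_canonical_entry[OF *(1,2)]) (use Z in \<open>simp add: extra_LwU_def\<close>)
qed

text \<open>The valuation \<open>v\<close> depends on the target \<open>w\<close> but not on
  \<open>u\<close>. So a run that reaches some simulating \<open>u\<close> can be extended, whatever
  led to it.\<close>

lemma abs_step_simulated:
  assumes A: "timed_automaton A" and m: "zone_like (nclocks A) (snd m)"
    and step: "abs_step A (extra_LwU A) m t m'" and w: "w \<in> snd m'"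
  shows "\<exists>v\<in>snd m. \<forall>u. lu_sim A v u \<longrightarrow> (\<exists>u'. ta_step A t u u' \<and> lu_sim A w u')"
proof -
  have t: "t \<in> set (trans A)" and m': "snd m' = extra_LwU A (post A t (snd m))"
    using step by (simp_all add: abs_step_iff)
  obtain v' where v': "v' \<in> post A t (snd m)" "lu_sim A w v'"
    using extra_sound[OF zone_like_post[OF A t m]] w m' by auto
  then obtain v where v: "v \<in> snd m" "ta_step A t v v'" by (auto simp: mem_post)
  show ?thesis
    using lu_sim_step[OF A t _ v(2)] lu_sim_trans[OF v'(2)] v(1) by blast
qed

lemma zg_nodes_reachable:
  assumes A: "timed_automaton A" and m: "m \<in> zg_extra_nodes A" and w: "w \<in> snd m"
  shows "\<exists>u. reachable A (fst m) u \<and> lu_sim A w u"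
  using m w
proof (induction arbitrary: w rule: zg_nodes.induct)
  case start
  then show ?case
    using extra_sound[OF zone_like_initial, of w A] by (auto intro: reachable.start)
next
  case (step m t m')
  obtain v where v: "v \<in> snd m" "\<And>u. lu_sim A v u \<Longrightarrow> \<exists>u'. ta_step A t u u' \<and> lu_sim A w u'"
    using abs_step_simulated[OF A zg_nodes_zone(1)[OF A step(1)] step(2) step.prems] by blast
  obtain u where u: "reachable A (fst m) u" "lu_sim A v u" using step.IH[OF v(1)] by blast
  then show ?case
    using v(2)[OF u(2)] step(2) reachable.step[of A t u] by (auto simp: abs_step_iff)
qed

text \<open>The induction is over all \<open>w\<close> in the last node, because each step back asks
  the shorter path for a different target. Therefore \<open>u 0\<close> depends on
  \<open>k\<close>.\<close>

lemma zg_path_concretization: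
  assumes A: "timed_automaton A" and m0: "m 0 \<in> zg_extra_nodes A"
    and path: "\<And>i. abs_step A (extra_LwU A) (m i) (t i) (m (Suc i))"
  shows "\<exists>u. reachable A (fst (m 0)) (u 0) \<and> (\<forall>i<k. ta_step A (t i) (u i) (u (Suc i)))"
proof -
  have node: "m i \<in> zg_extra_nodes A" for i
    by (induction i) (use m0 path zg_nodes.step in blast)+
  have "\<exists>u. reachable A (fst (m 0)) (u 0) \<and> (\<forall>i<k. ta_step A (t i) (u i) (u (Suc i))) \<and> lu_sim A w (u k)"
    if "w \<in> snd (m k)" for w k
    using that
  proof (induction k arbitrary: w)
    case 0
    then obtain u where "reachable A (fst (m 0)) u" "lu_sim A w u"
      using zg_nodes_reachable[OF A m0] by blast
    then show ?case by (intro exI[of _ "\<lambda>_. u"]) simp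
  next
    case (Suc k)
    obtain v where v: "v \<in> snd (m k)" "\<And>u. lu_sim A v u \<Longrightarrow> \<exists>u'. ta_step A (t k) u u' \<and> lu_sim A w u'"
      using abs_step_simulated[OF A zg_nodes_zone(1)[OF A node] path Suc.prems] by blast
    obtain u where u: "reachable A (fst (m 0)) (u 0)" "\<forall>i<k. ta_step A (t i) (u i) (u (Suc i))" "lu_sim A v (u k)"
      using Suc.IH[OF v(1)] by blast
    obtain u' where u': "ta_step A (t k) (u k) u'" "lu_sim A w u'" using v(2)[OF u(3)] by blast
    show ?case
      by (rule exI[of _ "u(Suc k := u')"]) (use u u' in \<open>auto simp: less_Suc_eq\<close>)
  qed
  then show ?thesis using zg_nodes_zone(2)[OF A node[of k]] by blast
qed

lemma reachable_valuation:
  assumes A: "timed_automaton A" and u: "reachable A q u"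
  shows "valuation (nclocks A) u"
  using u
proof (induction rule: reachable.induct)
  case (start u)
  then show ?case using zone_like_initial zone_like_valuation by blast
next
  case (step t u u')
  have "set (resets t) \<subseteq> {1..nclocks A}" using A step by (auto simp: timed_automaton_def)
  then show ?case
    using step by (auto simp: ta_step_def valuation_def delay_def reset_def)
qed

section \<open>Zeno runs from cycles\<close>

text \<open>A syntactic property that can be tested atom by atom. An unsatisfiable guard does not
  lift the clocks that it does not mention.\<close>

definition lifted_by :: "transition \<Rightarrow> nat set" where
  "lifted_by t = {x. \<exists>op c. (x, op, c) \<in> set (guard t) \<and> op \<in> {CEq, CGe, CGt} \<and> c \<noteq> 0}"

lemma lifted_by_ge_1:
  assumes "x \<in> lifted_by t" "sat_guard v (guard t)"
  shows "1 \<le> v x"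
proof -
  obtain op c where xc: "(x, op, c) \<in> set (guard t)" "op \<in> {CEq, CGe, CGt}" "c \<noteq> 0"
    using assms(1) by (auto simp: lifted_by_def)
  then have "cmp_holds op (v x) (real c)" using assms(2) by (auto simp: sat_guard_def)
  then show ?thesis using xc by auto
qed

lemma clock_not_reset:
  assumes "\<And>i. i < N \<Longrightarrow> u (Suc i) = delay n (reset (R i) (u i)) (d i)"
    and "x \<in> {1..n}" "a \<le> b" "b \<le> N" "\<And>j. a \<le> j \<Longrightarrow> j < b \<Longrightarrow> x \<notin> set (R j)"
  shows "u b x = u a x + (\<Sum>j\<in>{a..<b}. d j)"
  using assms(3-)
proof (induction b rule: dec_induct)
  case (step b)
  then show ?case using assms(1)[of b] assms(2) by (simp add: delay_def reset_def)
qed simp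

text \<open>Delays are indexed by their distance from \<open>b\<close>, so that values at the same
  position of different iterations can be compared term by term.\<close>

lemma clock_after_reset:
  assumes u: "\<And>i. i < N \<Longrightarrow> u (Suc i) = delay n (reset (R i) (u i)) (d i)"
    and x: "x \<in> {1..n}" and s: "0 < s" "s \<le> b" "b \<le> N"
    and R: "x \<in> set (R (b - s))" "\<And>j. 0 < j \<Longrightarrow> j < s \<Longrightarrow> x \<notin> set (R (b - j))"
  shows "u b x = (\<Sum>j\<in>{1..s}. d (b - j))"
proof -
  have "u b x = u (Suc (b - s)) x + (\<Sum>j\<in>{Suc (b - s)..<b}. d j)"
  proof (rule clock_not_reset[where u = u and d = d and R = R, OF u x])
    fix j assume "Suc (b - s) \<le> j" "j < b"
    then show "x \<notin> set (R j)" using R(2)[of "b - j"] s by simp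
  qed (use s in auto)
  also have "u (Suc (b - s)) x = d (b - s)"
    using u[of "b - s"] s x R(1) by (simp add: delay_def reset_def)
  also have "d (b - s) + (\<Sum>j\<in>{Suc (b - s)..<b}. d j) = (\<Sum>j\<in>{b - s..<b}. d j)"
    using s by (simp add: sum.atLeast_Suc_lessThan)
  also have "\<dots> = (\<Sum>j\<in>{1..s}. d (b - j))"
    by (rule sum.reindex_bij_witness[of _ "\<lambda>j. b - j" "\<lambda>j. b - j"]) (use s in auto)
  finally show ?thesis .
qed

lemma sum_half_powers_less: "finite I \<Longrightarrow> (\<Sum>i\<in>I. (1 / 2 :: real) ^ Suc i) < 1"
proof -
  assume "finite I"
  then obtain m where m: "I \<subseteq> {..<m}" using finite_nat_iff_bounded by blast
  have "(\<Sum>i\<in>I. (1 / 2 :: real) ^ Suc i) \<le> (\<Sum>i<m. (1 / 2) ^ Suc i)"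
    by (rule sum_mono2) (use m in auto)
  also have "\<dots> = 1 - (1 / 2) ^ m" by (induction m) auto
  finally show ?thesis by (smt (verit) zero_less_power divide_pos_pos)
qed

text \<open>
  The heart of the soundness proof.  Clocks that are never reset satisfy all lower bound guards
  after the first iteration of the cycle, and tolerate as much delay as elapses before the last one.
  For a clock that is reset, only the guards \<open>x > 0\<close> and \<open>x \<le> 0\<close> matter once delays are
  small, so that it suffices to keep the set of positions of positive delays: from the third
  iteration on these are the positions with a positive delay in the third or fourth one.
\<close>

lemma zeno_from_cycle:
  assumes A: "timed_automaton A" and l: "0 < l"
    and t: "\<And>i. t i \<in> set (trans A)" "\<And>i. src (t (Suc i)) = tgt (t i)"
    and period: "\<And>i. t (i + l) = t i"
    and u0: "valuation (nclocks A) (u 0)"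
    and steps: "\<And>i. i < 5 * l \<Longrightarrow> ta_step A (t i) (u i) (u (Suc i))"
    and disj: "\<And>i j. set (resets (t i)) \<inter> lifted_by (t j) = {}"
  shows "zeno_from A (src (t 0)) (u 0)"
proof -
  let ?n = "nclocks A"
  let ?R = "\<lambda>i. resets (t i)"
  have "\<exists>d. 0 \<le> d \<and> (i < 5 * l \<longrightarrow> u (Suc i) = delay ?n (reset (?R i) (u i)) d)" for i
    using steps[of i] by (cases "i < 5 * l") (auto simp: ta_step_def)
  then obtain d :: "nat \<Rightarrow> real" where d: "\<And>i. 0 \<le> d i"
    and u: "\<And>i. i < 5 * l \<Longrightarrow> u (Suc i) = delay ?n (reset (?R i) (u i)) (d i)"
    by metis
  have guards: "sat_guard (u i) (guard (t i))" if "i < 5 * l" for i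
    using steps[OF that] by (simp add: ta_step_def)
  have t_mult: "t (k * l + i) = t i" for k i
  proof (induction k)
    case (Suc k)
    then show ?case using period[of "k * l + i"] by (simp add: ac_simps)
  qed simp
  have t_mod: "t i = t (i mod l)" for i
    using t_mult[of "i div l" "i mod l"] by simp
  \<comment> \<open>What a clock that is never reset gains between the end of the first iteration
    and the start of the fifth.\<close>
  define S where "S = (\<Sum>i\<in>{l..<4 * l}. d i)"
  define e where "e i = (if i < 2 * l then d i else d (2 * l + i mod l) + d (3 * l + i mod l))" for i
  \<comment> \<open>The factor \<open>1 / (1 + S)\<close> and the halving keep all new delays after
    the first iteration below 1 and at most \<open>S\<close> in total. Dividing by
    \<open>1 + S\<close> also covers \<open>S = 0\<close>.\<close>
  define d' where "d' i = (if i < l then d i else e i / (1 + S) * (1 / 2) ^ Suc i)" for i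
  have S: "0 \<le> S" unfolding S_def by (intro sum_nonneg d)
  have e_nonneg: "0 \<le> e i" for i using d by (simp add: e_def)
  have e_le: "e i \<le> S" if "l \<le> i" for i
  proof (cases "i < 2 * l")
    case True
    then have "e i = (\<Sum>j\<in>{i}. d j)" by (simp add: e_def)
    also have "\<dots> \<le> S" unfolding S_def by (rule sum_mono2) (use True that d in auto)
    finally show ?thesis .
  next
    case False
    have "i mod l < l" using l by simp
    have "e i = (\<Sum>j\<in>{2 * l + i mod l, 3 * l + i mod l}. d j)" using False l by (simp add: e_def)
    also have "\<dots> \<le> S" unfolding S_def by (rule sum_mono2) (use \<open>i mod l < l\<close> d in auto)
    finally show ?thesis .
  qed
  have d'_nonneg: "0 \<le> d' i" for i using d e_nonneg S by (simp add: d'_def)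
  have d'_le: "d' i \<le> S / (1 + S) * (1 / 2) ^ Suc i" if "l \<le> i" for i
    using e_le[OF that] that S unfolding d'_def by (auto intro!: mult_right_mono divide_right_mono)
  have d'_zero: "d' i = 0 \<longleftrightarrow> e i = 0" if "l \<le> i" for i
    using that S by (simp add: d'_def)
  have d'_le_d: "d' i \<le> d i" if "i < 2 * l" for i
  proof (cases "i < l")
    case False
    have "e i / (1 + S) \<le> e i" using e_nonneg[of i] S by (simp add: divide_le_eq mult_left_le mult_le_cancel_left1 algebra_simps)
    moreover have "(1 / 2 :: real) ^ Suc i \<le> 1" by (rule power_le_one) auto
    ultimately have "e i / (1 + S) * (1 / 2) ^ Suc i \<le> e i"
      using e_nonneg[of i] S by (smt (verit) mult_left_le divide_nonneg_nonneg zero_le_power)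
    then show ?thesis using False that by (simp add: d'_def e_def)
  qed (simp add: d'_def)
  have sum_d': "(\<Sum>i\<in>I. d' i) \<le> S / (1 + S) * (\<Sum>i\<in>I. (1 / 2) ^ Suc i)" if "\<And>i. i \<in> I \<Longrightarrow> l \<le> i" for I
    unfolding sum_distrib_left by (rule sum_mono) (rule d'_le[OF that])
  have sum_d'_less: "(\<Sum>i\<in>I. d' i) < 1" and sum_d'_le: "(\<Sum>i\<in>I. d' i) \<le> S"
    if I: "finite I" "\<And>i. i \<in> I \<Longrightarrow> l \<le> i" for I
  proof -
    let ?p = "\<Sum>i\<in>I. (1 / 2 :: real) ^ Suc i"
    have p: "0 \<le> ?p" "?p < 1" using sum_half_powers_less[OF I(1)] by (auto intro: sum_nonneg)
    have q: "S / (1 + S) < 1" "S / (1 + S) \<le> S" "0 \<le> S / (1 + S)"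
      using S by (auto simp: divide_le_eq algebra_simps)
    have "S / (1 + S) * ?p \<le> 1 * ?p" using p q by (intro mult_right_mono) auto
    then show "(\<Sum>i\<in>I. d' i) < 1" using p sum_d'[of I, OF I(2)] by linarith
    have "S / (1 + S) * ?p \<le> S / (1 + S) * 1" using p q by (intro mult_left_mono) auto
    then show "(\<Sum>i\<in>I. d' i) \<le> S" using q sum_d'[of I, OF I(2)] by linarith
  qed
  define u' where "u' = rec_nat (u 0) (\<lambda>i v. delay ?n (reset (?R i) v) (d' i))"
  have u'_0: "u' 0 = u 0" and u'_Suc: "u' (Suc i) = delay ?n (reset (?R i) (u' i)) (d' i)" for i
    by (simp_all add: u'_def)
  have u'_eq: "u' i = u i" if "i \<le> l" for i
    using that by (induction i) (use u l in \<open>auto simp: u'_0 u'_Suc d'_def\<close>)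
  have guards': "sat_guard (u' i) (guard (t i))" for i
  proof (cases "i < l")
    case True
    then show ?thesis using guards[of i] u'_eq[of i] by simp
  next
    case il: False
    define p where "p = i mod l"
    have p: "p < l" using l by (simp add: p_def)
    have i_eq: "i = i div l * l + p" by (simp add: p_def)
    have ti: "t (k * l + p) = t i" for k using t_mult[of k p] t_mod[of i] by (simp add: p_def)
    have kl: "k * l + p < 5 * l" if "k \<le> 4" for k
      using p mult_le_mono1[OF that, of l] by linarith
    show ?thesis
      unfolding sat_guard_def
    proof clarify
      fix x op c assume xc: "(x, op, c) \<in> set (guard (t i))"
      have x: "x \<in> {1..?n}" using guard_clock[OF A t(1) xc] .
      have old: "cmp_holds op (u (k * l + p) x) (real c)" if "k \<le> 4" for k
        using guards[OF kl[OF that]] xc by (auto simp: sat_guard_def ti)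
      show "cmp_holds op (u' i x) (real c)"
      proof (cases "\<exists>j. x \<in> set (?R j)")
        case False
        have old_val: "u k x = u 0 x + (\<Sum>j\<in>{0..<k}. d j)" if "k \<le> 5 * l" for k
          by (rule clock_not_reset[where u = u and d = d and R = ?R, OF u x]) (use that False in auto)
        have new_val: "u' i x = u 0 x + (\<Sum>j\<in>{0..<i}. d' j)"
          using clock_not_reset[where N = i and u = u' and d = d' and R = ?R, OF u'_Suc x, of 0 i] False u'_0 by simp
        have split: "(\<Sum>j\<in>{0..<i}. d' j) = (\<Sum>j\<in>{0..<l}. d j) + (\<Sum>j\<in>{l..<i}. d' j)"
          using il by (subst sum.atLeastLessThan_concat[symmetric, of 0 l i]) (auto simp: d'_def)
        have "(\<Sum>j\<in>{0..<p}. d j) \<le> (\<Sum>j\<in>{0..<l}. d j)"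
          by (rule sum_mono2) (use p d in auto)
        moreover have "0 \<le> (\<Sum>j\<in>{l..<i}. d' j)" using d'_nonneg by (simp add: sum_nonneg)
        ultimately have lower: "u (0 * l + p) x \<le> u' i x"
          using old_val[of p] p by (simp add: new_val split)
        have "(\<Sum>j\<in>{l..<i}. d' j) \<le> S" by (rule sum_d'_le) auto
        moreover have "(\<Sum>j\<in>{0..<4 * l}. d j) = (\<Sum>j\<in>{0..<l}. d j) + S"
          unfolding S_def by (rule sum.atLeastLessThan_concat[symmetric]) auto
        moreover have "(\<Sum>j\<in>{0..<4 * l}. d j) \<le> (\<Sum>j\<in>{0..<4 * l + p}. d j)"
          by (rule sum_mono2) (use d in auto)
        ultimately have upper: "u' i x \<le> u (4 * l + p) x"
          using old_val[of "4 * l + p"] p by (simp add: new_val split)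
        show ?thesis
          using old[of 0] old[of 4] lower upper by (cases op) auto
      next
        case True
        then obtain j0 where j0: "x \<in> set (?R j0)" by blast
        have c0: "c = 0" if "op \<in> {CEq, CGe, CGt}"
        proof (rule ccontr)
          assume "c \<noteq> 0"
          then have "x \<in> lifted_by (t i)" using xc that unfolding lifted_by_def by blast
          then show False using disj[of j0 i] j0 by blast
        qed
        have "\<exists>s. 0 < s \<and> s \<le> l \<and> x \<in> set (?R (i - s))"
        proof -
          let ?q = "j0 mod l"
          have q: "?q < l" using l by simp
          let ?m = "i div l"
          have m: "1 \<le> ?m" using il l by (simp add: div_greater_zero_iff Suc_le_eq)
          show ?thesis
          proof (cases "?q < p")
            case True
            have "i - (p - ?q) = ?m * l + ?q" using i_eq True by linarith
            then have "t (i - (p - ?q)) = t j0" using t_mult[of ?m ?q] t_mod[of j0] by simp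
            then show ?thesis using True p j0 by (intro exI[of _ "p - ?q"]) auto
          next
            case False
            have "(?m - 1) * l + l = ?m * l" using m by (simp add: algebra_simps)
            then have "i - (l + p - ?q) = (?m - 1) * l + ?q" using i_eq False q by linarith
            then have "t (i - (l + p - ?q)) = t j0" using t_mult[of "?m - 1" ?q] t_mod[of j0] by simp
            then show ?thesis using False p q j0 by (intro exI[of _ "l + p - ?q"]) auto
          qed
        qed
        note ex_reset = this
        define s where "s = (LEAST s. 0 < s \<and> s \<le> l \<and> x \<in> set (?R (i - s)))"
        have s: "0 < s" "s \<le> l" "x \<in> set (?R (i - s))"
          using LeastI_ex[OF ex_reset] unfolding s_def by blast+
        have s_min: "x \<notin> set (?R (i - j))" if "0 < j" "j < s" for j
          using not_less_Least[of j "\<lambda>s. 0 < s \<and> s \<le> l \<and> x \<in> set (?R (i - s))"] that s(2)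
          unfolding s_def by fastforce
        \<comment> \<open>Looking back at most one iteration shows the same transitions from every
          iteration but the first, where the look would leave the run; hence
          \<open>0 < k\<close>.\<close>
        have window: "t (k * l + p - j) = t (i - j)" if "0 < k" "j \<le> l" for k j
        proof -
          let ?m = "i div l"
          have m: "1 \<le> ?m" using il l by (simp add: div_greater_zero_iff Suc_le_eq)
          have "(?m - 1) * l + l = ?m * l" "(k - 1) * l + l = k * l"
            using m that by (auto simp: algebra_simps)
          then have "i - j = (?m - 1) * l + (l + p - j)" "k * l + p - j = (k - 1) * l + (l + p - j)"
            using that i_eq by linarith+
          then show ?thesis by (simp add: t_mult)
        qed
        have old_val: "u (k * l + p) x = (\<Sum>j\<in>{1..s}. d (k * l + p - j))" if "0 < k" "k \<le> 4" for k
        proof (rule clock_after_reset[where u = u and d = d and R = ?R, OF u x])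
          have "1 * l \<le> k * l" using that by (intro mult_right_mono) auto
          then show "s \<le> k * l + p" using s(2) by linarith
          show "k * l + p \<le> 5 * l" using kl[OF that(2)] by simp
        qed (use s s_min that window in auto)
        have new_val: "u' i x = (\<Sum>j\<in>{1..s}. d' (i - j))"
          by (rule clock_after_reset[where N = i and u = u' and d = d' and R = ?R, OF u'_Suc x]) (use s s_min il in auto)
        have new_nonneg: "0 \<le> u' i x" using d'_nonneg by (simp add: new_val sum_nonneg)
        have old_nonneg: "0 \<le> u (k * l + p) x" if "0 < k" "k \<le> 4" for k
          using old_val[OF that] d by (simp add: sum_nonneg)
        have old_zero: "d (k * l + p - j) = 0"
          if "0 < k" "k \<le> 4" "u (k * l + p) x = 0" "j \<in> {1..s}" for k j
          using old_val[OF that(1,2)] that(3,4) d by (simp add: sum_nonneg_eq_0_iff)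
        have new_zero: "d' (i - j) = 0" if "u' i x = 0" "j \<in> {1..s}" for j
          using new_val that d'_nonneg by (simp add: sum_nonneg_eq_0_iff)
        show ?thesis
        \<comment> \<open>In the second iteration the last reset may lie in the first one, whose
          delays are not scaled, so the value need not be below 1. There the old value at
          \<open>i\<close> itself serves as comparison.\<close>
        proof (cases "i < 2 * l")
          case i2: True
          have "i div l = 1" using i2 il l by (simp add: div_nat_eqI)
          then have i1: "1 * l + p = i" using i_eq by simp
          have "u i x = (\<Sum>j\<in>{1..s}. d (i - j))" using old_val[of 1, unfolded i1] by simp
          then have le: "u' i x \<le> u i x"
            unfolding new_val
            by (simp only:) (rule sum_mono, rule d'_le_d, use i2 in auto)
          have "u i x = 0 \<or> 0 < u' i x"
          proof (cases "u' i x = 0")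
            case False
            then show ?thesis using new_nonneg by simp
          next
            case u'_zero: True
            have "d (i - j) = 0" if j: "j \<in> {1..s}" for j
              using new_zero[OF u'_zero j] d'_zero[of "i - j"] i2
              by (cases "i - j < l") (auto simp: d'_def e_def split: if_splits)
            then show ?thesis using old_val[of 1, unfolded i1] by simp
          qed
          then show ?thesis
            using old[of 1, unfolded i1] le new_nonneg c0 by (cases op) auto
        next
          case i2: False
          have small: "u' i x < 1"
          proof -
            have "u' i x = (\<Sum>j\<in>{i - s..<i}. d' j)"
              unfolding new_val
              by (rule sum.reindex_bij_witness[of _ "\<lambda>j. i - j" "\<lambda>j. i - j"]) (use s i2 in auto)
            also have "\<dots> < 1" by (rule sum_d'_less) (use s i2 in auto)
            finally show ?thesis .
          qed
          have m2: "2 \<le> i div l" using i2 l by (metis less_eq_div_iff_mult_less_eq not_less)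
          \<comment> \<open>For \<open>j > p\<close> the look back crosses into the previous
            iteration. Since \<open>e\<close> adds two iterations, \<open>d (3 * l + p - j)\<close>
            is a summand on both sides of the crossing, so \<open>u' i x = 0\<close> forces
            \<open>u (3 * l + p) x = 0\<close>. In the third iteration
            \<open>d (2 * l + p - j)\<close> plays this part, as a crossing there reaches the second
            iteration, where \<open>e\<close> is \<open>d\<close>.\<close>
          have e_old: "e (i - j) = d (2 * l + p - j) \<and> i div l = 2 \<or>
              e (i - j) = d (2 * l + p - j) + d (3 * l + p - j) \<and> j \<le> p \<or>
              e (i - j) = d (3 * l + p - j) + d (4 * l + p - j) \<and> 3 \<le> i div l" if j: "j \<le> l" for j
          proof (cases "i - j < 2 * l")
            case True
            have "\<not> 3 \<le> i div l"
            proof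
              assume "3 \<le> i div l"
              then have "3 * l \<le> i div l * l" by (intro mult_right_mono) auto
              then show False using True i_eq j by linarith
            qed
            with m2 have "i div l = 2" by linarith
            then have "i - j = 2 * l + p - j" using i_eq by simp
            then show ?thesis using True \<open>i div l = 2\<close> by (simp add: e_def)
          next
            case False
            show ?thesis
            proof (cases "j \<le> p")
              case True
              then have eq: "i - j = (p - j) + i div l * l" using i_eq by linarith
              have "(i - j) mod l = p - j" unfolding eq mod_mult_self1 using p by simp
              moreover have "2 * l + p - j = 2 * l + (p - j)" "3 * l + p - j = 3 * l + (p - j)"
                using True by simp_all
              ultimately show ?thesis using False True by (simp only: e_def if_False simp_thms)
            next
              case jp: False
              have "(i div l - 1) * l + l = i div l * l" using m2 by (simp add: algebra_simps)
              then have eq: "i - j = (l + p - j) + (i div l - 1) * l" using i_eq j by linarith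
              have "(i - j) mod l = l + p - j" unfolding eq mod_mult_self1 using p jp by simp
              moreover have "3 * l + p - j = 2 * l + (l + p - j)" "4 * l + p - j = 3 * l + (l + p - j)"
                using j by simp_all
              moreover have "3 \<le> i div l"
              proof (rule ccontr)
                assume "\<not> 3 \<le> i div l"
                then have "i div l = 2" using m2 by linarith
                then have "i = 2 * l + p" using i_eq by simp
                then show False using False jp j l by linarith
              qed
              ultimately show ?thesis using False by (simp only: e_def if_False simp_thms)
            qed
          qed
          have zero: "u' i x = 0" if old0: "\<And>k. 0 < k \<Longrightarrow> k \<le> 4 \<Longrightarrow> u (k * l + p) x = 0"
          proof -
            have "d' (i - j) = 0" if j: "j \<in> {1..s}" for j
            proof -
              have jl: "j \<le> l" using j s by simp
              have dz: "d (2 * l + p - j) = 0" "d (3 * l + p - j) = 0" "d (4 * l + p - j) = 0"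
                using old_zero[of 2 j] old_zero[of 3 j] old_zero[of 4 j] old0[of 2] old0[of 3] old0[of 4] j
                by simp_all
              have "e (i - j) = 0" using e_old[OF jl] dz by auto
              then show ?thesis using d'_zero[of "i - j"] i2 jl by simp
            qed
            then show ?thesis by (simp add: new_val)
          qed
          have pos: "\<exists>k. 0 < k \<and> k \<le> 4 \<and> u (k * l + p) x = 0" if new0: "u' i x = 0"
          proof -
            have e0: "e (i - j) = 0" if "j \<in> {1..s}" for j
            proof -
              have "l \<le> i - j" using i2 s(2) that by (simp, linarith)
              then show ?thesis using new_zero[OF new0 that] d'_zero by simp
            qed
            have d_sum: "d a = 0 \<and> d b = 0" if "d a + d b = 0" for a b
              using d[of a] d[of b] that by linarith
            show ?thesis
            proof (cases "i div l = 2")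
              case True
              have "d (2 * l + p - j) = 0" if j: "j \<in> {1..s}" for j
                using e0[OF j] e_old[of j] s j True d_sum by auto
              then show ?thesis using old_val[of 2] by (intro exI[of _ 2]) simp
            next
              case False
              have "d (3 * l + p - j) = 0" if j: "j \<in> {1..s}" for j
                using e0[OF j] e_old[of j] s j False d_sum by auto
              then show ?thesis using old_val[of 3] by (intro exI[of _ 3]) simp
            qed
          qed
          show ?thesis
          proof (cases "u' i x = 0")
            case True
            then obtain k where "0 < k" "k \<le> 4" "u (k * l + p) x = 0" using pos by blast
            then show ?thesis using old[of k] True by (cases op) auto
          next
            case False
            then obtain k where k: "0 < k" "k \<le> 4" "u (k * l + p) x \<noteq> 0" using zero by blast
            have ok: "cmp_holds op (u (k * l + p) x) (real c)" "0 < u (k * l + p) x" "0 < u' i x"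
              using old[of k] old_nonneg[of k] k new_nonneg False by auto
            have "u' i x < real c" if "c \<noteq> 0" using small that by (cases c) auto
            then show ?thesis using ok c0 by (cases "c = 0"; cases op) auto
          qed
        qed
      qed
    qed
  qed
  have "summable d'"
  proof (rule summable_comparison_test'[where N = l])
    show "summable (\<lambda>i. (1 / 2 :: real) ^ i)" by (rule summable_geometric) simp
    fix i assume "l \<le> i"
    have "S / (1 + S) \<le> 1" using S by simp
    then have "S / (1 + S) * (1 / 2) ^ Suc i \<le> 1 * (1 / 2) ^ Suc i" by (rule mult_right_mono) simp
    also have "\<dots> \<le> (1 / 2 :: real) ^ i" by simp
    finally show "norm (d' i) \<le> (1 / 2) ^ i" using d'_le[OF \<open>l \<le> i\<close>] d'_nonneg[of i] by simp
  qed
  then show ?thesis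
    unfolding zeno_from_def
    by (intro exI[of _ u'] exI[of _ t] exI[of _ d']) (use t guards' d'_nonneg u'_0 u'_Suc in auto)
qed

section \<open>Zeno runs and paths of the zone graph\<close>

text \<open>
  If \<open>r\<close> is the row of the clock \<open>z\<close> in the DBM of a zone, then \<open>nonpos (r ! x)\<close> says
  that \<open>z \<le> x\<close> holds in the zone.
\<close>

definition edge_ok :: "bound list \<Rightarrow> transition \<Rightarrow> bool" where
  "edge_ok r t \<longleftrightarrow> (\<forall>x\<in>lifted_by t. x < length r \<and> nonpos (r ! x)) \<and>
     (\<forall>x\<in>set (resets t). \<not> (x < length r \<and> nonpos (r ! x)))"

definition has_ok_path :: "(node \<times> transition \<times> node) list \<Rightarrow> bound list \<Rightarrow> bool" where
  "has_ok_path es r \<longleftrightarrow> (\<exists>e :: nat \<Rightarrow> node \<times> transition \<times> node. \<forall>i. e i \<in> set es \<and>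
     edge_ok r (fst (snd (e i))) \<and> fst (e (Suc i)) = snd (snd (e i)))"

lemma lifted_by_clock:
  "timed_automaton A \<Longrightarrow> t \<in> set (trans A) \<Longrightarrow> x \<in> lifted_by t \<Longrightarrow> x \<in> {1..nclocks A}"
  unfolding lifted_by_def using guard_clock by blast

lemma canonical_dbm_nth: "i \<le> n \<Longrightarrow> canonical_dbm n Z ! i = map (canonical_entry Z i) [0..<Suc n]"
  by (simp add: canonical_dbm_def nth_append del: upt_Suc)

text \<open>Instances list only codes of nodes. Injectivity turns a path or a cycle of codes into
  one of the zone graph.\<close>

lemma inj_on_node_of:
  assumes A: "timed_automaton A"
  shows "inj_on (node_of A) (zg_extra_nodes A)"
proof (rule inj_onI)
  fix m m' assume m: "m \<in> zg_extra_nodes A" "m' \<in> zg_extra_nodes A" and eq: "node_of A m = node_of A m'"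
  have "fst m = fst m'" and dbm: "canonical_dbm (nclocks A) (snd m) = canonical_dbm (nclocks A) (snd m')"
    using eq by (auto simp: node_of_def split: prod.splits)
  have "canonical_entry (snd m) i j = canonical_entry (snd m') i j" if "i \<le> nclocks A" "j \<le> nclocks A" for i j
    using arg_cong[OF dbm, of "\<lambda>D. D ! i ! j"] that
    by (simp add: canonical_dbm_nth del: upt_Suc)
  then have "dbm_set (nclocks A) (canonical_entry (snd m)) = dbm_set (nclocks A) (canonical_entry (snd m'))"
    by (simp add: dbm_set_def)
  then have "snd m = snd m'" using zg_nodes_zone(4)[OF A] m by simp
  with \<open>fst m = fst m'\<close> show "m = m'" by (simp add: prod_eq_iff)
qed

text \<open>The list \<open>r\<close> acts as a separator: along the path, clocks inside it are not
  reset and clocks outside it are not lifted. The segment between two visits of a node is a cycle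
  with the disjointness that \<open>zeno_from_cycle\<close> asks for.\<close>

lemma has_zeno_run_of_ok_path:
  assumes inst: "(A, ns, es) \<in> ZP_instances extra_LwU" and path: "has_ok_path es r"
  shows "has_zeno_run A"
proof -
  have A: "timed_automaton A" and ns: "set ns = node_of A ` zg_extra_nodes A"
    and es: "set es = (\<lambda>(m, t, m'). (node_of A m, t, node_of A m')) ` zg_edges A (extra_LwU A)"
    using inst by (auto simp: ZP_instances_def)
  obtain e where e: "\<And>i. e i \<in> set es" "\<And>i. edge_ok r (fst (snd (e i)))"
    "\<And>i. fst (e (Suc i)) = snd (snd (e i))"
    using path unfolding has_ok_path_def by blast
  have "\<exists>m t m'. (m, t, m') \<in> zg_edges A (extra_LwU A) \<and> e i = (node_of A m, t, node_of A m')" for i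
    using e(1)[of i] unfolding es by auto blast
  then obtain m t m' where edge: "\<And>i. (m i, t i, m' i) \<in> zg_edges A (extra_LwU A)"
    and e_eq: "\<And>i. e i = (node_of A (m i), t i, node_of A (m' i))"
    by metis
  have node: "m i \<in> zg_extra_nodes A" and step: "abs_step A (extra_LwU A) (m i) (t i) (m' i)" for i
    using edge[of i] by (auto simp: zg_edges_def)
  have "m' i = m (Suc i)" for i
    using inj_onD[OF inj_on_node_of[OF A]] e(3)[of i] node zg_nodes.step[OF node step] by (simp add: e_eq)
  with step have step: "abs_step A (extra_LwU A) (m i) (t i) (m (Suc i))" for i by metis
  have ok: "edge_ok r (t i)" for i using e(2)[of i] by (simp add: e_eq)
  \<comment> \<open>Finiteness of the graph is taken from the instance, which lists its
    nodes.\<close>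
  have "range (\<lambda>i. node_of A (m i)) \<subseteq> set ns" using node ns by auto
  then have "finite (range (\<lambda>i. node_of A (m i)))" by (rule finite_subset) simp
  then have "\<not> inj (\<lambda>i. node_of A (m i))" using finite_imageD by blast
  then obtain a b where ab: "a < b" "node_of A (m a) = node_of A (m b)"
    unfolding inj_def by (metis linorder_neqE_nat)
  then have m_ab: "m a = m b" using inj_onD[OF inj_on_node_of[OF A]] node by blast
  define l where "l = b - a"
  have l: "0 < l" using ab by (simp add: l_def)
  define M where "M i = m (a + i mod l)" for i
  define T where "T i = t (a + i mod l)" for i
  have path: "abs_step A (extra_LwU A) (M i) (T i) (M (Suc i))" for i
  proof (cases "Suc (i mod l) = l")
    case True
    then have "Suc (a + i mod l) = b" using ab by (simp add: l_def)
    then show ?thesis using True step[of "a + i mod l"] m_ab by (simp add: M_def T_def mod_Suc)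
  next
    case False
    then show ?thesis using step[of "a + i mod l"] by (simp add: M_def T_def mod_Suc)
  qed
  have M0: "M 0 \<in> zg_extra_nodes A" using node by (simp add: M_def)
  obtain u where u: "reachable A (fst (M 0)) (u 0)" "\<And>i. i < 5 * l \<Longrightarrow> ta_step A (T i) (u i) (u (Suc i))"
    using zg_path_concretization[where m = M and t = T and k = "5 * l", OF A M0 path] by blast
  have "zeno_from A (src (T 0)) (u 0)"
  proof (rule zeno_from_cycle[OF A l])
    show "T i \<in> set (trans A)" for i using path[of i] by (simp add: abs_step_iff)
    show "src (T (Suc i)) = tgt (T i)" for i
      using path[of i] path[of "Suc i"] by (simp add: abs_step_iff)
    show "T (i + l) = T i" for i by (simp add: T_def)
    show "valuation (nclocks A) (u 0)" by (rule reachable_valuation[OF A u(1)])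
    show "ta_step A (T i) (u i) (u (Suc i))" if "i < 5 * l" for i using u(2)[OF that] .
    show "set (resets (T i)) \<inter> lifted_by (T j) = {}" for i j
      using ok unfolding edge_ok_def T_def by blast
  qed
  moreover have "src (T 0) = fst (M 0)" using path[of 0] by (simp add: abs_step_iff)
  ultimately show ?thesis using zeno_run_of_reachable u(1) by metis
qed

section \<open>The order of the lifted clocks\<close>

lemma nonpos_sat_bound: "nonpos b \<Longrightarrow> sat_bound r b \<Longrightarrow> r \<le> 0"
  by (cases b) (auto simp: nonpos_def)

text \<open>An entry with constant at most 0 is not above \<open>l \<ge> 0\<close>, so it is never
  dropped; if it is relaxed, the new bound \<open>Lt (- u)\<close> is still nonpositive.\<close>

lemma extra_preserves_order:
  assumes Z: "zone_like (nclocks A) Z" "Z \<noteq> {}" and ij: "i \<le> nclocks A" "j \<le> nclocks A"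
    and L: "L_bound A i = Some l" and U: "weak_U A j = Some u"
    and le: "\<forall>v\<in>Z. v i \<le> v j" and w: "w \<in> extra_LwU A Z"
  shows "w i \<le> w j"
proof -
  have "nonpos (canonical_entry Z i j)"
    using nonpos_canonical_entry[OF Z ij] le by blast
  then have "nonpos (extra_entry (L_bound A i) (weak_U A j) (canonical_entry Z i j))"
    using L_bound_nonneg[OF L] weak_U_nonneg[OF U]
    by (cases "canonical_entry Z i j") (auto simp: L U nonpos_def extra_finite_def)
  moreover have "sat_bound (w i - w j) (extra_entry (L_bound A i) (weak_U A j) (canonical_entry Z i j))"
    using w Z(2) ij by (auto simp: extra_LwU_def dbm_set_def)
  ultimately show ?thesis using nonpos_sat_bound by fastforce
qed

lemma lifted_by_L_bound:
  assumes A: "timed_automaton A" and t: "t \<in> set (trans A)" and x: "x \<in> lifted_by t"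
  shows "\<exists>l. L_bound A x = Some l \<and> 1 \<le> l"
proof -
  obtain op c where xc: "(x, op, c) \<in> set (guard t)" "op \<in> {CEq, CGe, CGt}" "c \<noteq> 0"
    using x by (auto simp: lifted_by_def)
  then have "int c \<in> lower_consts A x" using t by (auto simp: lower_consts_def)
  moreover have "x \<noteq> 0" using guard_clock[OF A t xc(1)] by simp
  ultimately obtain l where "L_bound A x = Some l" "int c \<le> l" using L_bound_ge by blast
  then show ?thesis using xc(3) by auto
qed

text \<open>A lifted clock has \<open>L_bound\<close> at least 1, so its \<open>weak_U\<close> is
  finite, being 1 where \<open>U_bound\<close> is \<open>None\<close>. Hence extrapolation keeps
  comparisons in either direction. So does \<open>post\<close>: delays shift both clocks equally,
  and a reset clock becomes the smaller one.\<close>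

lemma zg_nodes_ordered:
  assumes A: "timed_automaton A" and m: "m \<in> zg_extra_nodes A"
    and x: "t\<^sub>x \<in> set (trans A)" "x \<in> lifted_by t\<^sub>x" and y: "t\<^sub>y \<in> set (trans A)" "y \<in> lifted_by t\<^sub>y"
  shows "(\<forall>v\<in>snd m. v x \<le> v y) \<or> (\<forall>v\<in>snd m. v y \<le> v x)"
proof -
  let ?n = "nclocks A"
  have xy: "x \<in> {1..?n}" "y \<in> {1..?n}" using lifted_by_clock[OF A] x y by blast+
  have bounds: "\<exists>l u. L_bound A z = Some l \<and> weak_U A z = Some u" if "t \<in> set (trans A)" "z \<in> lifted_by t" for t z
    using lifted_by_L_bound[OF A that] by (cases "U_bound A z") (auto simp: weak_U_def)
  have extra: "(\<forall>v\<in>extra_LwU A Z. v x \<le> v y) \<or> (\<forall>v\<in>extra_LwU A Z. v y \<le> v x)"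
    if "zone_like ?n Z" "Z \<noteq> {}" "(\<forall>v\<in>Z. v x \<le> v y) \<or> (\<forall>v\<in>Z. v y \<le> v x)" for Z
    using that bounds[OF x] bounds[OF y] xy extra_preserves_order[OF that(1,2)] by (metis atLeastAtMost_iff)
  show ?thesis
    using m
  proof (induction rule: zg_nodes.induct)
    case start
    have "\<forall>v\<in>initial_zone A. v x \<le> v y" using xy by (auto simp: initial_zone_def delay_def)
    then show ?case using extra[OF zone_like_initial initial_zone_nonempty] by simp
  next
    case (step m t m')
    have t: "t \<in> set (trans A)" and ne: "post A t (snd m) \<noteq> {}" and m': "snd m' = extra_LwU A (post A t (snd m))"
      using step(2) by (simp_all add: abs_step_iff)
    have nonneg: "0 \<le> v x" "0 \<le> v y" if "v \<in> snd m" for v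
      using zone_like_valuation[OF zg_nodes_zone(1)[OF A step(1)] that] valuation_nonneg by auto
    have "(\<forall>v\<in>post A t (snd m). v x \<le> v y) \<or> (\<forall>v\<in>post A t (snd m). v y \<le> v x)"
      using step.IH xy nonneg
      by (cases "x \<in> set (resets t)"; cases "y \<in> set (resets t)")
        (auto simp: mem_post ta_step_def delay_def reset_def)
    then show ?case
      unfolding m' by (rule extra[OF zone_like_post[OF A t zg_nodes_zone(1)[OF A step(1)]] ne])
  qed
qed

text \<open>Each value in \<open>B\<close> has a last occurrence; \<open>N\<close> lies beyond these
  finitely many positions.\<close>

lemma eventually_recurrent:
  assumes "finite (range f)"
  shows "\<exists>N :: nat. \<forall>i\<ge>N. \<forall>j. \<exists>k\<ge>j. f k = f i"
proof -
  define B where "B = {y \<in> range f. \<exists>j. \<forall>k\<ge>j. f k \<noteq> y}"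
  have "\<forall>y\<in>B. \<exists>j. \<forall>k\<ge>j. f k \<noteq> y" by (simp add: B_def)
  then obtain J where J: "\<And>y k. y \<in> B \<Longrightarrow> J y \<le> k \<Longrightarrow> f k \<noteq> y" by metis
  have "finite (J ` B)" using assms by (simp add: B_def)
  then obtain N where "\<forall>j\<in>J ` B. j \<le> N" using finite_nat_set_iff_bounded_le by blast
  then have "f i \<notin> B" if "N \<le> i" for i
    using J[of "f i" i] that order_trans[of "J (f i)" N i] by blast
  then show ?thesis unfolding B_def by blast
qed

text \<open>Comparability in a zone is only a preorder, as distinct clocks may coincide
  there.\<close>

lemma finite_total_least:
  assumes "finite F" "F \<noteq> {}" and "\<And>x y. x \<in> F \<Longrightarrow> y \<in> F \<Longrightarrow> r x y \<or> r y x"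
    and "\<And>x y z. r x y \<Longrightarrow> r y z \<Longrightarrow> r x z"
  shows "\<exists>z\<in>F. \<forall>y\<in>F. r z y"
  using assms(1-3)
proof (induction F rule: finite_ne_induct)
  case (insert x F)
  then obtain z where "z \<in> F" "\<forall>y\<in>F. r z y" by blast
  then show ?case using insert.prems assms(4) by (metis insert_iff)
qed blast

lemma ok_path_of_zeno_run:
  assumes inst: "(A, ns, es) \<in> ZP_instances extra_LwU" and zeno: "has_zeno_run A"
  shows "has_ok_path es [] \<or> (\<exists>m\<in>set ns. \<exists>r\<in>set (snd m). has_ok_path es r)"
proof -
  let ?n = "nclocks A"
  have A: "timed_automaton A" and ns: "set ns = node_of A ` zg_extra_nodes A"
    and es: "set es = (\<lambda>(m, t, m'). (node_of A m, t, node_of A m')) ` zg_edges A (extra_LwU A)"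
    using inst by (auto simp: ZP_instances_def)
  obtain q v \<delta> t where run: "infinite_run A q v \<delta> t" and summable: "summable \<delta>"
    using zeno unfolding has_zeno_run_def by blast
  have q0: "q 0 = init A" and v0: "v 0 = (\<lambda>_. 0)" using run by (simp_all add: infinite_run_def)
  have run_i: "t i \<in> set (trans A)" "0 \<le> \<delta> i" "src (t i) = q i" "q (Suc i) = tgt (t i)"
    "sat_guard (delay ?n (v i) (\<delta> i)) (guard (t i))"
    "v (Suc i) = reset (resets (t i)) (delay ?n (v i) (\<delta> i))" for i
    using run by (simp_all add: infinite_run_def)
  define u where "u i = delay ?n (v i) (\<delta> i)" for i
  have guards: "sat_guard (u i) (guard (t i))" for i using run_i by (simp add: u_def)
  have u_Suc: "u (Suc i) = delay ?n (reset (resets (t i)) (u i)) (\<delta> (Suc i))" for i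
    using run_i(6)[of i] by (simp add: u_def)
  have steps: "ta_step A (t i) (u i) (u (Suc i))" for i
    unfolding ta_step_def using guards u_Suc run_i(2) by blast
  \<comment> \<open>These zones depend only on the transitions of the run; its valuations stay
    inside because the extrapolation is extensive.\<close>
  define W where "W = rec_nat (extra_LwU A (initial_zone A)) (\<lambda>i Z. extra_LwU A (post A (t i) Z))"
  have W_0: "W 0 = extra_LwU A (initial_zone A)" and W_Suc: "W (Suc i) = extra_LwU A (post A (t i) (W i))" for i
    by (simp_all add: W_def)
  have node_step: "abs_step A (extra_LwU A) (q i, W i) (t i) (q (Suc i), W (Suc i)) \<and> u (Suc i) \<in> W (Suc i)"
    if "(q i, W i) \<in> zg_extra_nodes A" "u i \<in> W i" for i
  proof -
    have post: "u (Suc i) \<in> post A (t i) (W i)" using that steps by (auto simp: mem_post)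
    moreover have "zone_like ?n (post A (t i) (W i))"
      using zone_like_post[OF A run_i(1)] zg_nodes_zone(1)[OF A that(1)] by simp
    ultimately show ?thesis
      using extra_extensive run_i zg_nodes_zone(3)[OF A that(1)] by (auto simp: abs_step_iff W_Suc)
  qed
  have node: "(q i, W i) \<in> zg_extra_nodes A \<and> u i \<in> W i" for i
  proof (induction i)
    case 0
    have "u 0 \<in> initial_zone A" using run_i(2)[of 0] by (auto simp: u_def v0 initial_zone_def)
    then show ?case
      using extra_extensive[OF zone_like_initial] zg_nodes.start[of A "extra_LwU A"] by (auto simp: q0 W_0)
  next
    case (Suc i)
    then show ?case using node_step[of i] zg_nodes.step by blast
  qed
  define e where "e i = (node_of A (q i, W i), t i, node_of A (q (Suc i), W (Suc i)))" for i
  have e: "e i \<in> set es" for i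
    unfolding es e_def
    by (rule image_eqI[of _ _ "((q i, W i), t i, (q (Suc i), W (Suc i)))"])
      (use node node_step in \<open>auto simp: zg_edges_def\<close>)
  have "finite (range e)" by (rule finite_subset[of _ "set es"]) (use e in auto)
  then obtain N1 where N1: "\<And>i j. N1 \<le> i \<Longrightarrow> \<exists>k\<ge>j. e k = e i"
    using eventually_recurrent by metis
  \<comment> \<open>Over any finite stretch after \<open>N2\<close> less than 1 elapses, less than
    any positive guard constant.\<close>
  obtain N2 where N2: "\<And>a b. N2 \<le> a \<Longrightarrow> norm (\<Sum>i\<in>{a..<b}. \<delta> i) < 1"
    using summable unfolding summable_Cauchy by (metis zero_less_one)
  define N where "N = max N1 N2"
  have recur: "\<exists>k\<ge>j. t k = t i \<and> W k = W i" if "N \<le> i" for i j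
  proof -
    obtain k where k: "j \<le> k" "e k = e i" using N1[of i j] \<open>N \<le> i\<close> by (auto simp: N_def)
    then have "node_of A (q k, W k) = node_of A (q i, W i)" "t k = t i" by (simp_all add: e_def)
    then show ?thesis using k(1) inj_onD[OF inj_on_node_of[OF A]] node by blast
  qed
  have small: "u k x < 1" if "N \<le> j" "j < k" "x \<in> set (resets (t j))" for x j k
  proof -
    have "set (resets (t j)) \<subseteq> {1..?n}" using A run_i(1) by (auto simp: timed_automaton_def)
    then have x: "x \<in> {1..?n}" using that by blast
    have "u k x \<le> (\<Sum>i\<in>{Suc j..<Suc k}. \<delta> i)"
      using \<open>j < k\<close>[THEN Suc_leI]
    proof (induction k rule: dec_induct)
      case base
      then show ?case using that x by (simp add: u_Suc delay_def reset_def)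
    next
      case (step k)
      have "0 \<le> (\<Sum>i\<in>{Suc j..<Suc k}. \<delta> i)" using run_i(2) by (simp add: sum_nonneg)
      then have "u (Suc k) x \<le> (\<Sum>i\<in>{Suc j..<Suc k}. \<delta> i) + \<delta> (Suc k)"
        using step.IH x by (auto simp: u_Suc[of k] delay_def reset_def)
      then show ?case using step.hyps by simp
    qed
    also have "\<dots> < 1" using N2[of "Suc j" "Suc k"] that by (simp add: N_def)
    finally show ?thesis .
  qed
  define F where "F = (\<Union>i\<in>{N..}. lifted_by (t i))"
  have path: "has_ok_path es r" if "\<And>i. N \<le> i \<Longrightarrow> edge_ok r (t i)" for r
    unfolding has_ok_path_def
    by (rule exI[of _ "\<lambda>i. e (N + i)"]) (use e that in \<open>auto simp: e_def\<close>)
  have F_lifted: "\<exists>k\<ge>j. x \<in> lifted_by (t k)" if x: "x \<in> F" for x j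
  proof -
    obtain i where "N \<le> i" "x \<in> lifted_by (t i)" using x by (auto simp: F_def)
    then show ?thesis using recur[of i j] by metis
  qed
  \<comment> \<open>A clock that is lifted again and again is never reset: it would have to reach \<open>1\<close> afterwards.\<close>
  have F_not_reset: "x \<notin> set (resets (t j))" if x: "x \<in> F" and j: "N \<le> j" for x j
  proof
    assume r: "x \<in> set (resets (t j))"
    obtain k where "j < k" "x \<in> lifted_by (t k)" using F_lifted[OF x, of "Suc j"] by (auto simp: Suc_le_eq)
    then show False using small[OF j _ r] lifted_by_ge_1[OF _ guards] by fastforce
  qed
  show ?thesis
  proof (cases "F = {}")
    case True
    then have "edge_ok [] (t i)" if "N \<le> i" for i
      using that by (auto simp: edge_ok_def F_def)
    then show ?thesis using path by blast
  next
    case False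
    have F_clocks: "F \<subseteq> {1..?n}" using lifted_by_clock[OF A run_i(1)] by (auto simp: F_def)
    have "\<exists>z\<in>F. \<forall>y\<in>F. \<forall>v\<in>W N. v z \<le> v y"
    proof (rule finite_total_least[OF finite_subset[OF F_clocks] False])
      fix x y assume "x \<in> F" "y \<in> F"
      then obtain i j where "x \<in> lifted_by (t i)" "y \<in> lifted_by (t j)" by (auto simp: F_def)
      then show "(\<forall>v\<in>W N. v x \<le> v y) \<or> (\<forall>v\<in>W N. v y \<le> v x)"
        using zg_nodes_ordered[OF A conjunct1[OF node[of N]] run_i(1)[of i] _ run_i(1)[of j]] by simp
    qed (auto intro: order_trans)
    then obtain z where z: "z \<in> F" "\<And>y v. y \<in> F \<Longrightarrow> v \<in> W N \<Longrightarrow> v z \<le> v y" by blast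
    have zn: "z \<in> {1..?n}" using z F_clocks by blast
    define r where "r = map (canonical_entry (W N) z) [0..<Suc ?n]"
    have len: "length r = Suc ?n" by (simp add: r_def)
    have nonpos_r: "nonpos (r ! y) \<longleftrightarrow> (\<forall>v\<in>W N. v z \<le> v y)" if "y \<le> ?n" for y
      using nonpos_canonical_entry[OF zg_nodes_zone(1,2)[OF A conjunct1[OF node[of N]]], of z y] that zn
      by (simp add: r_def del: upt_Suc)
    have "edge_ok r (t i)" if i: "N \<le> i" for i
      unfolding edge_ok_def
    proof (intro conjI ballI notI)
      fix y assume "y \<in> lifted_by (t i)"
      then have y: "y \<in> F" using i by (auto simp: F_def)
      then have "y \<le> ?n" using F_clocks by auto
      then show "y < length r" "nonpos (r ! y)" using nonpos_r z(2)[OF y] len by auto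
    next
      fix y assume y: "y \<in> set (resets (t i))" "y < length r \<and> nonpos (r ! y)"
      then have le: "v z \<le> v y" if "v \<in> W N" for v using nonpos_r that len by auto
      obtain k0 where k0: "N \<le> k0" "z \<in> lifted_by (t k0)" using F_lifted[OF z(1)] by blast
      have z_ge: "1 \<le> u k z" if "k0 \<le> k" for k
        using that
      proof (induction k rule: dec_induct)
        case base
        then show ?case using lifted_by_ge_1[OF k0(2) guards] .
      next
        case (step k)
        then show ?case
          using F_not_reset[OF z(1), of k] k0 run_i(2)[of "Suc k"] zn by (simp add: u_Suc delay_def reset_def)
      qed
      \<comment> \<open>The reset of \<open>y\<close> recurs after \<open>k0\<close>, and the zone
        \<open>W N\<close> recurs after that. There \<open>y\<close> is below 1 and \<open>z\<close>
        at least 1, although \<open>z \<le> y\<close> holds in \<open>W N\<close>.\<close>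
      obtain j where j: "k0 \<le> j" "t j = t i" using recur[OF i] by metis
      obtain k where k: "Suc j \<le> k" "W k = W N" using recur[of N "Suc j"] by auto
      have "u k y < 1" using small[of j k y] j k k0 y by simp
      moreover have "u k z \<le> u k y" using le node[of k] k by simp
      moreover have "1 \<le> u k z" using z_ge j k by simp
      ultimately show False by linarith
    qed
    then have "has_ok_path es r" by (rule path)
    moreover have "node_of A (q N, W N) \<in> set ns" using node ns by blast
    moreover have "r \<in> set (snd (node_of A (q N, W N)))"
      using zn by (auto simp: node_of_def canonical_dbm_def r_def simp del: upt_Suc intro!: image_eqI[of _ _ z])
    ultimately show ?thesis by blast
  qed
qed

section \<open>Correctness on encoded instances\<close>

lemma enc_bool_inject [simp]: "enc_bool a = enc_bool b \<longleftrightarrow> a = b"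
  by (cases a; cases b) auto

lemma enc_nat_eq_NIL [simp]: "enc_nat n = NIL \<longleftrightarrow> n = 0"
  by (subst enc_nat.simps) simp

lemma enc_nat_inject [simp]: "enc_nat m = enc_nat n \<longleftrightarrow> m = n"
proof
  show "enc_nat m = enc_nat n \<Longrightarrow> m = n"
  proof (induction m arbitrary: n rule: less_induct)
    case (less m)
    show ?case
    proof (cases "m = 0 \<or> n = 0")
      case True
      then show ?thesis using less.prems enc_nat_eq_NIL by metis
    next
      case False
      then have "odd m = odd n" "enc_nat (m div 2) = enc_nat (n div 2)"
        using less.prems enc_nat.simps[of m] enc_nat.simps[of n] by auto
      moreover have "m div 2 < m" using False by simp
      ultimately have "m div 2 = n div 2" by (intro less.IH)
      moreover have "m mod 2 = n mod 2" using \<open>odd m = odd n\<close> by (simp add: mod2_eq_if)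
      ultimately show ?thesis
        by (metis div_mult_mod_eq)
    qed
  qed
qed simp

lemma enc_int_inject [simp]: "enc_int a = enc_int b \<longleftrightarrow> a = b"
  by (auto simp: enc_int_def)

lemma enc_bound_inject [simp]: "enc_bound a = enc_bound b \<longleftrightarrow> a = b"
  by (cases a; cases b) auto

lemma inj_enc_list: "inj f \<Longrightarrow> inj (enc_list f)"
  by (metis injI inj_map_eq_map items_enc_list)

text \<open>Trimming compares nodes as trees; injectivity makes this comparison faithful.\<close>

lemma enc_node_inject [simp]: "enc_node m = enc_node m' \<longleftrightarrow> m = m'"
proof -
  have "inj (enc_list (enc_list enc_bound))"
    by (intro inj_enc_list injI) simp
  then show ?thesis by (auto simp: enc_node_def inj_eq split: prod.splits)
qed

lemma nonpos_tree_nth: "nonpos_tree (nth_tree (map enc_bound r) y) \<longleftrightarrow> y < length r \<and> nonpos (r ! y)"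
  by (cases "r ! y") (auto simp: nonpos_tree_def nth_tree_def nonpos_def enc_int_def)

lemma right_enc_cmp_eq_NIL: "right (enc_cmp op) = NIL \<longleftrightarrow> op \<notin> {CEq, CGe, CGt}"
  by (cases op) (auto simp: enc_nat.simps[of 0] enc_nat.simps[of "Suc 0"] enc_nat.simps[of 2] enc_nat.simps[of 3] enc_nat.simps[of 4])

definition enc_edge :: "node \<times> transition \<times> node \<Rightarrow> tree" where
  "enc_edge = (\<lambda>(m, t, m'). Cell (enc_node m) (Cell (enc_transition t) (enc_node m')))"

lemma edge_ok_tree_enc: "edge_ok_tree (enc_list enc_bound r) (enc_edge e) \<longleftrightarrow> edge_ok r (fst (snd e))"
proof -
  let ?t = "fst (snd e)"
  have "items (left (right (left (right (enc_edge e))))) =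
      map (\<lambda>(x, op, c). Cell (enc_nat x) (Cell (enc_cmp op) (enc_nat c))) (guard ?t)"
    and "items (left (right (right (left (right (enc_edge e)))))) = map enc_nat (resets ?t)"
    by (simp_all add: enc_edge_def enc_transition_def enc_guard_def split: prod.split)
  moreover have "(\<forall>g\<in>set (map (\<lambda>(x, op, c). Cell (enc_nat x) (Cell (enc_cmp op) (enc_nat c))) (guard ?t)).
      right (left (right g)) \<noteq> NIL \<and> right (right g) \<noteq> NIL \<longrightarrow>
        nonpos_tree (lookup (enc_list enc_bound r) (left g))) \<longleftrightarrow>
      (\<forall>(x, op, c)\<in>set (guard ?t). op \<in> {CEq, CGe, CGt} \<and> c \<noteq> 0 \<longrightarrow> x < length r \<and> nonpos (r ! x))"
    unfolding set_map ball_simps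
    by (rule ball_cong[OF refl])
      (simp add: lookup_enc_nat nonpos_tree_nth right_enc_cmp_eq_NIL split: prod.split)
  moreover have "\<dots> \<longleftrightarrow> (\<forall>x\<in>lifted_by ?t. x < length r \<and> nonpos (r ! x))"
    unfolding lifted_by_def by blast
  ultimately show ?thesis
    by (simp only: edge_ok_tree_def edge_ok_def set_map ball_simps lookup_enc_nat items_enc_list nonpos_tree_nth)
qed

lemma row_ok_tree_enc: "row_ok_tree (enc_list enc_bound r) (enc_list enc_edge es) \<longleftrightarrow> has_ok_path es r"
proof -
  have filter_enc: "set (filter (edge_ok_tree (enc_list enc_bound r)) (items (enc_list enc_edge es))) =
      enc_edge ` {e \<in> set es. edge_ok r (fst (snd e))}"
    unfolding items_enc_list set_filter set_map using edge_ok_tree_enc by blast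
  have "row_ok_tree (enc_list enc_bound r) (enc_list enc_edge es) \<longleftrightarrow>
      (\<exists>f :: nat \<Rightarrow> tree. \<forall>i. f i \<in> enc_edge ` {e \<in> set es. edge_ok r (fst (snd e))} \<and>
         left (f (Suc i)) = right (right (f i)))"
    unfolding row_ok_tree_def trim_all_tree_nonempty_iff
    unfolding items_of_items filter_enc ..
  also have "\<dots> \<longleftrightarrow> has_ok_path es r"
  proof
    assume "\<exists>f :: nat \<Rightarrow> tree. \<forall>i. f i \<in> enc_edge ` {e \<in> set es. edge_ok r (fst (snd e))} \<and>
         left (f (Suc i)) = right (right (f i))"
    then obtain f :: "nat \<Rightarrow> tree" where f: "\<And>i. f i \<in> enc_edge ` {e \<in> set es. edge_ok r (fst (snd e))}"
      "\<And>i. left (f (Suc i)) = right (right (f i))" by blast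
    then have "\<forall>i. \<exists>e. f i = enc_edge e \<and> e \<in> set es \<and> edge_ok r (fst (snd e))" by blast
    then obtain e where e: "\<And>i. f i = enc_edge (e i)" "\<And>i. e i \<in> set es" "\<And>i. edge_ok r (fst (snd (e i)))"
      by metis
    have "fst (e (Suc i)) = snd (snd (e i))" for i
      using f(2)[of i] by (auto simp: e enc_edge_def split: prod.splits)
    then show "has_ok_path es r" using e unfolding has_ok_path_def by blast
  next
    assume "has_ok_path es r"
    then obtain e where e: "\<And>i. e i \<in> set es" "\<And>i. edge_ok r (fst (snd (e i)))"
      "\<And>i :: nat. fst (e (Suc i)) = snd (snd (e i))" unfolding has_ok_path_def by blast
    have "left (enc_edge (e (Suc i))) = right (right (enc_edge (e i)))" for i
      using e(3)[of i] by (auto simp: enc_edge_def split: prod.splits)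
    then show "\<exists>f :: nat \<Rightarrow> tree. \<forall>i. f i \<in> enc_edge ` {e \<in> set es. edge_ok r (fst (snd e))} \<and>
         left (f (Suc i)) = right (right (f i))"
      using e by (intro exI[of _ "\<lambda>i. enc_edge (e i)"]) blast
  qed
  finally show ?thesis .
qed

lemma zeno_tree_enc_instance:
  assumes "(A, ns, es) \<in> ZP_instances extra_LwU"
  shows "zeno_tree (enc_instance (A, ns, es)) \<longleftrightarrow> has_zeno_run A"
proof -
  have enc: "enc_instance (A, ns, es) = Cell (enc_ta A) (Cell (enc_list enc_node ns) (enc_list enc_edge es))"
    by (simp add: enc_instance_def enc_edge_def)
  have "row_ok_tree NIL (enc_list enc_edge es) \<longleftrightarrow> has_ok_path es []"
    using row_ok_tree_enc[of "[]" es] by (simp add: enc_list_def)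
  moreover have "items (right (enc_node m)) = map (enc_list enc_bound) (snd m)" for m
    by (auto simp: enc_node_def split: prod.splits)
  ultimately have "zeno_tree (enc_instance (A, ns, es)) \<longleftrightarrow>
      has_ok_path es [] \<or> (\<exists>m\<in>set ns. \<exists>r\<in>set (snd m). has_ok_path es r)"
    by (simp add: zeno_tree_def enc row_ok_tree_enc)
  then show ?thesis
    using ok_path_of_zeno_run[OF assms] has_zeno_run_of_ok_path[OF assms] by blast
qed

lemma ZP_in_polytime_extra_LwU: "ZP_in_polytime extra_LwU"
proof -
  have "zeno_tree (enc_instance i) \<longleftrightarrow> (\<lambda>(A, _, _). has_zeno_run A) i"
    if "i \<in> ZP_instances extra_LwU" for i
    using that zeno_tree_enc_instance by (cases i) simp
  then show ?thesis
    using polytime_solvable_pdec[OF pdec_zeno_tree, of enc_instance "ZP_instances extra_LwU"]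
    unfolding ZP_in_polytime_def polytime_solvable_def by (metis (no_types, lifting))
qed

section \<open>Lift-safety\<close>

text \<open>If no atom bounds \<open>x\<close> below by a positive constant, a satisfying valuation
  stays satisfying when \<open>x\<close> is lowered to \<open>1 / 2\<close>. This value meets
  \<open>x > 0\<close>, and an atom \<open>x = 0\<close> would contradict the implied
  \<open>x \<ge> 1\<close>.\<close>

lemma lifted_clocks_lifted_by:
  assumes "satisfiable_guards A" "x \<in> lifted_clocks A"
  shows "\<exists>t\<in>set (trans A). x \<in> lifted_by t"
proof -
  obtain t where x: "x \<in> {1..nclocks A}" and t: "t \<in> set (trans A)"
    and implied: "\<And>v. valuation (nclocks A) v \<Longrightarrow> sat_guard v (guard t) \<Longrightarrow> 1 \<le> v x"
    using assms(2) by (auto simp: lifted_clocks_def)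
  obtain v where v: "valuation (nclocks A) v" "sat_guard v (guard t)"
    using assms(1) t by (auto simp: satisfiable_guards_def)
  have "x \<in> lifted_by t"
  proof (rule ccontr)
    assume nx: "x \<notin> lifted_by t"
    have "valuation (nclocks A) (v(x := 1 / 2))"
      using v(1) x by (auto simp: valuation_def)
    moreover have "sat_guard (v(x := 1 / 2)) (guard t)"
      unfolding sat_guard_def
    proof clarify
      fix y op c assume yc: "(y, op, c) \<in> set (guard t)"
      have *: "cmp_holds op (v y) (real c)" using v(2) yc by (auto simp: sat_guard_def)
      show "cmp_holds op ((v(x := 1 / 2)) y) (real c)"
      proof (cases "y = x")
        case True
        have "c = 0" if "op \<in> {CEq, CGe, CGt}"
          using nx yc that unfolding True lifted_by_def by blast
        then show ?thesis
          using * implied[OF v] True by (cases op) auto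
      qed (use * in simp)
    qed
    ultimately show False using implied[of "v(x := 1 / 2)"] by simp
  qed
  with t show ?thesis by blast
qed

text \<open>The assumptions give \<open>weak_U A x\<close> at least 1. The entry for
  \<open>0 - x\<close> is at most -1 and can only be relaxed to \<open>Lt (- u)\<close> with
  \<open>u \<ge> 1\<close>, so \<open>x \<ge> 1\<close> survives.\<close>

lemma lift_safe_extra_LwU:
  assumes A: "timed_automaton A" "satisfiable_guards A"
    and U: "\<forall>x\<in>lifted_clocks A. U_bound A x \<noteq> Some 0"
  shows "lift_safe A (extra_LwU A)"
  unfolding lift_safe_def
proof (intro allI impI ballI iffI)
  fix Z x v
  assume zone: "zone (nclocks A) Z" and x: "x \<in> lifted_clocks A"
    and ge: "\<forall>v\<in>Z. 1 \<le> v x" and v: "v \<in> extra_LwU A Z"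
  have Z: "zone_like (nclocks A) Z" "Z \<noteq> {}"
    using zone_like_zone[OF zone] v by (auto simp: extra_LwU_def)
  have xn: "0 \<le> nclocks A" "x \<le> nclocks A" using x by (auto simp: lifted_clocks_def)
  obtain l where l: "L_bound A x = Some l" "1 \<le> l"
    using lifted_clocks_lifted_by[OF A(2) x] lifted_by_L_bound[OF A(1)] by blast
  obtain u where u: "weak_U A x = Some u" "1 \<le> u"
  proof (cases "U_bound A x")
    case None
    then show ?thesis using l that[of 1] by (simp add: weak_U_def)
  next
    case (Some u)
    then show ?thesis using U x U_bound_nonneg[OF Some] that[of u] weak_U_eq[OF Some] by fastforce
  qed
  let ?b = "canonical_entry Z 0 x"
  have unsat: "\<not> sat_bound r ?b" if r: "-1 < r" for r
  proof
    assume "sat_bound r ?b"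
    then obtain w where w: "w \<in> Z" "r \<le> w 0 - w x" using canonical_entry_tight(2)[OF Z xn] by blast
    then show False using ge r zone_like_valuation[OF Z(1) w(1)] by fastforce
  qed
  have "sat_bound (v 0 - v x) (extra_entry (L_bound A 0) (weak_U A x) ?b)"
    using v Z(2) xn by (auto simp: extra_LwU_def dbm_set_def simp del: L_bound_0)
  then have "sat_bound (v 0 - v x) (extra_entry (Some 0) (Some u) ?b)"
    by (simp add: u)
  moreover have "r \<le> -1" if r: "sat_bound r (extra_entry (Some 0) (Some u) ?b)" for r
  proof (cases ?b)
    case (Le c)
    then have "c \<le> -1" using unsat[of "real_of_int c"] by (intro ccontr[of "c \<le> -1"]) simp
    then show ?thesis using r u(2) by (auto simp: Le extra_finite_def split: if_splits)
  next
    case (Lt c)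
    then have "c \<le> -1" using unsat[of "real_of_int c - 1 / 2"] by (intro ccontr[of "c \<le> -1"]) simp
    then show ?thesis using r u(2) by (auto simp: Lt extra_finite_def split: if_splits)
  next
    case Inf
    then show ?thesis using unsat[of 0] by simp
  qed
  moreover have "v 0 = 0" using v zone_like_extra zone_like_valuation valuation_0 by blast
  ultimately show "1 \<le> v x" by fastforce
next
  fix Z x v
  assume "zone (nclocks A) Z" "\<forall>v\<in>extra_LwU A Z. 1 \<le> v x" "v \<in> Z"
  then show "1 \<le> v x" using extra_extensive[OF zone_like_zone] by blast
qed

text \<open>Lift-safety for all automata is refuted by \<open>satisfiable_not_lift_safe\<close>. For
  satisfiable guards the condition on \<open>U_bound\<close> is also necessary, by
  \<open>lift_safe_imp_weak_U\<close>. The complexity claim covers every timed automaton.\<close>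

theorem theorem4p11:
  shows "(\<forall>A. timed_automaton A \<and> satisfiable_guards A \<and> (\<forall>x\<in>lifted_clocks A. U_bound A x \<noteq> Some 0)
            \<longrightarrow> lift_safe A (extra_LwU A)) \<and>
         ZP_in_polytime extra_LwU"
  using lift_safe_extra_LwU ZP_in_polytime_extra_LwU by blast

end
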